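(* Let $H\in(0,1)$ and $K\in(1,2)$ be such that $2HK=1$. Then the bifractional Brownian motion $B^{H,K}$ with parameters $H$ and $K$ is a semimartingale.
   Context: For $H\in(0,1)$ and $K\in(1,2)$ with $HK\in(0,1)$, the bifractional Brownian motion $B^{H,K}=(B^{H,K}_t,\ t\ge0)$ is the (continuous version of the) centered Gaussian process with covariance function $$E\left(B^{H,K}_tB^{H,K}_s\right)=\frac{1}{2^K}\left(\left(t^{2H}+s^{2H}\right)^K-|t-s|^{2HK}\right),\qquad s,t\ge 0,$$ which exists for these parameters. The semimartingale property is understood with respect to the process's own natural filtration (with the usual augmentation). *)

theory Defs
  imports "HOL-Probability.Probability"
begin

text \<open>
  Stochastic processes are functions \<open>X :: real \<Rightarrow> 'a \<Rightarrow> real\<close>, and filtrations are functions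
  \<open>F :: real \<Rightarrow> 'a measure\<close>. The time set is \<open>[0, \<infinity>)\<close>: the values of a process at negative
  times are never used.
\<close>

subsection \<open>Gaussian processes and bifractional Brownian motion\<close>

text \<open>A point mass counts as a (degenerate) Gaussian law; \<open>normal_density \<mu> \<sigma>\<close> needs \<open>\<sigma> > 0\<close>.\<close>

definition gaussian_rv :: "'a measure \<Rightarrow> ('a \<Rightarrow> real) \<Rightarrow> bool" where
  "gaussian_rv M Y \<longleftrightarrow> Y \<in> borel_measurable M \<and>
     ((\<exists>\<mu> \<sigma>. \<sigma> > 0 \<and> distributed M lborel Y (\<lambda>x. ennreal (normal_density \<mu> \<sigma> x))) \<or>
      (\<exists>c. AE \<omega> in M. Y \<omega> = c))"

definition gaussian_process :: "'a measure \<Rightarrow> (real \<Rightarrow> 'a \<Rightarrow> real) \<Rightarrow> bool" where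
  "gaussian_process M X \<longleftrightarrow>
     (\<forall>J c. finite J \<and> J \<subseteq> {0..} \<longrightarrow> gaussian_rv M (\<lambda>\<omega>. \<Sum>t\<in>J. c t * X t \<omega>))"

text \<open>In the covariance, \<open>0 powr a = 0\<close> agrees with the usual convention since all exponents
  are positive.\<close>

definition bifractional_brownian_motion ::
    "real \<Rightarrow> real \<Rightarrow> 'a measure \<Rightarrow> (real \<Rightarrow> 'a \<Rightarrow> real) \<Rightarrow> bool" where
  "bifractional_brownian_motion H K M B \<longleftrightarrow>
     gaussian_process M B \<and>
     (\<forall>t\<ge>0. (\<integral>\<omega>. B t \<omega> \<partial>M) = 0) \<and>
     (\<forall>t\<ge>0. \<forall>s\<ge>0. (\<integral>\<omega>. B t \<omega> * B s \<omega> \<partial>M) =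
        1 / 2 powr K * ((t powr (2 * H) + s powr (2 * H)) powr K - \<bar>t - s\<bar> powr (2 * H * K))) \<and>
     (AE \<omega> in M. continuous_on {0..} (\<lambda>t. B t \<omega>))"

subsection \<open>The natural filtration and its usual augmentation\<close>

definition natural_filtration ::
    "'a measure \<Rightarrow> (real \<Rightarrow> 'a \<Rightarrow> real) \<Rightarrow> real \<Rightarrow> 'a measure" where
  "natural_filtration M X t =
     sigma (space M) {X s -` A \<inter> space M | s A. 0 \<le> s \<and> s \<le> t \<and> A \<in> sets borel}"

text \<open>
  The augmentation adjoins all \<open>M\<close>-negligible sets and makes the result right-continuous.
  Its \<open>\<sigma>\<close>-algebras are contained in \<open>sets (completion M)\<close>, in general not in \<open>sets M\<close>, so
  that the underlying measure space becomes \<open>completion M\<close>.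
\<close>

definition usual_augmentation :: "'a measure \<Rightarrow> (real \<Rightarrow> 'a measure) \<Rightarrow> real \<Rightarrow> 'a measure" where
  "usual_augmentation M F t =
     sigma (space M)
       (\<Inter>u\<in>{t<..}. sigma_sets (space M) (sets (F u) \<union> null_sets (completion M)))"

definition filtered_prob_space :: "'a measure \<Rightarrow> (real \<Rightarrow> 'a measure) \<Rightarrow> bool" where
  "filtered_prob_space M F \<longleftrightarrow>
     prob_space M \<and> filtration (space M) F \<and> (\<forall>t. subalgebra M (F t))"

subsection \<open>Semimartingales\<close>

definition adapted :: "(real \<Rightarrow> 'a measure) \<Rightarrow> (real \<Rightarrow> 'a \<Rightarrow> real) \<Rightarrow> bool" where
  "adapted F X \<longleftrightarrow> (\<forall>t\<ge>0. X t \<in> borel_measurable (F t))"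

definition cadlag :: "(real \<Rightarrow> real) \<Rightarrow> bool" where
  "cadlag f \<longleftrightarrow>
     (\<forall>t\<ge>0. (f \<longlongrightarrow> f t) (at_right t)) \<and> (\<forall>t>0. \<exists>l. (f \<longlongrightarrow> l) (at_left t))"

definition locally_finite_variation :: "(real \<Rightarrow> real) \<Rightarrow> bool" where
  "locally_finite_variation f \<longleftrightarrow>
     (\<forall>b\<ge>0. \<exists>C. \<forall>n. \<forall>p :: nat \<Rightarrow> real. mono_on {..n} p \<and> p ` {..n} \<subseteq> {0..b} \<longrightarrow>
        (\<Sum>i<n. \<bar>f (p (Suc i)) - f (p i)\<bar>) \<le> C)"

definition martingale ::
    "'a measure \<Rightarrow> (real \<Rightarrow> 'a measure) \<Rightarrow> (real \<Rightarrow> 'a \<Rightarrow> real) \<Rightarrow> bool" where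
  "martingale M F X \<longleftrightarrow> adapted F X \<and> (\<forall>t\<ge>0. integrable M (X t)) \<and>
     (\<forall>s t. 0 \<le> s \<and> s \<le> t \<longrightarrow> (AE \<omega> in M. real_cond_exp M (F s) (X t) \<omega> = X s \<omega>))"

text \<open>Stopping times take values in \<open>[0, \<infinity>]\<close> while \<open>F\<close> is indexed by real times, so the
  type of the library's \<open>stopping_time\<close> does not fit.\<close>

definition ext_stopping_time :: "(real \<Rightarrow> 'a measure) \<Rightarrow> ('a \<Rightarrow> ennreal) \<Rightarrow> bool" where
  "ext_stopping_time F T \<longleftrightarrow> (\<forall>t\<ge>0. Measurable.pred (F t) (\<lambda>\<omega>. T \<omega> \<le> ennreal t))"

definition stopped :: "('a \<Rightarrow> ennreal) \<Rightarrow> (real \<Rightarrow> 'a \<Rightarrow> real) \<Rightarrow> real \<Rightarrow> 'a \<Rightarrow> real" where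
  "stopped T X t \<omega> = X (enn2real (min (ennreal t) (T \<omega>))) \<omega>"

text \<open>Path properties are required almost surely, that is, processes are considered up to
  indistinguishability.\<close>

definition local_martingale ::
    "'a measure \<Rightarrow> (real \<Rightarrow> 'a measure) \<Rightarrow> (real \<Rightarrow> 'a \<Rightarrow> real) \<Rightarrow> bool" where
  "local_martingale M F X \<longleftrightarrow>
     adapted F X \<and> (AE \<omega> in M. cadlag (\<lambda>t. X t \<omega>)) \<and>
     (\<exists>T :: nat \<Rightarrow> 'a \<Rightarrow> ennreal.
        (\<forall>n. ext_stopping_time F (T n)) \<and>
        (AE \<omega> in M. incseq (\<lambda>n. T n \<omega>) \<and> (\<lambda>n. T n \<omega>) \<longlonglongrightarrow> \<infinity>) \<and>
        (\<forall>n. martingale M F (\<lambda>t \<omega>. stopped (T n) X t \<omega> - X 0 \<omega>)))"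

definition finite_variation_process ::
    "'a measure \<Rightarrow> (real \<Rightarrow> 'a measure) \<Rightarrow> (real \<Rightarrow> 'a \<Rightarrow> real) \<Rightarrow> bool" where
  "finite_variation_process M F A \<longleftrightarrow>
     adapted F A \<and>
     (AE \<omega> in M. cadlag (\<lambda>t. A t \<omega>) \<and> locally_finite_variation (\<lambda>t. A t \<omega>))"

definition semimartingale ::
    "'a measure \<Rightarrow> (real \<Rightarrow> 'a measure) \<Rightarrow> (real \<Rightarrow> 'a \<Rightarrow> real) \<Rightarrow> bool" where
  "semimartingale M F X \<longleftrightarrow>
     filtered_prob_space M F \<and> adapted F X \<and>
     (\<exists>N A. local_martingale M F N \<and> finite_variation_process M F A \<and>
        (AE \<omega> in M. N 0 \<omega> = 0 \<and> A 0 \<omega> = 0 \<and> (\<forall>t\<ge>0. X t \<omega> = X 0 \<omega> + N t \<omega> + A t \<omega>)))"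

end

theory Submission
  imports Defs
begin

text \<open>
  Since \<open>2 H K = 1\<close>, the covariance splits as
  \<open>2 powr - K * ((t powr (1/K) + s powr (1/K)) powr K - t - s) + 2 powr (1 - K) * min t s\<close>.
  Both summands are positive definite for \<open>1 < K < 2\<close>, so in law \<open>B\<close> is a multiple of Brownian
  motion plus an independent Gaussian process \<open>Y\<close>. The kernel of \<open>Y\<close> is smooth away from the
  origin: \<open>Y\<close> has a mean-square derivative at every \<open>t > 0\<close>, of norm \<open>const / sqrt t\<close>, which
  is integrable at \<open>0\<close>. Hence \<open>Y\<close> has paths of finite variation, and the sum is a semimartingale
  in the filtration of the two summands.

  The given probability space need not carry the two summands, so the decomposition in the
  natural filtration of \<open>B\<close> is built directly. Its drift density \<open>y s\<close> has to be the projection of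
  the derivative of \<open>Y\<close> at \<open>s\<close> on the past of \<open>B\<close>: the element of the closed linear span of
  \<open>B r\<close>, \<open>r \<le> s\<close>, whose inner product with \<open>B r\<close> is \<open>drift_kernel K (r / s)\<close>. By self-similarity
  it suffices to find it at \<open>s = 1\<close>, and all other times then use the same coefficients. At \<open>s = 1\<close>
  it exists by the Riesz argument: the linear functional given by \<open>drift_kernel\<close> is dominated by
  the covariance form (\<open>drift_functional_bounded\<close>), so minimising a quadratic functional gives
  finite combinations that converge geometrically fast (\<open>riesz_minimizing_sequence\<close>,
  \<open>drift_coefficients\<close>). Fast convergence makes the rescaled combinations converge almost surely
  under an envelope with mean \<open>const / sqrt s\<close> (\<open>nn_mean_envelope\<close>). Therefore the compensator,
  the time integral of the drift density, is continuous and of finite variation.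

  It remains to see that \<open>B\<close> minus the compensator is a martingale. Its increments are
  uncorrelated with the past; Gaussian integration by parts turns this into
  \<open>E (increment * exp (i Z)) = 0\<close> for every finite combination \<open>Z\<close> of past values
  (\<open>innovation_trig_orthogonal\<close>), and one-dimensional uniqueness of characteristic functions,
  applied once for each generator of the past, turns that into
  \<open>E (increment * indicator A) = 0\<close> for every past event \<open>A\<close> (\<open>trig_orthogonal_sigma\<close>).
  Right-continuous augmentation costs only a limit \<open>u \<rightarrow> s+\<close> in mean
  (\<open>innovation_orthogonal_right_limit\<close>).
\<close>

section \<open>Finite linear combinations and minimising sequences\<close>

text \<open>
  Sums over the support rather than over a given finite index set: the coefficient functions then
  form a vector space on which the covariance form is bilinear, and the same coefficients can be
  paired with values, with covariances, or with values at rescaled times.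
\<close>

definition lin :: "('t \<Rightarrow> real) \<Rightarrow> ('t \<Rightarrow> real) \<Rightarrow> real" where
  "lin c g = (\<Sum>u | c u \<noteq> 0. c u * g u)"

definition finsupp :: "'t set \<Rightarrow> ('t \<Rightarrow> real) set" where
  "finsupp I = {c. finite {u. c u \<noteq> 0} \<and> {u. c u \<noteq> 0} \<subseteq> I}"

lemma lin_superset:
  assumes "finite J" "{u. c u \<noteq> 0} \<subseteq> J"
  shows "lin c g = (\<Sum>u\<in>J. c u * g u)"
  unfolding lin_def using assms by (intro sum.mono_neutral_left) auto

lemma finsupp_comb:
  assumes "c \<in> finsupp I" "d \<in> finsupp I"
  shows "(\<lambda>u. c u + r * d u) \<in> finsupp I"
proof -
  have "{u. c u + r * d u \<noteq> 0} \<subseteq> {u. c u \<noteq> 0} \<union> {u. d u \<noteq> 0}" by auto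
  then show ?thesis using assms unfolding finsupp_def
    by (auto intro: finite_subset[of _ "{u. c u \<noteq> 0} \<union> {u. d u \<noteq> 0}"])
qed

lemma finsupp_mono: "I \<subseteq> I' \<Longrightarrow> c \<in> finsupp I \<Longrightarrow> c \<in> finsupp I'"
  by (auto simp: finsupp_def)

lemma zero_finsupp: "(\<lambda>_. 0) \<in> finsupp I"
  by (auto simp: finsupp_def)

lemma lin_zero [simp]: "lin (\<lambda>_. 0) g = 0"
  by (simp add: lin_def)

lemma lin_comb_left:
  assumes "c \<in> finsupp I" "d \<in> finsupp I"
  shows "lin (\<lambda>u. c u + r * d u) g = lin c g + r * lin d g"
proof -
  let ?J = "{u. c u \<noteq> 0} \<union> {u. d u \<noteq> 0}"
  have f: "finite ?J" using assms by (auto simp: finsupp_def)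
  have "lin c g = (\<Sum>u\<in>?J. c u * g u)" "lin d g = (\<Sum>u\<in>?J. d u * g u)"
    "lin (\<lambda>u. c u + r * d u) g = (\<Sum>u\<in>?J. (c u + r * d u) * g u)"
    by (rule lin_superset[OF f]; auto)+
  then show ?thesis
    by (simp add: algebra_simps sum.distrib sum_distrib_left)
qed

lemma lin_add_right: "lin c (\<lambda>u. g u + h u) = lin c g + lin c h"
  by (simp add: lin_def algebra_simps sum.distrib)

lemma lin_diff_right: "lin c (\<lambda>u. g u - h u) = lin c g - lin c h"
  by (simp add: lin_def algebra_simps sum_subtractf)

lemma lin_scale_right: "lin c (\<lambda>u. r * g u) = r * lin c g"
  by (simp add: lin_def algebra_simps sum_distrib_left)

lemma lin_mult: "lin c g * lin d h = lin c (\<lambda>u. lin d (\<lambda>v. g u * h v))"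
  unfolding lin_def sum_product by (simp add: sum_distrib_left mult_ac)

lemma lin_swap: "lin c (\<lambda>u. lin d (\<lambda>v. g u v)) = lin d (\<lambda>v. lin c (\<lambda>u. g u v))"
  unfolding lin_def sum_distrib_left by (subst sum.swap) (simp add: mult.left_commute)

lemma lin_cong: "c \<in> finsupp I \<Longrightarrow> (\<And>u. u \<in> I \<Longrightarrow> g u = h u) \<Longrightarrow> lin c g = lin c h"
  unfolding lin_def by (rule sum.cong) (auto simp: finsupp_def)

lemma lin_integral:
  assumes "c \<in> finsupp I" "\<And>u. u \<in> I \<Longrightarrow> integrable M (g u)"
  shows "integrable M (\<lambda>x. lin c (\<lambda>u. g u x))"
    and "(\<integral>x. lin c (\<lambda>u. g u x) \<partial>M) = lin c (\<lambda>u. \<integral>x. g u x \<partial>M)"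
proof -
  have i: "integrable M (\<lambda>x. c u * g u x)" if "c u \<noteq> 0" for u
    using assms that by (auto simp: finsupp_def)
  then show "integrable M (\<lambda>x. lin c (\<lambda>u. g u x))" 
    unfolding lin_def by (intro Bochner_Integration.integrable_sum) (use i in auto)
  show "(\<integral>x. lin c (\<lambda>u. g u x) \<partial>M) = lin c (\<lambda>u. \<integral>x. g u x \<partial>M)"
    unfolding lin_def by (subst Bochner_Integration.integral_sum) (use i in auto)
qed

lemma lin_measurable:
  assumes "c \<in> finsupp I" "\<And>u. u \<in> I \<Longrightarrow> g u \<in> borel_measurable M"
  shows "(\<lambda>x. lin c (\<lambda>u. g u x)) \<in> borel_measurable M"
  using assms unfolding lin_def finsupp_def by (auto intro!: borel_measurable_sum)

lemma lin_tendsto: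
  assumes "c \<in> finsupp I" "\<And>u. u \<in> I \<Longrightarrow> ((\<lambda>x. g x u) \<longlongrightarrow> l u) F"
  shows "((\<lambda>x. lin c (g x)) \<longlongrightarrow> lin c l) F"
  using assms unfolding lin_def finsupp_def by (auto intro!: tendsto_intros)

definition point :: "'t \<Rightarrow> 't \<Rightarrow> real" where
  "point v = (\<lambda>u. if u = v then 1 else 0)"

lemma lin_point [simp]: "lin (point v) g = g v"
  by (simp add: lin_def point_def)

lemma point_finsupp: "v \<in> I \<Longrightarrow> point v \<in> finsupp I"
  by (auto simp: finsupp_def point_def)

text \<open>
  Riesz representation without completeness. A minimising sequence of
  \<open>q c c - 2 * L c\<close> is Cauchy by the parallelogram law, and being nearly minimal forces the
  first variation \<open>q (x k) d - L d\<close> to vanish in the limit. The inequality \<open>2 * L c \<le> q c c + C\<close>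
  replaces boundedness of \<open>L\<close> and makes the functional bounded below. A prescribed geometric
  rate is what later gives almost sure convergence.
\<close>

lemma riesz_minimizing_sequence:
  fixes q :: "('t \<Rightarrow> real) \<Rightarrow> ('t \<Rightarrow> real) \<Rightarrow> real" and L :: "('t \<Rightarrow> real) \<Rightarrow> real"
  assumes zero: "(\<lambda>_. 0) \<in> S"
    and comb: "\<And>c d r. c \<in> S \<Longrightarrow> d \<in> S \<Longrightarrow> (\<lambda>u. c u + r * d u) \<in> S"
    and sym: "\<And>c d. c \<in> S \<Longrightarrow> d \<in> S \<Longrightarrow> q c d = q d c"
    and qlin: "\<And>c d e r. c \<in> S \<Longrightarrow> d \<in> S \<Longrightarrow> e \<in> S \<Longrightarrow> q (\<lambda>u. c u + r * d u) e = q c e + r * q d e"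
    and Llin: "\<And>c d r. c \<in> S \<Longrightarrow> d \<in> S \<Longrightarrow> L (\<lambda>u. c u + r * d u) = L c + r * L d"
    and bound: "\<And>c. c \<in> S \<Longrightarrow> 2 * L c \<le> q c c + C"
  obtains x :: "nat \<Rightarrow> 't \<Rightarrow> real" where "\<And>k. x k \<in> S"
    "\<And>k. q (\<lambda>u. x (Suc k) u - x k u) (\<lambda>u. x (Suc k) u - x k u) \<le> (1/4) ^ k"
    "\<And>d. d \<in> S \<Longrightarrow> (\<lambda>k. q (x k) d) \<longlonglongrightarrow> L d"
proof -
  define J where "J c = q c c - 2 * L c" for c
  define m where "m = Inf (J ` S)"
  have bdd: "bdd_below (J ` S)"
  proof (rule bdd_belowI2)
    show "- C \<le> J c" if "c \<in> S" for c using bound[OF that] by (simp add: J_def)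
  qed
  have m: "m \<le> J c" if "c \<in> S" for c
    unfolding m_def using bdd that by (intro cInf_lower) auto
  have "\<exists>c\<in>S. J c < m + (1/4) ^ k / 4" for k :: nat
  proof -
    have "Inf (J ` S) < m + (1/4) ^ k / 4" unfolding m_def[symmetric] by simp
    then show ?thesis using cInf_lessD[of "J ` S"] zero by blast
  qed
  then obtain x where xS: "\<And>k. x k \<in> S" and xJ: "\<And>k::nat. J (x k) < m + (1/4) ^ k / 4" by metis
  have qq: "q (\<lambda>u. c u + r * d u) (\<lambda>u. c u + r * d u) = q c c + 2 * r * q c d + r\<^sup>2 * q d d"
    if "c \<in> S" "d \<in> S" for c d r
  proof -
    let ?e = "\<lambda>u. c u + r * d u"
    have "q ?e ?e = q c ?e + r * q d ?e" using that comb by (intro qlin) auto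
    moreover have "q c ?e = q ?e c" "q d ?e = q ?e d" using that comb by (auto intro!: sym)
    ultimately show ?thesis using that qlin sym[of d c] by (simp add: algebra_simps power2_eq_square)
  qed
  have JJ: "J (\<lambda>u. c u + r * d u) = J c + 2 * r * (q c d - L d) + r\<^sup>2 * q d d"
    if "c \<in> S" "d \<in> S" for c d r
    using qq[OF that] Llin[OF that] by (simp add: J_def algebra_simps)
  show ?thesis
  proof
    show "x k \<in> S" for k by (rule xS)
    fix k
    let ?d = "\<lambda>u. x (Suc k) u - x k u"
    have dS: "?d \<in> S" using comb[OF xS[of "Suc k"] xS[of k], of "-1"] by simp
    have e: "(\<lambda>u. x k u + 1 * ?d u) = x (Suc k)" by auto
    have 1: "J (x (Suc k)) = J (x k) + 2 * (q (x k) ?d - L ?d) + q ?d ?d"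
      using JJ[OF xS[of k] dS, of 1] unfolding e by simp
    have 2: "J (\<lambda>u. x k u + (1/2) * ?d u) = J (x k) + (q (x k) ?d - L ?d) + q ?d ?d / 4"
      using JJ[OF xS[of k] dS, of "1/2"] by (simp add: power2_eq_square)
    \<comment> \<open>Parallelogram law: the midpoint of two near minimisers is no better than the infimum.\<close>
    have 3: "m \<le> J (\<lambda>u. x k u + (1/2) * ?d u)" by (intro m comb xS dS)
    have "(1/4::real) ^ Suc k = (1/4) ^ k / 4" by simp
    moreover have "(0::real) \<le> (1/4) ^ k" by simp
    ultimately show "q ?d ?d \<le> (1/4) ^ k"
      using 1 2 3 xJ[of k] xJ[of "Suc k"] by argo
  next
    fix d assume d: "d \<in> S"
    have up: "\<bar>q (x k) d - L d\<bar> \<le> (1 + \<bar>q d d\<bar>) * (1/2) ^ k" for k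
    proof -
      \<comment> \<open>A step of the order of the square root of the gap to the infimum balances both error terms.\<close>
      define r :: real where "r = (1/2) ^ k"
      have r: "r > 0" by (simp add: r_def)
      have r2: "(1/4::real) ^ k = r\<^sup>2"
        by (simp add: r_def power2_eq_square flip: power_mult_distrib)
      have "m \<le> J (x k) + 2 * r * (q (x k) d - L d) + r\<^sup>2 * q d d"
        "m \<le> J (x k) - 2 * r * (q (x k) d - L d) + r\<^sup>2 * q d d"
        using m[OF comb[OF xS[of k] d, of r]] JJ[OF xS[of k] d, of r]
          m[OF comb[OF xS[of k] d, of "-r"]] JJ[OF xS[of k] d, of "-r"] by auto
      then have "r * (2 * \<bar>q (x k) d - L d\<bar>) \<le> r * (r * (1/4 + q d d))"
        using xJ[of k] r unfolding r2 abs_if by (simp add: algebra_simps power2_eq_square)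
      then have "2 * \<bar>q (x k) d - L d\<bar> \<le> r * (1/4 + q d d)" using r by simp
      also have "\<dots> \<le> r * (2 * (1 + \<bar>q d d\<bar>))" using r by (intro mult_left_mono) auto
      finally show ?thesis by (simp add: r_def algebra_simps)
    qed
    have "(\<lambda>k. (1 + \<bar>q d d\<bar>) * (1/2::real) ^ k) \<longlonglongrightarrow> 0"
      by (intro tendsto_mult_right_zero LIMSEQ_realpow_zero) auto
    then have "(\<lambda>k. q (x k) d - L d) \<longlonglongrightarrow> 0"
      by (rule Lim_null_comparison[rotated]) (use up in auto)
    then show "(\<lambda>k. q (x k) d) \<longlonglongrightarrow> L d" by (simp add: LIM_zero_iff)
  qed
qed

section \<open>The covariance kernel\<close>

definition bifbm_cov :: "real \<Rightarrow> real \<Rightarrow> real \<Rightarrow> real" where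
  "bifbm_cov K t s = 1 / 2 powr K * ((t powr (1 / K) + s powr (1 / K)) powr K - \<bar>t - s\<bar>)"

text \<open>
  The derivative of the covariance in its first argument at the point \<open>(1, u)\<close>, \<open>u \<le> 1\<close>; at
  \<open>(s, v)\<close> the derivative is \<open>drift_kernel K (v / s)\<close> because the covariance is homogeneous of
  degree one (see \<open>bifbm_cov_increment\<close>).
\<close>

definition drift_kernel :: "real \<Rightarrow> real \<Rightarrow> real" where
  "drift_kernel K u = 1 / 2 powr K * ((1 + u powr (1 / K)) powr (K - 1) - 1)"

definition pow_weight :: "real \<Rightarrow> real \<Rightarrow> real" where
  "pow_weight p x = (if 0 < x then x powr (- p - 1) else 0)"

lemma pow_weight_measurable [measurable]: "pow_weight p \<in> borel_measurable borel"
  unfolding pow_weight_def by measurable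

text \<open>
  The measure \<open>pow_weight p x dx\<close> is homogeneous of degree \<open>p\<close> under dilations, so integrals
  against it produce pure powers.
\<close>

lemma pow_weight_scaling:
  fixes g :: "real \<Rightarrow> real"
  assumes a: "0 < a" and int: "integrable lborel (\<lambda>x. g x * pow_weight p x)"
  shows "integrable lborel (\<lambda>x. g (a * x) * pow_weight p x)"
    and "(\<integral>x. g (a * x) * pow_weight p x \<partial>lborel) = a powr p * (\<integral>x. g x * pow_weight p x \<partial>lborel)"
proof -
  have e: "g (0 + a * x) * pow_weight p (0 + a * x) = a powr (- p - 1) * (g (a * x) * pow_weight p x)" for x
    using a by (auto simp: pow_weight_def powr_mult zero_less_mult_iff)
  have i: "integrable lborel (\<lambda>x. g (0 + a * x) * pow_weight p (0 + a * x))"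
    using lborel_integrable_real_affine[OF int, of a 0] a by simp
  have "a powr (- p - 1) \<noteq> 0" using a by simp
  then show "integrable lborel (\<lambda>x. g (a * x) * pow_weight p x)" using i unfolding e by simp
  have "(\<integral>x. g x * pow_weight p x \<partial>lborel) = a * (\<integral>x. g (0 + a * x) * pow_weight p (0 + a * x) \<partial>lborel)"
    using lborel_integral_real_affine[of a "\<lambda>x. g x * pow_weight p x" 0] a by simp
  also have "\<dots> = (a * a powr (- p - 1)) * (\<integral>x. g (a * x) * pow_weight p x \<partial>lborel)"
    unfolding e by simp
  also have "a * a powr (- p - 1) = a powr (- p)" using a by (simp add: powr_mult_base)
  finally show "(\<integral>x. g (a * x) * pow_weight p x \<partial>lborel) = a powr p * (\<integral>x. g x * pow_weight p x \<partial>lborel)"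
    using a by (simp add: powr_minus field_simps)
qed

lemma integrable_pow_weight_dominated:
  fixes g :: "real \<Rightarrow> real"
  assumes p: "0 < p" "p < q" and [measurable]: "g \<in> borel_measurable borel"
    and small: "\<And>x. 0 < x \<Longrightarrow> x \<le> 1 \<Longrightarrow> \<bar>g x\<bar> \<le> x powr q"
    and large: "\<And>x. 1 < x \<Longrightarrow> \<bar>g x\<bar> \<le> x powr r" and r: "r < p"
  shows "integrable lborel (\<lambda>x. g x * pow_weight p x)"
proof -
  have 1: "(\<lambda>x. x powr (q - p - 1)) absolutely_integrable_on {0..1}"
    using p by (intro nonnegative_absolutely_integrable_1 integrable_on_powr_from_0) auto
  have "((\<lambda>x. x powr (r - p - 1)) has_integral - (1 powr (r - p - 1 + 1)) / (r - p - 1 + 1)) {1..}"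
    using r by (intro has_integral_powr_to_inf) auto
  then have 2: "(\<lambda>x. x powr (r - p - 1)) absolutely_integrable_on {1..}"
    by (intro nonnegative_absolutely_integrable_1) (auto simp: integrable_on_def)
  have m: "(\<lambda>x. indicator {0..1} x *\<^sub>R x powr (q - p - 1) + indicator {1..} x *\<^sub>R x powr (r - p - 1) :: real)
      \<in> borel_measurable borel" by measurable
  have "integrable lebesgue (\<lambda>x. indicator {0..1} x *\<^sub>R x powr (q - p - 1) + indicator {1..} x *\<^sub>R x powr (r - p - 1) :: real)"
    using 1 2 by (auto simp: set_integrable_def)
  then have i: "integrable lborel (\<lambda>x. indicator {0..1} x *\<^sub>R x powr (q - p - 1) + indicator {1..} x *\<^sub>R x powr (r - p - 1) :: real)"
    using m by (subst (asm) integrable_completion) auto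
  have gw: "\<bar>g x * pow_weight p x\<bar> \<le> x powr (s - p - 1)" if "0 < x" "\<bar>g x\<bar> \<le> x powr s" for x s
  proof -
    have "\<bar>g x * pow_weight p x\<bar> = \<bar>g x\<bar> * x powr (- p - 1)" using that by (simp add: pow_weight_def abs_mult)
    also have "\<dots> \<le> x powr s * x powr (- p - 1)" using that by (intro mult_right_mono) auto
    also have "\<dots> = x powr (s - p - 1)" by (simp add: powr_add[symmetric] algebra_simps)
    finally show ?thesis .
  qed
  show ?thesis
  proof (rule Bochner_Integration.integrable_bound[OF i], measurable, intro AE_I2)
    fix x :: real
    show "norm (g x * pow_weight p x) \<le> norm (indicator {0..1} x *\<^sub>R x powr (q - p - 1) + indicator {1..} x *\<^sub>R x powr (r - p - 1))"
    proof -
      consider "x \<le> 0" | "0 < x" "x \<le> 1" | "1 < x" by linarith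
      then show ?thesis
      proof cases
        case 1 then show ?thesis by (simp add: pow_weight_def)
      next
        case 2
        have "\<bar>g x * pow_weight p x\<bar> \<le> x powr (q - p - 1)" using 2 by (intro gw small)
        then show ?thesis using 2 by (auto simp: indicator_def)
      next
        case 3
        have "\<bar>g x * pow_weight p x\<bar> \<le> x powr (r - p - 1)" using 3 by (intro gw large) auto
        then show ?thesis using 3 by (auto simp: indicator_def)
      qed
    qed
  qed
qed

lemma pow_weight_integral_pos:
  fixes g :: "real \<Rightarrow> real"
  assumes int: "integrable lborel (\<lambda>x. g x * pow_weight p x)" and pos: "\<And>x. 0 < x \<Longrightarrow> 0 < g x"
  shows "0 < (\<integral>x. g x * pow_weight p x \<partial>lborel)"
proof -
  have nn: "0 \<le> g x * pow_weight p x" for x using pos[of x] by (auto simp: pow_weight_def)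
  have "(\<integral>x. g x * pow_weight p x \<partial>lborel) \<noteq> 0"
  proof
    assume "(\<integral>x. g x * pow_weight p x \<partial>lborel) = 0"
    then have "AE x in lborel. g x * pow_weight p x = 0"
      using integral_nonneg_eq_0_iff_AE[OF int] nn by auto
    then have "AE x in lborel. x \<notin> {0<..<1::real}"
      by eventually_elim (use pos in \<open>force simp: pow_weight_def split: if_splits\<close>)
    then have "emeasure lborel {0<..<1::real} = 0"
      by (subst (asm) AE_iff_measurable[where N="{0<..<1::real}"]) auto
    moreover have "emeasure lborel {0<..<1::real} = 1" by simp
    ultimately show False by simp
  qed
  moreover have "0 \<le> (\<integral>x. g x * pow_weight p x \<partial>lborel)"
    using nn by (intro Bochner_Integration.integral_nonneg)
  ultimately show ?thesis by simp
qed

lemma exp_diff_bounds: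
  fixes x :: real assumes "0 < x"
  shows "0 < exp (- x) - 1 + x" "exp (- x) - 1 + x \<le> x" "exp (- x) - 1 + x \<le> x\<^sup>2"
    "0 < 1 - exp (- x)" "1 - exp (- x) \<le> x" "1 - exp (-x) \<le> 1"
proof -
  have lower: "1 - x < exp (- x)" using assms exp_minus_greater[of x] by simp
  have "exp (- x) * (1 + x) \<le> exp (- x) * exp x" by (intro mult_left_mono) auto
  then have "exp (- x) * (1 + x) \<le> 1" by (simp add: mult_exp_exp)
  then have "exp (- x) \<le> 1 / (1 + x)" using assms by (simp add: field_simps)
  moreover have "1 / (1 + x) - 1 + x = x\<^sup>2 / (1 + x)" using assms by (simp add: field_simps power2_eq_square)
  moreover have "x\<^sup>2 / (1 + x) \<le> x\<^sup>2 / 1" using assms by (intro divide_left_mono) auto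
  ultimately show "exp (- x) - 1 + x \<le> x\<^sup>2" by simp
  show "0 < exp (- x) - 1 + x" "exp (- x) - 1 + x \<le> x" 
    "0 < 1 - exp (- x)" "1 - exp (- x) \<le> x" "1 - exp (-x) \<le> 1" using lower assms by auto
qed

text \<open>
  With \<open>g x = exp (- x) - 1 + x\<close> the integral of \<open>g (a * x)\<close> is a multiple of \<open>a powr K\<close>, and
  \<open>g (x + y) - g x - g y = (1 - exp (- x)) * (1 - exp (- y))\<close>. So the smooth part of the
  covariance is a Gram kernel. Convergence at \<open>0\<close> needs \<open>K < 2\<close>, at infinity \<open>K > 1\<close>.
\<close>

lemma power_subordination:
  fixes K :: real
  assumes K: "1 < K" "K < 2"
  obtains D where "0 < D"
    "\<And>a b. 0 \<le> a \<Longrightarrow> 0 \<le> b \<Longrightarrow> integrable lborel (\<lambda>x. ((1 - exp (- (x * a))) * (1 - exp (- (x * b)))) * pow_weight K x)"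
    "\<And>a b. 0 \<le> a \<Longrightarrow> 0 \<le> b \<Longrightarrow>
      (\<integral>x. ((1 - exp (- (x * a))) * (1 - exp (- (x * b)))) * pow_weight K x \<partial>lborel) = D * ((a + b) powr K - a powr K - b powr K)"
proof
  define g where "g x = exp (- x) - 1 + x" for x :: real
  have [measurable]: "g \<in> borel_measurable borel" unfolding g_def by measurable
  define D where "D = (\<integral>x. g x * pow_weight K x \<partial>lborel)"
  have int: "integrable lborel (\<lambda>x. g x * pow_weight K x)"
    using K by (intro integrable_pow_weight_dominated[where q=2 and r=1])
      (use exp_diff_bounds in \<open>auto simp: g_def less_imp_le\<close>)
  show "0 < D" unfolding D_def using exp_diff_bounds(1) by (intro pow_weight_integral_pos int) (simp add: g_def)
  have s: "integrable lborel (\<lambda>x. g (a * x) * pow_weight K x) \<and>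
      (\<integral>x. g (a * x) * pow_weight K x \<partial>lborel) = D * a powr K" if "0 \<le> a" for a
    using pow_weight_scaling[OF _ int, of a] that by (cases "a = 0") (auto simp: D_def g_def)
  fix a b :: real assume ab: "0 \<le> a" "0 \<le> b"
  have e: "((1 - exp (- (x * a))) * (1 - exp (- (x * b)))) * pow_weight K x
      = g ((a + b) * x) * pow_weight K x - g (a * x) * pow_weight K x - g (b * x) * pow_weight K x" for x
  proof -
    have "exp (- (a * x + b * x)) = exp (- (a * x)) * exp (- (b * x))" by (simp add: mult_exp_exp)
    then show ?thesis unfolding g_def by (simp add: algebra_simps)
  qed
  show "integrable lborel (\<lambda>x. ((1 - exp (- (x * a))) * (1 - exp (- (x * b)))) * pow_weight K x)"
    unfolding e using s[of a] s[of b] s[of "a + b"] ab by auto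
  show "(\<integral>x. ((1 - exp (- (x * a))) * (1 - exp (- (x * b)))) * pow_weight K x \<partial>lborel) = D * ((a + b) powr K - a powr K - b powr K)"
    unfolding e using s[of a] s[of b] s[of "a + b"] ab by (simp add: algebra_simps)
qed

text \<open>
  The same device for the derivative of that kernel, now with \<open>1 - exp (- x)\<close>.
\<close>

lemma power_subordination_derivative:
  fixes K :: real
  assumes K: "1 < K" "K < 2"
  obtains D where "0 < D"
    "\<And>a. 0 \<le> a \<Longrightarrow> integrable lborel (\<lambda>x. (exp (- x) * (1 - exp (- (x * a)))) * pow_weight (K - 1) x)"
    "\<And>a. 0 \<le> a \<Longrightarrow>
      (\<integral>x. (exp (- x) * (1 - exp (- (x * a)))) * pow_weight (K - 1) x \<partial>lborel) = D * ((1 + a) powr (K - 1) - 1)"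
proof
  define g where "g x = 1 - exp (- x)" for x :: real
  have [measurable]: "g \<in> borel_measurable borel" unfolding g_def by measurable
  define D where "D = (\<integral>x. g x * pow_weight (K - 1) x \<partial>lborel)"
  have int: "integrable lborel (\<lambda>x. g x * pow_weight (K - 1) x)"
    using K by (intro integrable_pow_weight_dominated[where q=1 and r=0])
      (use exp_diff_bounds in \<open>auto simp: g_def less_imp_le\<close>)
  show "0 < D" unfolding D_def using exp_diff_bounds(4) by (intro pow_weight_integral_pos int) (simp add: g_def)
  have s: "integrable lborel (\<lambda>x. g (a * x) * pow_weight (K - 1) x) \<and>
      (\<integral>x. g (a * x) * pow_weight (K - 1) x \<partial>lborel) = D * a powr (K - 1)" if "0 \<le> a" for a
    using pow_weight_scaling[OF _ int, of a] that by (cases "a = 0") (auto simp: D_def g_def)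
  fix a :: real assume a: "0 \<le> a"
  have e: "(exp (- x) * (1 - exp (- (x * a)))) * pow_weight (K - 1) x
      = g ((1 + a) * x) * pow_weight (K - 1) x - g (1 * x) * pow_weight (K - 1) x" for x
  proof -
    have "exp (- (x + a * x)) = exp (- x) * exp (- (a * x))" by (simp add: mult_exp_exp)
    then show ?thesis unfolding g_def by (simp add: algebra_simps)
  qed
  show "integrable lborel (\<lambda>x. (exp (- x) * (1 - exp (- (x * a)))) * pow_weight (K - 1) x)"
    unfolding e using s[of 1] s[of "1 + a"] a by auto
  show "(\<integral>x. (exp (- x) * (1 - exp (- (x * a)))) * pow_weight (K - 1) x \<partial>lborel) = D * ((1 + a) powr (K - 1) - 1)"
    unfolding e using s[of 1] s[of "1 + a"] a by (simp add: algebra_simps)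
qed

lemma bifbm_cov_split:
  "bifbm_cov K t s = 1 / 2 powr K * ((t powr (1/K) + s powr (1/K)) powr K - t - s) + 2 / 2 powr K * min t s"
  by (simp add: bifbm_cov_def min_def abs_if field_simps)

text \<open>
  The Brownian part of the covariance is the Gram kernel of indicator functions of intervals.
\<close>

lemma min_kernel_nonneg:
  assumes "c \<in> finsupp {0..}"
  shows "0 \<le> lin c (\<lambda>u. lin c (\<lambda>v. min u v))"
proof -
  have i: "integrable lborel (\<lambda>x. indicator {0..u} x * indicator {0..v} x :: real)"
    and e: "(\<integral>x. indicator {0..u} x * indicator {0..v} x \<partial>lborel) = min u v"
    if "0 \<le> u" "0 \<le> v" for u v :: real
  proof -
    have *: "indicator {0..u} x * indicator {0..v} x = (indicator {0..min u v} x :: real)" for x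
      by (auto simp: indicator_def)
    show "integrable lborel (\<lambda>x. indicator {0..u} x * indicator {0..v} x :: real)"
      unfolding * using that by (auto simp: emeasure_lborel_Icc_eq)
    show "(\<integral>x. indicator {0..u} x * indicator {0..v} x \<partial>lborel) = min u v"
      unfolding * using that by simp
  qed
  have "0 \<le> (\<integral>x. lin c (\<lambda>u. indicator {0..u} x) * lin c (\<lambda>u. indicator {0..u} x) \<partial>lborel)"
    by (intro Bochner_Integration.integral_nonneg) auto
  also have "\<dots> = lin c (\<lambda>u. lin c (\<lambda>v. \<integral>x. indicator {0..u} x * indicator {0..v} x \<partial>lborel))"
    unfolding lin_mult
    by (subst lin_integral(2)[OF assms], intro lin_integral(1)[OF assms] i; simp?)
      (intro lin_cong[OF assms] lin_integral(2)[OF assms] i; simp)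
  also have "\<dots> = lin c (\<lambda>u. lin c (\<lambda>v. min u v))"
    by (intro lin_cong[OF assms]) (auto simp: e)
  finally show ?thesis .
qed

text \<open>
  In the representations above, the functional is the inner product of the feature vector of
  \<open>c\<close> with the fixed function \<open>exp (- x) * x\<close>, which is square integrable for the weight
  \<open>pow_weight K\<close> because \<open>K < 2\<close>. The pointwise inequality \<open>2ab \<le> a\<^sup>2 + b\<^sup>2\<close> separates the two
  factors; the Brownian part of the covariance only increases the right-hand side.
\<close>

lemma drift_functional_bounded:
  fixes K :: real
  assumes K: "1 < K" "K < 2"
  obtains C where "\<And>c. c \<in> finsupp {0..} \<Longrightarrow>
    2 * lin c (drift_kernel K) \<le> lin c (\<lambda>u. lin c (bifbm_cov K u)) + C"
proof -
  obtain D1 where D1: "0 < D1"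
    and i1: "\<And>a b. 0 \<le> a \<Longrightarrow> 0 \<le> b \<Longrightarrow> integrable lborel (\<lambda>x. ((1 - exp (- (x * a))) * (1 - exp (- (x * b)))) * pow_weight K x)"
    and e1: "\<And>a b. 0 \<le> a \<Longrightarrow> 0 \<le> b \<Longrightarrow>
      (\<integral>x. ((1 - exp (- (x * a))) * (1 - exp (- (x * b)))) * pow_weight K x \<partial>lborel) = D1 * ((a + b) powr K - a powr K - b powr K)"
    using power_subordination[OF K] by blast
  obtain D2 where D2: "0 < D2"
    and i2: "\<And>a. 0 \<le> a \<Longrightarrow> integrable lborel (\<lambda>x. (exp (- x) * (1 - exp (- (x * a)))) * pow_weight (K - 1) x)"
    and e2: "\<And>a. 0 \<le> a \<Longrightarrow>
      (\<integral>x. (exp (- x) * (1 - exp (- (x * a)))) * pow_weight (K - 1) x \<partial>lborel) = D2 * ((1 + a) powr (K - 1) - 1)"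
    using power_subordination_derivative[OF K] by blast
  define \<alpha> where "\<alpha> = 1 / 2 powr K / D2"
  define \<beta> where "\<beta> = 1 / 2 powr K / D1"
  have \<beta>: "0 < \<beta>" using D1 by (simp add: \<beta>_def)
  have i3: "integrable lborel (\<lambda>x. exp (- x) * exp (- x) * pow_weight (K - 2) x)"
  proof -
    have "(exp (- x) * exp (- x)) * pow_weight (K - 2) x = (exp (- x) * exp (- x) * x) * pow_weight (K - 1) x" for x
      by (simp add: pow_weight_def powr_mult_base)
    moreover have "integrable lborel (\<lambda>x. (exp (- x) * exp (- x) * x) * pow_weight (K - 1) x)"
    proof (rule integrable_pow_weight_dominated[where q=1 and r=0])
      fix x :: real assume "0 < x" "x \<le> 1"
      then have "exp (- x) * exp (- x) * x \<le> 1 * 1 * x" by (intro mult_mono) auto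
      then show "\<bar>exp (- x) * exp (- x) * x\<bar> \<le> x powr 1" using \<open>0 < x\<close> by simp
    next
      fix x :: real assume x: "1 < x"
      have "x * exp (- x) \<le> 1" using exp_ge_add_one_self[of x] by (simp add: exp_minus field_simps del: exp_ge_add_one_self)
      then have "exp (- x) * (exp (- x) * x) \<le> 1 * 1" using x by (intro mult_mono) (auto simp: mult.commute)
      then show "\<bar>exp (- x) * exp (- x) * x\<bar> \<le> x powr 0" using x by (simp add: mult_ac)
    qed (use K in auto)
    ultimately show ?thesis by (simp only:)
  qed
  define C where "C = (\<alpha>\<^sup>2 / \<beta>) * (\<integral>x. exp (- x) * exp (- x) * pow_weight (K - 2) x \<partial>lborel)"
  have Kpow: "(u powr (1 / K)) powr K = u" if "0 \<le> u" for u using that K by (simp add: powr_powr)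
  show ?thesis
  proof
    fix c :: "real \<Rightarrow> real" assume c: "c \<in> finsupp {0..}"
    define S where "S x = lin c (\<lambda>u. 1 - exp (- (x * u powr (1 / K))))" for x
    define f1 where "f1 x = (S x * S x) * pow_weight K x" for x
    define f2 where "f2 x = (exp (- x) * S x) * pow_weight (K - 1) x" for x
    have f1e: "f1 x = lin c (\<lambda>u. lin c (\<lambda>v. ((1 - exp (- (x * u powr (1 / K)))) * (1 - exp (- (x * v powr (1 / K))))) * pow_weight K x))" for x
      unfolding f1_def S_def lin_mult by (simp add: mult.commute[of _ "pow_weight K x"] lin_scale_right)
    have f2e: "f2 x = lin c (\<lambda>u. (exp (- x) * (1 - exp (- (x * u powr (1 / K))))) * pow_weight (K - 1) x)" for x
      unfolding f2_def S_def by (simp add: mult.commute[of _ "pow_weight (K - 1) x"] lin_scale_right)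
    have f1i: "integrable lborel f1" unfolding f1e by (intro lin_integral(1)[OF c] i1) auto
    have f2i: "integrable lborel f2" unfolding f2e by (intro lin_integral(1)[OF c] i2) auto
    have I1: "(\<integral>x. f1 x \<partial>lborel) = D1 * lin c (\<lambda>u. lin c (\<lambda>v. (u powr (1/K) + v powr (1/K)) powr K - u - v))"
    proof -
      have "(\<integral>x. f1 x \<partial>lborel) = lin c (\<lambda>u. \<integral>x. lin c (\<lambda>v. ((1 - exp (- (x * u powr (1 / K)))) * (1 - exp (- (x * v powr (1 / K))))) * pow_weight K x) \<partial>lborel)"
        unfolding f1e by (intro lin_integral[OF c] i1) auto
      also have "\<dots> = lin c (\<lambda>u. lin c (\<lambda>v. \<integral>x. ((1 - exp (- (x * u powr (1 / K)))) * (1 - exp (- (x * v powr (1 / K))))) * pow_weight K x \<partial>lborel))"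
        by (intro lin_cong[OF c] lin_integral[OF c] i1) auto
      also have "\<dots> = lin c (\<lambda>u. lin c (\<lambda>v. D1 * ((u powr (1/K) + v powr (1/K)) powr K - u - v)))"
        by (intro lin_cong[OF c]) (subst e1, auto simp: Kpow)
      finally show ?thesis by (simp add: lin_scale_right)
    qed
    have I2: "(\<integral>x. f2 x \<partial>lborel) = lin c (\<lambda>u. D2 * ((1 + u powr (1 / K)) powr (K - 1) - 1))"
    proof -
      have "(\<integral>x. f2 x \<partial>lborel) = lin c (\<lambda>u. \<integral>x. (exp (- x) * (1 - exp (- (x * u powr (1 / K))))) * pow_weight (K - 1) x \<partial>lborel)"
        unfolding f2e by (intro lin_integral[OF c] i2) auto
      also have "\<dots> = lin c (\<lambda>u. D2 * ((1 + u powr (1 / K)) powr (K - 1) - 1))"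
        by (intro lin_cong[OF c] e2) auto
      finally show ?thesis .
    qed
    have L: "lin c (drift_kernel K) = \<alpha> * (\<integral>x. f2 x \<partial>lborel)"
      unfolding I2 drift_kernel_def \<alpha>_def lin_scale_right using D2 by simp
    have Q: "lin c (\<lambda>u. lin c (bifbm_cov K u)) = \<beta> * (\<integral>x. f1 x \<partial>lborel) + 2 / 2 powr K * lin c (\<lambda>u. lin c (\<lambda>v. min u v))"
      unfolding I1 \<beta>_def bifbm_cov_split lin_scale_right lin_add_right using D1 by simp
    have "2 * \<alpha> * f2 x \<le> \<beta> * f1 x + (\<alpha>\<^sup>2 / \<beta>) * (exp (- x) * exp (- x) * pow_weight (K - 2) x)" for x
    proof (cases "0 < x")
      case True
      \<comment> \<open>The weights \<open>\<alpha>\<close> and \<open>\<beta>\<close> are those with which the two integrals enter the functional and the form.\<close>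
      let ?a = "\<beta> * S x" and ?b = "\<alpha> * (exp (- x) * x)"
      have w: "pow_weight (K - 1) x = x * pow_weight K x" "pow_weight (K - 2) x = x\<^sup>2 * pow_weight K x"
        using True powr_add[of x 1 "- K - 1"] powr_add[of x 2 "- K - 1"] by (auto simp: pow_weight_def)
      have "0 \<le> (?a - ?b)\<^sup>2 / \<beta> * pow_weight K x" using \<beta> by (auto simp: pow_weight_def)
      also have "\<dots> = \<beta> * f1 x + (\<alpha>\<^sup>2 / \<beta>) * (exp (- x) * exp (- x) * pow_weight (K - 2) x) - 2 * \<alpha> * f2 x"
        unfolding f1_def f2_def w using \<beta> by (simp add: field_simps power2_eq_square)
      finally show ?thesis by simp
    qed (simp add: f1_def f2_def pow_weight_def)
    then have "(\<integral>x. 2 * \<alpha> * f2 x \<partial>lborel) \<le> (\<integral>x. \<beta> * f1 x + (\<alpha>\<^sup>2 / \<beta>) * (exp (- x) * exp (- x) * pow_weight (K - 2) x) \<partial>lborel)"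
      using f1i f2i i3 by (intro integral_mono) auto
    also have "\<dots> = \<beta> * (\<integral>x. f1 x \<partial>lborel) + C"
      unfolding C_def using f1i i3 by (subst Bochner_Integration.integral_add) auto
    finally have "2 * lin c (drift_kernel K) \<le> \<beta> * (\<integral>x. f1 x \<partial>lborel) + C" unfolding L by simp
    moreover have "0 \<le> 2 / 2 powr K * lin c (\<lambda>u. lin c (\<lambda>v. min u v))" using min_kernel_nonneg[OF c] by simp
    ultimately show "2 * lin c (drift_kernel K) \<le> lin c (\<lambda>u. lin c (bifbm_cov K u)) + C" unfolding Q by linarith
  qed
qed

lemma bifbm_cov_sym: "bifbm_cov K t s = bifbm_cov K s t"
  by (simp add: bifbm_cov_def add.commute abs_minus_commute)

lemma bifbm_cov_scale:
  assumes "0 < K" "0 < s" "0 \<le> u" "0 \<le> v"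
  shows "bifbm_cov K (s * u) (s * v) = s * bifbm_cov K u v"
proof -
  have "(s * u) powr (1/K) + (s * v) powr (1/K) = s powr (1/K) * (u powr (1/K) + v powr (1/K))"
    using assms by (simp add: powr_mult algebra_simps)
  then have "((s * u) powr (1/K) + (s * v) powr (1/K)) powr K = s * (u powr (1/K) + v powr (1/K)) powr K"
    using assms by (simp add: powr_mult powr_powr)
  moreover have "\<bar>s * u - s * v\<bar> = s * \<bar>u - v\<bar>" using assms by (simp add: abs_mult right_diff_distrib[symmetric])
  ultimately show ?thesis by (simp add: bifbm_cov_def algebra_simps)
qed

lemma bifbm_cov_diag:
  assumes "0 < K" "0 \<le> t" shows "bifbm_cov K t t = t"
  using assms by (simp add: bifbm_cov_def powr_mult powr_powr flip: mult_2)

lemma bifbm_cov_continuous: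
  assumes "0 < K" "0 \<le> s"
  shows "((\<lambda>u. bifbm_cov K u s) \<longlongrightarrow> bifbm_cov K s s) (at_right s)"
proof -
  have ev: "eventually (\<lambda>u. 0 \<le> u) (at_right s)"
    using assms by (auto simp: eventually_at_filter)
  have 1: "((\<lambda>u. u powr (1/K)) \<longlongrightarrow> s powr (1/K)) (at_right s)"
    using assms ev by (intro tendsto_powr2 tendsto_intros) auto
  have 2: "((\<lambda>u. (u powr (1/K) + s powr (1/K)) powr K) \<longlongrightarrow> (s powr (1/K) + s powr (1/K)) powr K) (at_right s)"
    using assms by (intro tendsto_powr2 tendsto_add 1 tendsto_const) auto
  show ?thesis unfolding bifbm_cov_def by (intro tendsto_intros 2)
qed

text \<open>
  For \<open>v \<le> u\<close> the Brownian part of the covariance with time \<open>v\<close> is constant on \<open>{u..t}\<close>, so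
  only the smooth part contributes to the increment, through its derivative.
\<close>

lemma bifbm_cov_increment:
  assumes K: "1 < K" and v: "0 \<le> v" "v \<le> u" and u: "0 < u" "u \<le> t"
  shows "has_bochner_integral lborel (\<lambda>s. drift_kernel K (v / s) * indicator {u..t} s)
    (bifbm_cov K t v - bifbm_cov K u v)"
proof -
  let ?F = "\<lambda>s. 1 / 2 powr K * ((s powr (1/K) + v powr (1/K)) powr K - (s - v))"
  have "has_bochner_integral lborel (\<lambda>s. drift_kernel K (v / s) * indicator {u..t} s) (?F t - ?F u)"
  proof (rule has_bochner_integral_FTC_Icc_real)
    fix s assume "u \<le> s" "s \<le> t"
    then have s: "0 < s" using u by simp
    have e: "(1 + (v / s) powr (1/K)) powr (K - 1) = (s powr (1/K) + v powr (1/K)) powr (K - 1) * s powr (1/K - 1)"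
    proof -
      have "s powr (1/K) + v powr (1/K) = s powr (1/K) * (1 + (v / s) powr (1/K))"
        using s v by (simp add: powr_divide field_simps)
      then have "(s powr (1/K) + v powr (1/K)) powr (K - 1) = s powr ((1/K) * (K - 1)) * (1 + (v / s) powr (1/K)) powr (K - 1)"
        by (simp add: powr_mult powr_powr)
      moreover have "s powr ((1/K) * (K - 1)) * s powr (1/K - 1) = 1"
        using s K by (simp add: powr_add[symmetric] field_simps)
      ultimately show ?thesis by (simp add: mult_ac)
    qed
    have pos: "0 < s powr (1/K) + v powr (1/K)" using s by (simp add: add_pos_nonneg)
    have "(?F has_real_derivative 1 / 2 powr K * (K * (s powr (1/K) + v powr (1/K)) powr (K - 1) * ((1/K) * s powr (1/K - 1)) - 1)) (at s)"
      using s pos K by (auto intro!: derivative_eq_intros)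
    also have "1 / 2 powr K * (K * (s powr (1/K) + v powr (1/K)) powr (K - 1) * ((1/K) * s powr (1/K - 1)) - 1) = drift_kernel K (v / s)"
      unfolding drift_kernel_def e using K by simp
    finally show "DERIV ?F s :> drift_kernel K (v / s)" .
    have vs: "((\<lambda>x. (v / x) powr (1/K)) \<longlongrightarrow> (v / s) powr (1/K)) (at s)"
    proof -
      have "eventually (\<lambda>x. 0 < x) (at s)" using s by (intro eventually_at_rightI order_tendstoD(1)[OF tendsto_ident_at])
      then have "eventually (\<lambda>x. 0 \<le> v / x) (at s)" by eventually_elim (use v in auto)
      then show ?thesis using K s by (intro tendsto_powr2 tendsto_intros) auto
    qed
    have "1 + (v / s) powr (1/K) \<noteq> 0" by (smt (verit) powr_ge_zero)
    then show "isCont (\<lambda>s. drift_kernel K (v / s)) s"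
      unfolding isCont_def drift_kernel_def
      by (intro tendsto_mult tendsto_diff tendsto_const tendsto_powr tendsto_add vs)
  qed (use u in auto)
  moreover have "?F t = bifbm_cov K t v" "?F u = bifbm_cov K u v" using v u by (auto simp: bifbm_cov_def)
  ultimately show ?thesis by simp
qed

section \<open>Gaussian variables and orthogonality through characters\<close>

text \<open>
  The degenerate alternative of \<open>gaussian_rv\<close> is the point mass at \<open>0\<close> once the mean vanishes.
\<close>

lemma (in prob_space) gaussian_centered:
  assumes g: "gaussian_rv M W" and mean: "expectation W = 0"
  shows "integrable M (\<lambda>x. (W x)\<^sup>2)"
    and "expectation (\<lambda>x. cos (W x)) = exp (- expectation (\<lambda>x. (W x)\<^sup>2) / 2)"
    and "expectation (\<lambda>x. sin (W x)) = 0"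
proof -
  have W[measurable]: "W \<in> borel_measurable M" using g by (simp add: gaussian_rv_def)
  have "integrable M (\<lambda>x. (W x)\<^sup>2) \<and>
    expectation (\<lambda>x. cos (W x)) = exp (- expectation (\<lambda>x. (W x)\<^sup>2) / 2) \<and> expectation (\<lambda>x. sin (W x)) = 0"
  proof (cases "\<exists>\<mu> \<sigma>. \<sigma> > 0 \<and> distributed M lborel W (\<lambda>x. ennreal (normal_density \<mu> \<sigma> x))")
    case True
    then obtain \<mu> \<sigma> where s: "0 < \<sigma>" and D: "distributed M lborel W (normal_density \<mu> \<sigma>)" by auto
    have "\<mu> = 0" using normal_distributed_expectation[OF s D] mean by simp
    then have D0: "distributed M lborel (\<lambda>x. W x / \<sigma>) std_normal_density"
      using D normal_standard_normal_convert[OF s, of W \<mu>] by simp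
    interpret N: real_distribution std_normal_distribution by (rule real_dist_normal_dist)
    have sq: "integrable M (\<lambda>x. (W x / \<sigma>)\<^sup>2)"
      using distributed_integrable[OF D0, of "\<lambda>x. x\<^sup>2"] integrable_std_normal_moment[of 2] by simp
    have var: "expectation (\<lambda>x. (W x / \<sigma>)\<^sup>2) = 1"
      using distributed_integral[OF D0, of "\<lambda>x. x\<^sup>2"] integral_std_normal_moment_even[of 1] by simp
    have eq: "expectation (\<lambda>x. h (W x / \<sigma>)) = (\<integral>x. h x \<partial>std_normal_distribution)"
      if [measurable]: "h \<in> borel_measurable borel" for h :: "real \<Rightarrow> real"
      using distributed_integral[OF D0, of h] by (subst integral_real_density) auto
    have ch: "char std_normal_distribution \<sigma> = complex_of_real (exp (- \<sigma>\<^sup>2 / 2))"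
      by (simp add: char_std_normal_distribution)
    have ii: "integrable std_normal_distribution (\<lambda>x. iexp (\<sigma> * x))" by (rule N.integrable_iexp) simp_all
    have c: "(\<integral>x. cos (\<sigma> * x) \<partial>std_normal_distribution) = exp (- \<sigma>\<^sup>2 / 2)"
      using integral_Re[OF ii] ch by (simp add: char_def Re_exp)
    have sn: "(\<integral>x. sin (\<sigma> * x) \<partial>std_normal_distribution) = 0"
      using integral_Im[OF ii] ch by (simp add: char_def Im_exp)
    have "integrable M (\<lambda>x. (W x)\<^sup>2)"
      using Bochner_Integration.integrable_mult_right[OF sq, of "\<sigma>\<^sup>2"] s by (simp add: power_divide)
    moreover have "expectation (\<lambda>x. (W x)\<^sup>2) = \<sigma>\<^sup>2"
      using var s by (simp add: power_divide field_simps)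
    moreover have "expectation (\<lambda>x. cos (W x)) = exp (- \<sigma>\<^sup>2 / 2)"
      using eq[of "\<lambda>x. cos (\<sigma> * x)"] c s by simp
    moreover have "expectation (\<lambda>x. sin (W x)) = 0"
      using eq[of "\<lambda>x. sin (\<sigma> * x)"] sn s by simp
    ultimately show ?thesis by simp
  next
    case False
    then obtain c where c: "AE x in M. W x = c" using g unfolding gaussian_rv_def by blast
    have "expectation W = expectation (\<lambda>_. c)" by (rule integral_cong_AE) (use c in auto)
    then have z: "AE x in M. W x = 0" using c mean by (simp add: prob_space)
    have "integrable M (\<lambda>x. (W x)\<^sup>2) \<longleftrightarrow> integrable M (\<lambda>x. 0::real)"
      by (rule integrable_cong_AE) (use z in auto)
    moreover have "expectation (\<lambda>x. (W x)\<^sup>2) = expectation (\<lambda>_. 0)" by (rule integral_cong_AE) (use z in auto)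
    moreover have "expectation (\<lambda>x. cos (W x)) = expectation (\<lambda>_. 1)" by (rule integral_cong_AE) (use z in auto)
    moreover have "expectation (\<lambda>x. sin (W x)) = expectation (\<lambda>_. 0)" by (rule integral_cong_AE) (use z in auto)
    ultimately show ?thesis by (simp add: prob_space)
  qed
  then show "integrable M (\<lambda>x. (W x)\<^sup>2)"
    "expectation (\<lambda>x. cos (W x)) = exp (- expectation (\<lambda>x. (W x)\<^sup>2) / 2)"
    "expectation (\<lambda>x. sin (W x)) = 0" by auto
qed

lemma integrable_mult_of_squares:
  fixes f g :: "'a \<Rightarrow> real"
  assumes [measurable]: "f \<in> borel_measurable M" "g \<in> borel_measurable M"
    and "integrable M (\<lambda>x. (f x)\<^sup>2)" "integrable M (\<lambda>x. (g x)\<^sup>2)"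
  shows "integrable M (\<lambda>x. f x * g x)"
proof (rule Bochner_Integration.integrable_bound)
  show "integrable M (\<lambda>x. (f x)\<^sup>2 + (g x)\<^sup>2)" using assms by simp
  show "AE x in M. norm (f x * g x) \<le> norm ((f x)\<^sup>2 + (g x)\<^sup>2)"
  proof (intro AE_I2)
    fix x
    have "0 \<le> (\<bar>f x\<bar> - \<bar>g x\<bar>)\<^sup>2" "0 \<le> \<bar>f x\<bar> * \<bar>g x\<bar>" by auto
    then show "norm (f x * g x) \<le> norm ((f x)\<^sup>2 + (g x)\<^sup>2)"
      by (simp add: power2_diff abs_mult) (use \<open>0 \<le> \<bar>f x\<bar> * \<bar>g x\<bar>\<close> in linarith)
  qed
qed measurable

lemma (in prob_space) integrable_of_square:
  fixes f :: "'a \<Rightarrow> real"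
  assumes "f \<in> borel_measurable M" "integrable M (\<lambda>x. (f x)\<^sup>2)"
  shows "integrable M f"
  using integrable_mult_of_squares[of f M "\<lambda>_. 1"] assms by simp

lemma expectation_difference_quotient:
  fixes Y Z :: "'a \<Rightarrow> real" and g g' :: "real \<Rightarrow> real"
  assumes Y: "integrable M Y" and [measurable]: "Z \<in> borel_measurable M" "g \<in> borel_measurable borel"
      "g' \<in> borel_measurable borel"
    and lip: "\<And>x y. \<bar>g x - g y\<bar> \<le> \<bar>x - y\<bar>" and d: "\<And>x. (g has_real_derivative g' x) (at x)"
  shows "(\<lambda>n. \<integral>x. (g (1 / real (Suc n) * Y x + Z x) - g (Z x)) / (1 / real (Suc n)) \<partial>M)
    \<longlonglongrightarrow> (\<integral>x. Y x * g' (Z x) \<partial>M)"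
proof (rule integral_dominated_convergence[where w="\<lambda>x. \<bar>Y x\<bar>"])
  have [measurable]: "Y \<in> borel_measurable M" using Y by simp
  show "(\<lambda>x. Y x * g' (Z x)) \<in> borel_measurable M" by measurable
  show "(\<lambda>x. (g (1 / real (Suc n) * Y x + Z x) - g (Z x)) / (1 / real (Suc n))) \<in> borel_measurable M" for n
    by measurable
  show "integrable M (\<lambda>x. \<bar>Y x\<bar>)" using Y by simp
  show "AE x in M. norm ((g (1 / real (Suc n) * Y x + Z x) - g (Z x)) / (1 / real (Suc n))) \<le> \<bar>Y x\<bar>" for n
  proof (intro AE_I2)
    fix x
    have "\<bar>g (1 / real (Suc n) * Y x + Z x) - g (Z x)\<bar> \<le> \<bar>1 / real (Suc n) * Y x\<bar>"
      using lip[of "1 / real (Suc n) * Y x + Z x" "Z x"] by simp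
    then show "norm ((g (1 / real (Suc n) * Y x + Z x) - g (Z x)) / (1 / real (Suc n))) \<le> \<bar>Y x\<bar>"
      unfolding real_norm_def abs_divide by (simp add: abs_mult field_simps del: of_nat_Suc)
  qed
  have h: "filterlim (\<lambda>n. 1 / real (Suc n)) (at 0) sequentially"
    by (rule filterlim_atI[OF lim_inverse_n'[THEN LIMSEQ_Suc]]) auto
  show "AE x in M. (\<lambda>n. (g (1 / real (Suc n) * Y x + Z x) - g (Z x)) / (1 / real (Suc n))) \<longlonglongrightarrow> Y x * g' (Z x)"
  proof (intro AE_I2)
    fix x
    have "((\<lambda>h. g (h * Y x + Z x)) has_real_derivative g' (0 * Y x + Z x) * Y x) (at 0)"
      by (rule DERIV_chain2[OF d]) (auto intro!: derivative_eq_intros)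
    then have "((\<lambda>h. (g (h * Y x + Z x) - g (Z x)) / h) \<longlongrightarrow> Y x * g' (Z x)) (at 0)"
      by (simp add: DERIV_def mult.commute)
    from filterlim_compose[OF this h]
    show "(\<lambda>n. (g (1 / real (Suc n) * Y x + Z x) - g (Z x)) / (1 / real (Suc n))) \<longlonglongrightarrow> Y x * g' (Z x)" .
  qed
qed

lemma abs_cos_diff_le: "\<bar>cos x - cos y\<bar> \<le> \<bar>x - y\<bar>" for x y :: real
proof -
  have "\<bar>sin ((x + y) / 2)\<bar> * \<bar>sin ((y - x) / 2)\<bar> \<le> 1 * \<bar>(y - x) / 2\<bar>"
    by (intro mult_mono abs_sin_x_le_abs_x) auto
  then show ?thesis by (simp add: cos_diff_cos abs_mult)
qed

lemma abs_sin_diff_le: "\<bar>sin x - sin y\<bar> \<le> \<bar>x - y\<bar>" for x y :: real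
  using abs_cos_diff_le[of "pi/2 - x" "pi/2 - y"] by (simp add: cos_diff abs_minus_commute)

text \<open>
  Differentiate \<open>E (exp (i (h * Y + Z)))\<close> at \<open>h = 0\<close>, once under the expectation and once in its
  closed form. Only the laws of the linear combinations \<open>h * Y + Z\<close> enter.
\<close>

lemma (in prob_space) gaussian_integration_by_parts:
  assumes gauss: "\<And>h. gaussian_rv M (\<lambda>x. h * Y x + Z x)"
    and mean: "\<And>h. expectation (\<lambda>x. h * Y x + Z x) = 0"
    and [measurable]: "Y \<in> borel_measurable M" "Z \<in> borel_measurable M"
    and Y2: "integrable M (\<lambda>x. (Y x)\<^sup>2)"
  shows "expectation (\<lambda>x. Y x * cos (Z x)) = 0"
    and "expectation (\<lambda>x. Y x * sin (Z x)) = exp (- expectation (\<lambda>x. (Z x)\<^sup>2) / 2) * expectation (\<lambda>x. Y x * Z x)"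
proof -
  have Y: "integrable M Y" by (rule integrable_of_square[OF _ Y2]) measurable
  have Z2: "integrable M (\<lambda>x. (Z x)\<^sup>2)" using gaussian_centered(1)[OF gauss mean, of 0] by simp
  have YZ: "integrable M (\<lambda>x. Y x * Z x)" by (rule integrable_mult_of_squares[OF _ _ Y2 Z2]) measurable
  have bnd: "integrable M (\<lambda>x. cos (W x))" "integrable M (\<lambda>x. sin (W x))" if [measurable]: "W \<in> borel_measurable M" for W :: "'a \<Rightarrow> real"
    by (rule integrable_const_bound[where B=1]; simp)+
  have sq: "expectation (\<lambda>x. (h * Y x + Z x)\<^sup>2) = h\<^sup>2 * expectation (\<lambda>x. (Y x)\<^sup>2) + 2 * h * expectation (\<lambda>x. Y x * Z x) + expectation (\<lambda>x. (Z x)\<^sup>2)" for h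
  proof -
    have "(h * Y x + Z x)\<^sup>2 = h\<^sup>2 * (Y x)\<^sup>2 + 2 * h * (Y x * Z x) + (Z x)\<^sup>2" for x
      by (simp add: power2_eq_square algebra_simps)
    then show ?thesis using Y2 Z2 YZ by simp
  qed
  let ?F = "\<lambda>h. exp (- (h\<^sup>2 * expectation (\<lambda>x. (Y x)\<^sup>2) + 2 * h * expectation (\<lambda>x. Y x * Z x) + expectation (\<lambda>x. (Z x)\<^sup>2)) / 2)"
  have cosF: "expectation (\<lambda>x. cos (h * Y x + Z x)) = ?F h" for h
    using gaussian_centered(2)[OF gauss mean, of h] sq by simp
  have h: "filterlim (\<lambda>n. 1 / real (Suc n)) (at 0) sequentially"
    by (rule filterlim_atI[OF lim_inverse_n'[THEN LIMSEQ_Suc]]) auto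
  have "(?F has_real_derivative - expectation (\<lambda>x. Y x * Z x) * ?F 0) (at 0)"
    by (auto intro!: derivative_eq_intros)
  then have "((\<lambda>h. (?F h - ?F 0) / h) \<longlongrightarrow> - expectation (\<lambda>x. Y x * Z x) * ?F 0) (at 0)"
    by (simp add: DERIV_def)
  from filterlim_compose[OF this h]
  have "(\<lambda>n. (?F (1 / real (Suc n)) - ?F 0) / (1 / real (Suc n))) \<longlonglongrightarrow> - expectation (\<lambda>x. Y x * Z x) * ?F 0" .
  moreover have "(?F (1 / real (Suc n)) - ?F 0) / (1 / real (Suc n))
    = expectation (\<lambda>x. (cos (1 / real (Suc n) * Y x + Z x) - cos (Z x)) / (1 / real (Suc n)))" for n
    using cosF[of "1 / real (Suc n)"] cosF[of 0] bnd by simp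
  ultimately have "(\<lambda>n. expectation (\<lambda>x. (cos (1 / real (Suc n) * Y x + Z x) - cos (Z x)) / (1 / real (Suc n))))
     \<longlonglongrightarrow> - expectation (\<lambda>x. Y x * Z x) * ?F 0" by simp
  moreover have "(\<lambda>n. expectation (\<lambda>x. (cos (1 / real (Suc n) * Y x + Z x) - cos (Z x)) / (1 / real (Suc n))))
     \<longlonglongrightarrow> expectation (\<lambda>x. Y x * - sin (Z x))"
    by (rule expectation_difference_quotient[OF Y, where g=cos and g'="\<lambda>x. - sin x"])
      (use abs_cos_diff_le in \<open>auto intro!: derivative_eq_intros\<close>)
  ultimately have "- expectation (\<lambda>x. Y x * Z x) * ?F 0 = expectation (\<lambda>x. Y x * - sin (Z x))"
    by (rule LIMSEQ_unique)
  then show "expectation (\<lambda>x. Y x * sin (Z x)) = exp (- expectation (\<lambda>x. (Z x)\<^sup>2) / 2) * expectation (\<lambda>x. Y x * Z x)"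
    by (simp add: mult.commute)
  have "expectation (\<lambda>x. (sin (1 / real (Suc n) * Y x + Z x) - sin (Z x)) / (1 / real (Suc n))) = 0" for n
    using gaussian_centered(3)[OF gauss mean, of "1 / real (Suc n)"] gaussian_centered(3)[OF gauss mean, of 0] bnd by simp
  moreover have "(\<lambda>n. expectation (\<lambda>x. (sin (1 / real (Suc n) * Y x + Z x) - sin (Z x)) / (1 / real (Suc n))))
     \<longlonglongrightarrow> expectation (\<lambda>x. Y x * cos (Z x))"
    by (rule expectation_difference_quotient[OF Y, where g=sin and g'=cos])
      (use abs_sin_diff_le in \<open>auto intro!: derivative_eq_intros\<close>)
  ultimately show "expectation (\<lambda>x. Y x * cos (Z x)) = 0"
    by (simp only: LIMSEQ_const_iff)
qed

text \<open>
  The positive and negative parts of \<open>Y\<close>, as densities, give \<open>Z\<close> two laws with the same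
  characteristic function; both have the same mass, as \<open>t = 0\<close> shows.
\<close>

lemma (in prob_space) fourier_zero_imp_zero:
  fixes Y Z :: "'a \<Rightarrow> real"
  assumes Y: "integrable M Y" and [measurable]: "Z \<in> borel_measurable M"
    and c: "\<And>t. expectation (\<lambda>x. Y x * cos (t * Z x)) = 0"
    and s: "\<And>t. expectation (\<lambda>x. Y x * sin (t * Z x)) = 0"
    and A[measurable]: "A \<in> sets borel"
  shows "expectation (\<lambda>x. Y x * indicator A (Z x)) = 0"
proof -
  have [measurable]: "Y \<in> borel_measurable M" using Y by simp
  define P where "P = (\<lambda>x. max 0 (Y x))"
  define N where "N = (\<lambda>x. max 0 (- Y x))"
  have Pi: "integrable M P" and Ni: "integrable M N" unfolding P_def N_def using Y by auto
  have [measurable]: "P \<in> borel_measurable M" "N \<in> borel_measurable M" using Pi Ni by auto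
  have PN: "Y x = P x - N x" for x by (simp add: P_def N_def)
  have nn: "0 \<le> P x" "0 \<le> N x" for x by (auto simp: P_def N_def)
  define m where "m = expectation P"
  have mN: "expectation N = m"
    using c[of 0] Pi Ni unfolding PN m_def by simp
  have ind: "integrable M (\<lambda>x. Q x * indicator A (Z x))" if "integrable M Q" for Q :: "'a \<Rightarrow> real"
  proof (rule Bochner_Integration.integrable_bound[OF that])
    show "(\<lambda>x. Q x * indicator A (Z x)) \<in> borel_measurable M" using that by measurable
  qed (auto simp: indicator_def)
  have split: "expectation (\<lambda>x. Y x * indicator A (Z x)) = expectation (\<lambda>x. P x * indicator A (Z x)) - expectation (\<lambda>x. N x * indicator A (Z x))"
    unfolding PN left_diff_distrib using ind Pi Ni by simp
  have "0 \<le> m" unfolding m_def using nn by simp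
  show ?thesis
  proof (cases "m = 0")
    case True
    then have "AE x in M. P x = 0" "AE x in M. N x = 0"
      using integral_nonneg_eq_0_iff_AE[OF Pi] integral_nonneg_eq_0_iff_AE[OF Ni] nn mN m_def by auto
    then have "AE x in M. Y x * indicator A (Z x) = 0" by eventually_elim (simp add: PN)
    then show ?thesis by (subst integral_cong_AE[where g="\<lambda>_. 0"]) auto
  next
    case False
    with \<open>0 \<le> m\<close> have m: "0 < m" by simp
    define \<mu> where "\<mu> Q = distr (density M (\<lambda>x. ennreal (Q x / m))) borel Z" for Q
    have dist: "real_distribution (\<mu> Q)" and chr: "char (\<mu> Q) t = (CLINT x|M. (Q x / m) *\<^sub>R iexp (t * Z x))"
      and meas: "measure (\<mu> Q) A = expectation (\<lambda>x. Q x * indicator A (Z x)) / m"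
      if Qi: "integrable M Q" and Qn: "\<And>x. 0 \<le> Q x" and Qm: "expectation Q = m" for Q t
    proof -
      have [measurable]: "Q \<in> borel_measurable M" using Qi by simp
      have "(\<integral>\<^sup>+x. ennreal (Q x / m) \<partial>M) = ennreal (expectation (\<lambda>x. Q x / m))"
        using Qi Qn m by (intro nn_integral_eq_integral) auto
      then have "(\<integral>\<^sup>+x. ennreal (Q x / m) \<partial>M) = 1" using Qm m by simp
      then interpret D: prob_space "density M (\<lambda>x. ennreal (Q x / m))"
        by (intro prob_spaceI) (simp add: emeasure_density cong: nn_integral_cong)
      show "real_distribution (\<mu> Q)" unfolding \<mu>_def by (intro D.real_distribution_distr) simp
      show "char (\<mu> Q) t = (CLINT x|M. (Q x / m) *\<^sub>R iexp (t * Z x))"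
        unfolding char_def \<mu>_def using Qn m by (subst integral_distr, simp, simp, subst integral_density) auto
      have "measure (\<mu> Q) A = (\<integral>x. indicator A x \<partial>\<mu> Q)" by (simp add: \<mu>_def)
      also have "\<dots> = (\<integral>x. (Q x / m) *\<^sub>R indicator A (Z x) \<partial>M)"
        unfolding \<mu>_def using Qn m by (subst integral_distr, simp, simp, subst integral_density) auto
      finally show "measure (\<mu> Q) A = expectation (\<lambda>x. Q x * indicator A (Z x)) / m" by simp
    qed
    have "char (\<mu> P) = char (\<mu> N)"
    proof
      fix t
      have ci: "integrable M (\<lambda>x. (Q x / m) *\<^sub>R iexp (t * Z x))" if "integrable M Q" for Q :: "'a \<Rightarrow> real"
      proof (rule Bochner_Integration.integrable_bound)
        show "integrable M (\<lambda>x. Q x / m)" using that by simp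
        show "(\<lambda>x. (Q x / m) *\<^sub>R iexp (t * Z x)) \<in> borel_measurable M" using that by measurable
      qed auto
      have z: "(CLINT x|M. (Y x / m) *\<^sub>R iexp (t * Z x)) = 0"
      proof (rule complex_eqI)
        show "Re (CLINT x|M. (Y x / m) *\<^sub>R iexp (t * Z x)) = Re 0"
          using c[of t] by (subst integral_Re[symmetric, OF ci[OF Y]]) (simp add: Re_exp)
        show "Im (CLINT x|M. (Y x / m) *\<^sub>R iexp (t * Z x)) = Im 0"
          using s[of t] by (subst integral_Im[symmetric, OF ci[OF Y]]) (simp add: Im_exp)
      qed
      have "(CLINT x|M. (Y x / m) *\<^sub>R iexp (t * Z x)) = (CLINT x|M. (P x / m) *\<^sub>R iexp (t * Z x)) - (CLINT x|M. (N x / m) *\<^sub>R iexp (t * Z x))"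
        unfolding PN diff_divide_distrib scaleR_left_diff_distrib
        by (rule Bochner_Integration.integral_diff[OF ci[OF Pi] ci[OF Ni]])
      then show "char (\<mu> P) t = char (\<mu> N) t"
        using z chr[OF Pi nn(1)] chr[OF Ni nn(2) mN] by (simp add: m_def)
    qed
    then have "\<mu> P = \<mu> N"
      using dist[OF Pi nn(1)] dist[OF Ni nn(2) mN] by (intro Levy_uniqueness) (auto simp: m_def)
    then show ?thesis
      using split m meas[OF Pi nn(1)] meas[OF Ni nn(2) mN] by (simp add: m_def)
  qed
qed

text \<open>
  Vanishing of \<open>E (Y * exp (i Z))\<close> for all \<open>Z\<close> in \<open>V\<close>, written with real integrals. This
  property, unlike \<open>E Y = 0\<close>, is inherited by \<open>Y\<close> times an indicator of an event depending on
  \<open>V\<close>, which allows conditioning on one variable at a time.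
\<close>

definition (in prob_space) trig_orthogonal :: "('a \<Rightarrow> real) set \<Rightarrow> ('a \<Rightarrow> real) \<Rightarrow> bool" where
  "trig_orthogonal V Y \<longleftrightarrow> integrable M Y \<and>
     (\<forall>Z\<in>V. expectation (\<lambda>x. Y x * cos (Z x)) = 0 \<and> expectation (\<lambda>x. Y x * sin (Z x)) = 0)"

lemma (in prob_space) integrable_mult_bounded:
  fixes Y f :: "'a \<Rightarrow> real"
  assumes Y: "integrable M Y" and f: "f \<in> borel_measurable M" "\<And>x. \<bar>f x\<bar> \<le> 1"
  shows "integrable M (\<lambda>x. Y x * f x)"
proof (rule Bochner_Integration.integrable_bound[OF Y])
  show "(\<lambda>x. Y x * f x) \<in> borel_measurable M" using Y f by measurable
  show "AE x in M. norm (Y x * f x) \<le> norm (Y x)"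
    using f(2) by (auto intro!: AE_I2 mult_left_le simp: abs_mult)
qed

text \<open>
  The sets \<open>A\<close> such that multiplication by \<open>indicator A\<close> preserves the property for every \<open>Y\<close> form
  a \<open>\<sigma>\<close>-algebra: stability under products replaces a \<open>\<pi>\<close>-system of generators.
\<close>

lemma (in prob_space) trig_orthogonal_sigma:
  assumes V: "\<And>Z. Z \<in> V \<Longrightarrow> Z \<in> borel_measurable M"
    and gens: "\<And>C Y. C \<in> G \<Longrightarrow> trig_orthogonal V Y \<Longrightarrow> trig_orthogonal V (\<lambda>x. Y x * indicator C x)"
    and G: "G \<subseteq> sets M"
    and A: "A \<in> sigma_sets (space M) G"
  shows "trig_orthogonal V Y \<Longrightarrow> trig_orthogonal V (\<lambda>x. Y x * indicator A x)"
proof -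
  have AM: "A \<in> sets M" if "A \<in> sigma_sets (space M) G" for A
    using that G by (metis sets.sigma_sets_subset subsetD)
  have comp: "trig_orthogonal V (\<lambda>x. Y x - Y' x)" if Y: "trig_orthogonal V Y" "trig_orthogonal V Y'" for Y Y'
    unfolding trig_orthogonal_def
  proof (intro conjI ballI)
    have i: "integrable M Y" "integrable M Y'" using Y by (auto simp: trig_orthogonal_def)
    then show "integrable M (\<lambda>x. Y x - Y' x)" by simp
    fix Z assume Z: "Z \<in> V"
    have [measurable]: "Z \<in> borel_measurable M" by (rule V[OF Z])
    show "expectation (\<lambda>x. (Y x - Y' x) * cos (Z x)) = 0" "expectation (\<lambda>x. (Y x - Y' x) * sin (Z x)) = 0"
      unfolding left_diff_distrib
      by (subst Bochner_Integration.integral_diff; (intro integrable_mult_bounded i)?; (simp; fail)?;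
        use Y Z in \<open>simp add: trig_orthogonal_def\<close>)+
  qed
  show "trig_orthogonal V (\<lambda>x. Y x * indicator A x)" if "trig_orthogonal V Y"
    using A that
  proof (induction A arbitrary: Y rule: sigma_sets.induct)
    case (Basic a) then show ?case using gens by blast
  next
    case Empty then show ?case by (simp add: trig_orthogonal_def)
  next
    case (Compl a)
    have "trig_orthogonal V (\<lambda>x. Y x - Y x * indicator a x)" using Compl by (intro comp)
    moreover have "Y x - Y x * indicator a x = Y x * indicator (space M - a) x" if "x \<in> space M" for x
      using that by (auto simp: indicator_def)
    ultimately show ?case unfolding trig_orthogonal_def
      by (simp cong: Bochner_Integration.integral_cong Bochner_Integration.integrable_cong)
  next
    case (Union a)
    have aM[measurable]: "a i \<in> sets M" for i using AM Union.hyps by blast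
    have i: "integrable M Y" using Union.prems by (simp add: trig_orthogonal_def)
    have [measurable]: "Y \<in> borel_measurable M" using i by simp
    have "trig_orthogonal V (\<lambda>x. Y x - Y x * indicator (\<Union>i<n. a i) x)" for n
    proof (induction n)
      case 0 then show ?case using Union.prems by simp
    next
      case (Suc n)
      \<comment> \<open>Remove the sets one at a time: each step multiplies by the complement of the next set.\<close>
      from comp[OF Suc Union.IH[OF Suc, of n]]
      show ?case by (rule back_subst[of "trig_orthogonal V"]) (auto simp: indicator_def lessThan_Suc fun_eq_iff)
    qed
    then have part: "trig_orthogonal V (\<lambda>x. Y x * indicator (\<Union>i<n. a i) x)" for n
      using comp[OF Union.prems] by fastforce
    have "trig_orthogonal V (\<lambda>x. Y x * indicator (\<Union>(range a)) x)"
      unfolding trig_orthogonal_def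
    proof (intro conjI ballI)
      show "integrable M (\<lambda>x. Y x * indicator (\<Union>(range a)) x)"
        by (intro integrable_mult_bounded i borel_measurable_indicator sets.countable_UN)
          (use aM in \<open>auto simp: indicator_def\<close>)
      have lim: "(\<lambda>n. expectation (\<lambda>x. (Y x * indicator (\<Union>i<n. a i) x) * f x)) \<longlonglongrightarrow> expectation (\<lambda>x. (Y x * indicator (\<Union>(range a)) x) * f x)"
        if [measurable]: "f \<in> borel_measurable M" and f: "\<And>x. \<bar>f x\<bar> \<le> 1" for f :: "'a \<Rightarrow> real"
      proof (rule integral_dominated_convergence[where w="\<lambda>x. \<bar>Y x\<bar>"])
        show "AE x in M. (\<lambda>n. (Y x * indicator (\<Union>i<n. a i) x) * f x) \<longlonglongrightarrow> (Y x * indicator (\<Union>(range a)) x) * f x"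
        proof (intro AE_I2 tendsto_intros)
          fix x
          show "(\<lambda>n. indicator (\<Union>i<n. a i) x :: real) \<longlonglongrightarrow> indicator (\<Union>(range a)) x"
            by (rule LIMSEQ_indicator_UN)
        qed
        show "AE x in M. norm ((Y x * indicator (\<Union>i<n. a i) x) * f x) \<le> \<bar>Y x\<bar>" for n
          using f by (intro AE_I2) (auto simp: indicator_def abs_mult intro!: mult_left_le)
      qed (use i in auto)
      fix Z assume Z: "Z \<in> V"
      have [measurable]: "Z \<in> borel_measurable M" by (rule V[OF Z])
      have "expectation (\<lambda>x. (Y x * indicator (\<Union>i<n. a i) x) * cos (Z x)) = 0"
        "expectation (\<lambda>x. (Y x * indicator (\<Union>i<n. a i) x) * sin (Z x)) = 0" for n
        using part[of n] Z by (auto simp: trig_orthogonal_def)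
      then show "expectation (\<lambda>x. (Y x * indicator (\<Union>(range a)) x) * cos (Z x)) = 0"
        "expectation (\<lambda>x. (Y x * indicator (\<Union>(range a)) x) * sin (Z x)) = 0"
        using lim[of "\<lambda>x. cos (Z x)"] lim[of "\<lambda>x. sin (Z x)"] by (auto dest: LIMSEQ_unique)
    qed
    then show ?case .
  qed
qed

section \<open>Paths of finite variation and joint measurability\<close>

text \<open>
  The representing sequence at time \<open>1\<close>; its limit relation is tested only against unit
  coefficients, that is, against single values of the process.
\<close>

lemma drift_coefficients:
  fixes K :: real
  assumes K: "1 < K" "K < 2"
  obtains x :: "nat \<Rightarrow> real \<Rightarrow> real" where "\<And>k. x k \<in> finsupp {0..1}"
    "\<And>k. lin (\<lambda>u. x (Suc k) u - x k u) (\<lambda>u. lin (\<lambda>u. x (Suc k) u - x k u) (bifbm_cov K u)) \<le> (1/4) ^ k"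
    "\<And>v. v \<in> {0..1} \<Longrightarrow> (\<lambda>k. lin (x k) (\<lambda>u. bifbm_cov K u v)) \<longlonglongrightarrow> drift_kernel K v"
proof -
  define q where "q c d = lin c (\<lambda>u. lin d (bifbm_cov K u))" for c d
  obtain C where C: "\<And>c. c \<in> finsupp {0..} \<Longrightarrow> 2 * lin c (drift_kernel K) \<le> q c c + C"
    using drift_functional_bounded[OF K] unfolding q_def by blast
  obtain x where x: "\<And>k. x k \<in> finsupp {0..1::real}"
    "\<And>k. q (\<lambda>u. x (Suc k) u - x k u) (\<lambda>u. x (Suc k) u - x k u) \<le> (1/4) ^ k"
    "\<And>d. d \<in> finsupp {0..1} \<Longrightarrow> (\<lambda>k. q (x k) d) \<longlonglongrightarrow> lin d (drift_kernel K)"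
  proof (rule riesz_minimizing_sequence[where S="finsupp {0..1::real}" and q=q and L="\<lambda>c. lin c (drift_kernel K)"])
    show "q c d = q d c" for c d
      unfolding q_def by (subst lin_swap) (simp add: bifbm_cov_sym)
    show "q (\<lambda>u. c u + r * d u) e = q c e + r * q d e" if "c \<in> finsupp {0..1}" "d \<in> finsupp {0..1}" for c d e r
      unfolding q_def by (rule lin_comb_left[OF that])
    show "2 * lin c (drift_kernel K) \<le> q c c + C" if "c \<in> finsupp {0..1}" for c
      using that by (intro C) (rule finsupp_mono[of "{0..1}"]; simp)
  qed (blast intro: zero_finsupp finsupp_comb lin_comb_left)+
  show ?thesis
  proof
    fix v :: real assume "v \<in> {0..1}"
    from x(3)[OF point_finsupp[OF this]]
    show "(\<lambda>k. lin (x k) (\<lambda>u. bifbm_cov K u v)) \<longlonglongrightarrow> drift_kernel K v" by (simp add: q_def)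
  qed (use x in \<open>auto simp: q_def\<close>)
qed

text \<open>
  Where the envelope is infinite the sequence may diverge and \<open>lim a\<close> is arbitrary, but then the
  bound on it is vacuous.
\<close>

lemma telescoping_envelope:
  fixes a :: "nat \<Rightarrow> real"
  defines "E \<equiv> ennreal \<bar>a 0\<bar> + (\<Sum>k. ennreal \<bar>a (Suc k) - a k\<bar>)"
  shows "ennreal \<bar>a n\<bar> \<le> E"
    and "E < \<infinity> \<Longrightarrow> a \<longlonglongrightarrow> lim a"
    and "ennreal \<bar>lim a\<bar> \<le> E"
proof -
  have bnd: "ennreal \<bar>a n\<bar> \<le> E" for n
  proof -
    have "ennreal \<bar>a n\<bar> \<le> ennreal \<bar>a 0\<bar> + (\<Sum>k<n. ennreal \<bar>a (Suc k) - a k\<bar>)"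
    proof (induction n)
      case (Suc n)
      have "ennreal \<bar>a (Suc n)\<bar> \<le> ennreal (\<bar>a n\<bar> + \<bar>a (Suc n) - a n\<bar>)" by (intro ennreal_leI) auto
      also have "\<dots> = ennreal \<bar>a n\<bar> + ennreal \<bar>a (Suc n) - a n\<bar>" by (simp add: ennreal_plus)
      also have "\<dots> \<le> (ennreal \<bar>a 0\<bar> + (\<Sum>k<n. ennreal \<bar>a (Suc k) - a k\<bar>)) + ennreal \<bar>a (Suc n) - a n\<bar>"
        by (rule add_right_mono[OF Suc])
      finally show ?case by (simp add: add.assoc)
    qed simp
    also have "\<dots> \<le> E" unfolding E_def by (intro add_left_mono sum_le_suminf) auto
    finally show ?thesis .
  qed
  then show "ennreal \<bar>a n\<bar> \<le> E" .
  show conv: "a \<longlonglongrightarrow> lim a" if "E < \<infinity>"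
  proof -
    have "(\<Sum>k. ennreal \<bar>a (Suc k) - a k\<bar>) \<noteq> top" using that unfolding E_def by (auto simp: ennreal_add_eq_top)
    then have "summable (\<lambda>k. \<bar>a (Suc k) - a k\<bar>)" by (intro summable_suminf_not_top) auto
    then have "summable (\<lambda>k. a (Suc k) - a k)" by (rule summable_rabs_cancel)
    then have "convergent (\<lambda>n. \<Sum>k<n. a (Suc k) - a k)" by (simp add: summable_iff_convergent)
    then have "convergent (\<lambda>n. a n - a 0)" by (simp add: sum_lessThan_telescope)
    then have "convergent a" using convergent_add_const_iff[of "- a 0" a] by simp
    then show ?thesis by (rule convergent_LIMSEQ_iff[THEN iffD1])
  qed
  show "ennreal \<bar>lim a\<bar> \<le> E"
  proof (cases "E < \<infinity>")
    case True
    have "(\<lambda>n. ennreal \<bar>a n\<bar>) \<longlonglongrightarrow> ennreal \<bar>lim a\<bar>" by (intro tendsto_intros conv True)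
    then show ?thesis by (rule LIMSEQ_le_const2) (use bnd in auto)
  next
    case False
    then have "E = top" by (simp add: less_top[symmetric])
    then show ?thesis by simp
  qed
qed

text \<open>
  Left endpoints of a fine grid turn the time into a countably valued variable.
\<close>

lemma continuous_paths_jointly_measurable:
  fixes f :: "real \<Rightarrow> 'a \<Rightarrow> real"
  assumes m[measurable]: "\<And>t. f t \<in> borel_measurable N" and c: "\<And>\<omega>. continuous_on UNIV (\<lambda>t. f t \<omega>)"
  shows "(\<lambda>z. f (fst z) (snd z)) \<in> borel_measurable (borel \<Otimes>\<^sub>M N)"
proof (rule borel_measurable_LIMSEQ_real)
  let ?g = "\<lambda>(n::nat) s. real_of_int \<lfloor>s * real (Suc n)\<rfloor> / real (Suc n)"
  show "(\<lambda>n. f (?g n (fst z)) (snd z)) \<longlonglongrightarrow> f (fst z) (snd z)" for z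
  proof -
    let ?s = "fst z"
    have lower: "(\<lambda>n. ?s - 1 / real (Suc n)) \<longlonglongrightarrow> ?s"
      using tendsto_diff[OF tendsto_const lim_inverse_n'[THEN LIMSEQ_Suc], of ?s] by simp
    have "(\<lambda>n. ?g n ?s) \<longlonglongrightarrow> ?s"
    proof (rule tendsto_sandwich[OF _ _ lower tendsto_const])
      show "\<forall>\<^sub>F n in sequentially. ?s - 1 / real (Suc n) \<le> ?g n ?s"
      proof (intro always_eventually allI)
        fix n
        have "?s * real (Suc n) - 1 \<le> real_of_int \<lfloor>?s * real (Suc n)\<rfloor>" by (rule real_of_int_floor_ge_diff_one)
        then have "(?s * real (Suc n) - 1) / real (Suc n) \<le> ?g n ?s" by (intro divide_right_mono) auto
        then show "?s - 1 / real (Suc n) \<le> ?g n ?s" by (simp add: diff_divide_distrib del: of_nat_Suc)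
      qed
      show "\<forall>\<^sub>F n in sequentially. ?g n ?s \<le> ?s"
      proof (intro always_eventually allI)
        fix n
        have "real_of_int \<lfloor>?s * real (Suc n)\<rfloor> / real (Suc n) \<le> (?s * real (Suc n)) / real (Suc n)"
          by (intro divide_right_mono) auto
        then show "?g n ?s \<le> ?s" by simp
      qed
    qed
    moreover have "isCont (\<lambda>t. f t (snd z)) ?s" using c[of "snd z"] by (simp add: continuous_on_eq_continuous_at)
    ultimately show ?thesis by (rule isCont_tendsto_compose[rotated])
  qed
  show "(\<lambda>z. f (?g n (fst z)) (snd z)) \<in> borel_measurable (borel \<Otimes>\<^sub>M N)" for n
    by (rule measurable_compose_countable[where f="\<lambda>i z. f (real_of_int i / real (Suc n)) (snd z)" and g="\<lambda>z. \<lfloor>fst z * real (Suc n)\<rfloor>"]) measurable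
qed

context
  fixes f :: "real \<Rightarrow> real"
  assumes f: "\<And>T. 0 \<le> T \<Longrightarrow> set_integrable lborel {0..T} f"
begin

lemma set_integrable_Icc: "0 \<le> a \<Longrightarrow> 0 \<le> b \<Longrightarrow> set_integrable lborel {a..b} f"
  by (rule set_integrable_subset[OF f[of b]]) auto

lemma indefinite_integral_diff:
  assumes "0 \<le> a" "a \<le> b"
  shows "(LINT s:{0..b}|lborel. f s) - (LINT s:{0..a}|lborel. f s) = (LINT s:{a..b}|lborel. f s)"
  using set_borel_integral_eq_integral[OF f[of b]] set_borel_integral_eq_integral[OF f[of a]]
    set_borel_integral_eq_integral[OF set_integrable_Icc[of a b]] assms
    Henstock_Kurzweil_Integration.integral_combine[of 0 a b f] by simp

lemma indefinite_integral_continuous_on: "continuous_on {0..} (\<lambda>t. LINT s:{0..t}|lborel. f s)"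
proof -
  have "continuous_on {0..T} (\<lambda>t. LINT s:{0..t}|lborel. f s)" if "0 \<le> T" for T
  proof -
    have "continuous_on {0..T} (\<lambda>t. integral {0..t} f)"
      using set_borel_integral_eq_integral(1)[OF f[OF that]] by (rule indefinite_integral_continuous_1)
    then show ?thesis
      by (rule continuous_on_eq) (use set_borel_integral_eq_integral(2)[OF f] in auto)
  qed
  then have *: "continuous_on {0..<T} (\<lambda>t. LINT s:{0..t}|lborel. f s)" for T
    by (cases "0 \<le> T") (auto intro: continuous_on_subset[of "{0..T}"])
  show ?thesis
    unfolding continuous_on_eq_continuous_within
  proof
    fix t :: real assume t: "t \<in> {0..}"
    have "continuous (at t within {0..<t + 1}) (\<lambda>t. LINT s:{0..t}|lborel. f s)"
      using *[of "t + 1"] t by (auto simp: continuous_on_eq_continuous_within)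
    moreover have "at t within {0..<t + 1} = at t within {0..}"
      by (rule at_within_nhd[of t "{..<t + 1}"]) auto
    ultimately show "continuous (at t within {0..}) (\<lambda>t. LINT s:{0..t}|lborel. f s)" by simp
  qed
qed

lemma indefinite_integral_finite_variation: "locally_finite_variation (\<lambda>t. LINT s:{0..t}|lborel. f s)"
  unfolding locally_finite_variation_def
proof (intro allI impI)
  fix b :: real assume b: "0 \<le> b"
  let ?H = "\<lambda>t. LINT s:{0..t}|lborel. \<bar>f s\<bar>"
  have fa: "set_integrable lborel {0..T} (\<lambda>s. \<bar>f s\<bar>)" if "0 \<le> T" for T
    using set_integrable_abs[OF f[OF that]] .
  show "\<exists>C. \<forall>n p. mono_on {..n} p \<and> p ` {..n} \<subseteq> {0..b} \<longrightarrow>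
      (\<Sum>i<n. \<bar>(LINT s:{0..p (Suc i)}|lborel. f s) - (LINT s:{0..p i}|lborel. f s)\<bar>) \<le> C"
  proof (intro exI[of _ "?H b"] allI impI)
    fix n :: nat and p :: "nat \<Rightarrow> real" assume p: "mono_on {..n} p \<and> p ` {..n} \<subseteq> {0..b}"
    have Hd: "?H d - ?H c = (LINT s:{c..d}|lborel. \<bar>f s\<bar>)" if "0 \<le> c" "c \<le> d" for c d
      using that set_borel_integral_eq_integral[OF fa[of d]] set_borel_integral_eq_integral[OF fa[of c]]
        set_borel_integral_eq_integral[OF set_integrable_abs[OF set_integrable_Icc[of c d]]]
        Henstock_Kurzweil_Integration.integral_combine[of 0 c d "\<lambda>s. \<bar>f s\<bar>"] by simp
    have Hn: "0 \<le> (LINT s:{c..d}|lborel. \<bar>f s\<bar>)" for c d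
      unfolding set_lebesgue_integral_def by (intro Bochner_Integration.integral_nonneg) auto
    have "(\<Sum>i<n. \<bar>(LINT s:{0..p (Suc i)}|lborel. f s) - (LINT s:{0..p i}|lborel. f s)\<bar>) \<le> (\<Sum>i<n. ?H (p (Suc i)) - ?H (p i))"
    proof (rule sum_mono)
      fix i assume "i \<in> {..<n}"
      then have i: "i \<in> {..n}" "Suc i \<in> {..n}" by auto
      then have "p i \<in> {0..b}" using p by blast
      moreover have "p i \<le> p (Suc i)" using p i by (intro mono_onD[of "{..n}" p]) auto
      ultimately have pi: "0 \<le> p i" "p i \<le> p (Suc i)" by auto
      have "\<bar>LINT s:{p i..p (Suc i)}|lborel. f s\<bar> \<le> (LINT s:{p i..p (Suc i)}|lborel. \<bar>f s\<bar>)"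
        using set_integral_norm_bound[OF set_integrable_Icc[of "p i" "p (Suc i)"]] pi by simp
      then show "\<bar>(LINT s:{0..p (Suc i)}|lborel. f s) - (LINT s:{0..p i}|lborel. f s)\<bar> \<le> ?H (p (Suc i)) - ?H (p i)"
        using pi by (simp add: indefinite_integral_diff Hd)
    qed
    also have "\<dots> = ?H (p n) - ?H (p 0)" by (rule sum_lessThan_telescope)
    also have "\<dots> \<le> ?H b"
    proof -
      have "0 \<le> p n" "p n \<le> b" using p by auto
      then have "?H (p n) \<le> ?H b" using Hd[of "p n" b] Hn[of "p n" b] by linarith
      then show ?thesis using Hn[of 0 "p 0"] by linarith
    qed
    finally show "(\<Sum>i<n. \<bar>(LINT s:{0..p (Suc i)}|lborel. f s) - (LINT s:{0..p i}|lborel. f s)\<bar>) \<le> ?H b" .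
  qed
qed

end

lemma continuous_imp_cadlag:
  assumes "continuous_on {0..} f"
  shows "cadlag f"
  unfolding cadlag_def
proof (intro conjI allI impI)
  fix t :: real assume "0 \<le> t"
  then have "(f \<longlongrightarrow> f t) (at t within {0..})" using assms by (auto simp: continuous_on_def)
  then show "(f \<longlongrightarrow> f t) (at_right t)" by (rule tendsto_within_subset) (use \<open>0 \<le> t\<close> in auto)
next
  fix t :: real assume t: "0 < t"
  then have "(f \<longlongrightarrow> f t) (at t within {0..})" using assms by (auto simp: continuous_on_def)
  then have "(f \<longlongrightarrow> f t) (at t within {0..<t})" by (rule tendsto_within_subset) auto
  moreover have "at t within {0..<t} = at_left t" by (rule at_within_nhd[of t "{0<..}"]) (use t in auto)
  ultimately show "\<exists>l. (f \<longlongrightarrow> l) (at_left t)" by auto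
qed

lemma nn_integral_inverse_sqrt:
  assumes "0 \<le> a" "a \<le> b" "0 \<le> C"
  shows "(\<integral>\<^sup>+s. ennreal (C / sqrt s) * indicator {a..b} s \<partial>lborel) = ennreal (2 * C * (sqrt b - sqrt a))"
proof -
  have "((\<lambda>s. C / sqrt s) has_integral (2 * C * sqrt b - 2 * C * sqrt a)) {a..b}"
  \<comment> \<open>Differentiability is used in the interior only, so \<open>a = 0\<close> is covered.\<close>
  proof (rule fundamental_theorem_of_calculus_interior)
    fix x assume "x \<in> {a<..<b}"
    then have "0 < x" using assms by auto
    then show "((\<lambda>s. 2 * C * sqrt s) has_vector_derivative C / sqrt x) (at x)"
      by (auto intro!: derivative_eq_intros simp: has_real_derivative_iff_has_vector_derivative[symmetric] field_simps)
  qed (use assms in \<open>auto intro!: continuous_intros\<close>)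
  then show ?thesis
    using assms by (subst nn_integral_has_integral_lebesgue') (auto simp: algebra_simps)
qed

section \<open>The drift density and its integral\<close>

text \<open>
  The drift density as a functional of a single path. At time \<open>s\<close> it reads the path at the times
  \<open>s * u\<close> only, which gives joint measurability and adaptedness by the same argument.
\<close>

definition path_drift :: "(nat \<Rightarrow> real \<Rightarrow> real) \<Rightarrow> (real \<Rightarrow> real) \<Rightarrow> real \<Rightarrow> real" where
  "path_drift x f s = lim (\<lambda>k. lin (x k) (\<lambda>u. f (s * u)) / s)"

lemma path_average_measurable:
  fixes f :: "real \<Rightarrow> 'a \<Rightarrow> real"
  assumes "\<And>t. f t \<in> borel_measurable N" "\<And>\<omega>. continuous_on UNIV (\<lambda>t. f t \<omega>)" "c \<in> finsupp I"
  shows "(\<lambda>z. lin c (\<lambda>u. f (fst z * u) (snd z)) / fst z) \<in> borel_measurable (lborel \<Otimes>\<^sub>M N)"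
proof -
  have "(\<lambda>z. f (fst z * u) (snd z)) \<in> borel_measurable (lborel \<Otimes>\<^sub>M N)" for u
    using measurable_compose[OF _ continuous_paths_jointly_measurable[OF assms(1,2)], of "\<lambda>z. (fst z * u, snd z)" "lborel \<Otimes>\<^sub>M N"]
    by simp
  then have [measurable]: "(\<lambda>z. lin c (\<lambda>u. f (fst z * u) (snd z))) \<in> borel_measurable (lborel \<Otimes>\<^sub>M N)"
    by (intro lin_measurable[OF assms(3)])
  show ?thesis by measurable
qed

lemma path_drift_measurable:
  fixes f :: "real \<Rightarrow> 'a \<Rightarrow> real"
  assumes "\<And>t. f t \<in> borel_measurable N" "\<And>\<omega>. continuous_on UNIV (\<lambda>t. f t \<omega>)" "\<And>k. x k \<in> finsupp I"
  shows "(\<lambda>z. path_drift x (\<lambda>t. f t (snd z)) (fst z)) \<in> borel_measurable (lborel \<Otimes>\<^sub>M N)"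
  unfolding path_drift_def
  by (rule borel_measurable_lim_metric, rule path_average_measurable[OF assms(1,2)], rule assms(3))

lemma path_drift_cong:
  assumes "\<And>k. x k \<in> finsupp {0..1}" "0 \<le> s" "\<And>r. 0 \<le> r \<Longrightarrow> r \<le> s \<Longrightarrow> f r = g r"
  shows "path_drift x f s = path_drift x g s"
proof -
  have "lin (x k) (\<lambda>u. f (s * u)) = lin (x k) (\<lambda>u. g (s * u))" for k
    by (rule lin_cong[OF assms(1)]) (use assms(2,3) in \<open>auto simp: mult_left_le\<close>)
  then show ?thesis by (simp add: path_drift_def)
qed

text \<open>
  The Gaussian hypotheses enter only through moments and through the two identities of Gaussian
  integration by parts; the coefficients \<open>x\<close> are those of \<open>drift_coefficients\<close>. Continuity is
  required of every path, on the whole line, so that no null set interferes with measurability.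
\<close>

locale regular_bifbm = prob_space M for M :: "'a measure" +
  fixes X :: "real \<Rightarrow> 'a \<Rightarrow> real" and K :: real and x :: "nat \<Rightarrow> real \<Rightarrow> real"
  assumes K: "1 < K" "K < 2"
    and X_meas[measurable]: "\<And>t. X t \<in> borel_measurable M"
    and X_cont: "\<And>\<omega>. continuous_on UNIV (\<lambda>t. X t \<omega>)"
    and X_sq: "\<And>t. 0 \<le> t \<Longrightarrow> integrable M (\<lambda>\<omega>. (X t \<omega>)\<^sup>2)"
    and X_cov: "\<And>t s. 0 \<le> t \<Longrightarrow> 0 \<le> s \<Longrightarrow> expectation (\<lambda>\<omega>. X t \<omega> * X s \<omega>) = bifbm_cov K t s"
    and X_cos: "\<And>t c. 0 \<le> t \<Longrightarrow> c \<in> finsupp {0..} \<Longrightarrow>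
      expectation (\<lambda>\<omega>. X t \<omega> * cos (lin c (\<lambda>r. X r \<omega>))) = 0"
    and X_sin: "\<And>t c. 0 \<le> t \<Longrightarrow> c \<in> finsupp {0..} \<Longrightarrow>
      expectation (\<lambda>\<omega>. X t \<omega> * sin (lin c (\<lambda>r. X r \<omega>))) =
        exp (- expectation (\<lambda>\<omega>. (lin c (\<lambda>r. X r \<omega>))\<^sup>2) / 2) * expectation (\<lambda>\<omega>. X t \<omega> * lin c (\<lambda>r. X r \<omega>))"
    and x_supp: "\<And>k. x k \<in> finsupp {0..1}"
    and x_fast: "\<And>k. lin (\<lambda>u. x (Suc k) u - x k u) (\<lambda>u. lin (\<lambda>u. x (Suc k) u - x k u) (bifbm_cov K u)) \<le> (1/4) ^ k"
    and x_lim: "\<And>v. v \<in> {0..1} \<Longrightarrow> (\<lambda>k. lin (x k) (\<lambda>u. bifbm_cov K u v)) \<longlonglongrightarrow> drift_kernel K v"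
begin

sublocale P: pair_sigma_finite lborel M by standard

lemma X_mult: "0 \<le> t \<Longrightarrow> 0 \<le> s \<Longrightarrow> integrable M (\<lambda>\<omega>. X t \<omega> * X s \<omega>)"
  by (rule integrable_mult_of_squares[OF X_meas X_meas X_sq X_sq])

lemma X_int: "0 \<le> t \<Longrightarrow> integrable M (X t)"
  by (rule integrable_of_square[OF X_meas X_sq])

lemma lin_X_meas [measurable]: "c \<in> finsupp I \<Longrightarrow> (\<lambda>\<omega>. lin c (\<lambda>r. X r \<omega>)) \<in> borel_measurable M"
  by (erule lin_measurable) simp

text \<open>
  The factor \<open>1 / s\<close> is the one of self-similarity: the covariance of \<open>avg k s\<close> with \<open>X v\<close> is that
  of \<open>avg k 1\<close> with \<open>X (v / s)\<close>.
\<close>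

definition avg :: "nat \<Rightarrow> real \<Rightarrow> 'a \<Rightarrow> real" where
  "avg k s \<omega> = lin (x k) (\<lambda>u. X (s * u) \<omega>) / s"

definition drift :: "real \<Rightarrow> 'a \<Rightarrow> real" where
  "drift s \<omega> = path_drift x (\<lambda>r. X r \<omega>) s"

definition envelope :: "real \<Rightarrow> 'a \<Rightarrow> ennreal" where
  "envelope s \<omega> = ennreal \<bar>avg 0 s \<omega>\<bar> + (\<Sum>k. ennreal \<bar>avg (Suc k) s \<omega> - avg k s \<omega>\<bar>)"

definition compensator :: "real \<Rightarrow> real \<Rightarrow> 'a \<Rightarrow> real" where
  "compensator a b \<omega> = (LINT s:{a..b}|lborel. drift s \<omega>)"

lemma drift_eq_lim: "drift s \<omega> = lim (\<lambda>k. avg k s \<omega>)"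
  by (simp add: drift_def path_drift_def avg_def)

lemma drift_bound: "ennreal \<bar>drift s \<omega>\<bar> \<le> envelope s \<omega>"
  unfolding drift_eq_lim envelope_def by (rule telescoping_envelope(3))

lemma avg_measurable_pair [measurable]: "(\<lambda>z. avg k (fst z) (snd z)) \<in> borel_measurable (lborel \<Otimes>\<^sub>M M)"
  unfolding avg_def by (rule path_average_measurable[OF X_meas X_cont x_supp])

lemma drift_measurable_pair [measurable]: "(\<lambda>z. drift (fst z) (snd z)) \<in> borel_measurable (lborel \<Otimes>\<^sub>M M)"
  unfolding drift_def by (rule path_drift_measurable[OF X_meas X_cont x_supp])

lemma envelope_measurable_pair [measurable]: "(\<lambda>z. envelope (fst z) (snd z)) \<in> borel_measurable (lborel \<Otimes>\<^sub>M M)"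
  unfolding envelope_def by measurable

lemma avg_measurable [measurable]: "avg k s \<in> borel_measurable M"
  using measurable_compose[OF _ avg_measurable_pair, of "\<lambda>\<omega>. (s, \<omega>)" M k] by simp

lemma drift_measurable [measurable]: "drift s \<in> borel_measurable M"
  using measurable_compose[OF _ drift_measurable_pair, of "\<lambda>\<omega>. (s, \<omega>)" M] by simp

lemma envelope_measurable [measurable]: "envelope s \<in> borel_measurable M"
  using measurable_compose[OF _ envelope_measurable_pair, of "\<lambda>\<omega>. (s, \<omega>)" M] by simp

lemma drift_measurable_time: "\<omega> \<in> space M \<Longrightarrow> (\<lambda>s. drift s \<omega>) \<in> borel_measurable borel"
  using measurable_compose[OF _ drift_measurable_pair, of "\<lambda>s. (s, \<omega>)" lborel] by simp

lemma mean_abs_le: 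
  fixes W :: "'a \<Rightarrow> real"
  assumes [measurable]: "W \<in> borel_measurable M" and sq: "integrable M (\<lambda>\<omega>. (W \<omega>)\<^sup>2)"
  shows "integrable M W" "expectation (\<lambda>\<omega>. \<bar>W \<omega>\<bar>) \<le> sqrt (expectation (\<lambda>\<omega>. (W \<omega>)\<^sup>2))"
proof -
  show i: "integrable M W" by (rule integrable_of_square[OF assms])
  let ?m = "expectation (\<lambda>\<omega>. \<bar>W \<omega>\<bar>)"
  have "0 \<le> variance (\<lambda>\<omega>. \<bar>W \<omega>\<bar>)" by (rule variance_positive)
  also have "\<dots> = expectation (\<lambda>\<omega>. (W \<omega>)\<^sup>2) - ?m\<^sup>2"
    using variance_eq[of "\<lambda>\<omega>. \<bar>W \<omega>\<bar>"] i sq by simp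
  finally show "?m \<le> sqrt (expectation (\<lambda>\<omega>. (W \<omega>)\<^sup>2))" by (intro real_le_rsqrt) simp
qed

lemma scaled_second_moment:
  assumes c: "c \<in> finsupp {0..1}" and s: "0 < s"
  shows "integrable M (\<lambda>\<omega>. (lin c (\<lambda>u. X (s * u) \<omega>) / s)\<^sup>2)"
    and "expectation (\<lambda>\<omega>. (lin c (\<lambda>u. X (s * u) \<omega>) / s)\<^sup>2) = lin c (\<lambda>u. lin c (bifbm_cov K u)) / s"
proof -
  have e: "(lin c (\<lambda>u. X (s * u) \<omega>) / s)\<^sup>2 = lin c (\<lambda>u. lin c (\<lambda>v. X (s * u) \<omega> * X (s * v) \<omega>)) / s\<^sup>2" for \<omega>
    by (simp add: power_divide power2_eq_square[of "lin c _"] lin_mult)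
  have m: "integrable M (\<lambda>\<omega>. X (s * u) \<omega> * X (s * v) \<omega>)" if "u \<in> {0..1}" "v \<in> {0..1}" for u v
    using that s by (intro X_mult) auto
  have i: "integrable M (\<lambda>\<omega>. lin c (\<lambda>u. lin c (\<lambda>v. X (s * u) \<omega> * X (s * v) \<omega>)))"
    by (intro lin_integral(1)[OF c] m)
  then show "integrable M (\<lambda>\<omega>. (lin c (\<lambda>u. X (s * u) \<omega>) / s)\<^sup>2)" unfolding e by simp
  have "expectation (\<lambda>\<omega>. lin c (\<lambda>u. lin c (\<lambda>v. X (s * u) \<omega> * X (s * v) \<omega>)))
      = lin c (\<lambda>u. expectation (\<lambda>\<omega>. lin c (\<lambda>v. X (s * u) \<omega> * X (s * v) \<omega>)))"
    by (intro lin_integral(2)[OF c] lin_integral(1)[OF c] m)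
  also have "\<dots> = lin c (\<lambda>u. lin c (\<lambda>v. expectation (\<lambda>\<omega>. X (s * u) \<omega> * X (s * v) \<omega>)))"
    by (intro lin_cong[OF c] lin_integral(2)[OF c] m)
  also have "\<dots> = lin c (\<lambda>u. lin c (\<lambda>v. s * bifbm_cov K u v))"
    using K s by (intro lin_cong[OF c]) (simp add: X_cov bifbm_cov_scale)
  finally show "expectation (\<lambda>\<omega>. (lin c (\<lambda>u. X (s * u) \<omega>) / s)\<^sup>2) = lin c (\<lambda>u. lin c (bifbm_cov K u)) / s"
    unfolding e using s by (simp add: lin_scale_right power2_eq_square)
qed

lemma nn_mean_avg:
  assumes c: "c \<in> finsupp {0..1}" and s: "0 < s" and q: "lin c (\<lambda>u. lin c (bifbm_cov K u)) \<le> r\<^sup>2" and r: "0 \<le> r"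
  shows "(\<integral>\<^sup>+\<omega>. ennreal \<bar>lin c (\<lambda>u. X (s * u) \<omega>) / s\<bar> \<partial>M) \<le> ennreal (r / sqrt s)"
proof -
  have [measurable]: "(\<lambda>\<omega>. lin c (\<lambda>u. X (s * u) \<omega>)) \<in> borel_measurable M"
    by (rule lin_measurable[OF c]) simp
  let ?W = "\<lambda>\<omega>. lin c (\<lambda>u. X (s * u) \<omega>) / s"
  have W: "integrable M ?W" "expectation (\<lambda>\<omega>. \<bar>?W \<omega>\<bar>) \<le> sqrt (expectation (\<lambda>\<omega>. (?W \<omega>)\<^sup>2))"
    by (rule mean_abs_le; use scaled_second_moment(1)[OF c s] in simp)+
  have "(\<integral>\<^sup>+\<omega>. ennreal \<bar>?W \<omega>\<bar> \<partial>M) = ennreal (expectation (\<lambda>\<omega>. \<bar>?W \<omega>\<bar>))"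
    using integrable_abs[OF W(1)] by (rule nn_integral_eq_integral) auto
  also have "\<dots> \<le> ennreal (sqrt (r\<^sup>2 / s))"
    using W(2) unfolding scaled_second_moment(2)[OF c s]
    by (intro ennreal_leI, elim order_trans) (use q s in \<open>auto intro!: divide_right_mono\<close>)
  finally show ?thesis using r by (simp add: real_sqrt_divide)
qed

text \<open>
  Norm of the first coefficient vector plus \<open>\<Sum>k. (1/2) ^ k = 2\<close>, the sum of the norms of the
  later increments.
\<close>

definition env_const :: real where
  "env_const = sqrt (lin (x 0) (\<lambda>u. lin (x 0) (bifbm_cov K u))) + 2"

lemma nonneg_cov:
  assumes "c \<in> finsupp {0..1}"
  shows "0 \<le> lin c (\<lambda>u. lin c (bifbm_cov K u))"
proof -
  have "0 \<le> expectation (\<lambda>\<omega>. (lin c (\<lambda>u. X (1 * u) \<omega>) / 1)\<^sup>2)"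
    by (intro Bochner_Integration.integral_nonneg zero_le_power2)
  then show ?thesis unfolding scaled_second_moment(2)[OF assms zero_less_one] by simp
qed

lemma env_const_nonneg: "0 \<le> env_const"
  unfolding env_const_def using nonneg_cov[OF x_supp[of 0]] by simp

text \<open>
  By homogeneity of the covariance each increment of \<open>avg\<close> at time \<open>s\<close> has the \<open>L\<^sup>2\<close> norm that it
  has at time \<open>1\<close>, divided by \<open>sqrt s\<close>. At \<open>s = 0\<close> both sides vanish, as division by zero
  yields zero.
\<close>

lemma nn_mean_envelope:
  assumes s: "0 \<le> s"
  shows "(\<integral>\<^sup>+\<omega>. envelope s \<omega> \<partial>M) \<le> ennreal (env_const / sqrt s)"
proof (cases "s = 0")
  case True then show ?thesis by (simp add: envelope_def avg_def)
next
  case False with s have s: "0 < s" by simp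
  have 0: "(\<integral>\<^sup>+\<omega>. ennreal \<bar>avg 0 s \<omega>\<bar> \<partial>M) \<le> ennreal (sqrt (lin (x 0) (\<lambda>u. lin (x 0) (bifbm_cov K u))) / sqrt s)"
    unfolding avg_def using nonneg_cov[OF x_supp[of 0]] by (intro nn_mean_avg x_supp s) auto
  have k: "(\<integral>\<^sup>+\<omega>. ennreal \<bar>avg (Suc k) s \<omega> - avg k s \<omega>\<bar> \<partial>M) \<le> ennreal ((1/2) ^ k / sqrt s)" for k
  proof -
    let ?d = "\<lambda>u. x (Suc k) u - x k u"
    have d: "?d \<in> finsupp {0..1}" using finsupp_comb[OF x_supp x_supp, of "Suc k" "-1" k] by simp
    have "avg (Suc k) s \<omega> - avg k s \<omega> = lin ?d (\<lambda>u. X (s * u) \<omega>) / s" for \<omega>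
      unfolding avg_def using lin_comb_left[OF x_supp x_supp, of "Suc k" "-1" k "\<lambda>u. X (s * u) \<omega>"] by (simp add: diff_divide_distrib)
    moreover have "((1/2::real) ^ k)\<^sup>2 = (1/4) ^ k" by (simp add: power2_eq_square flip: power_mult_distrib)
    ultimately show ?thesis using nn_mean_avg[OF d s, of "(1/2) ^ k"] x_fast[of k] by simp
  qed
  have sm: "(\<lambda>k. (1/2) ^ k / sqrt s) sums (2 / sqrt s)"
    using geometric_sums[of "1/2::real"] by (intro sums_divide) simp
  have "(\<integral>\<^sup>+\<omega>. envelope s \<omega> \<partial>M) = (\<integral>\<^sup>+\<omega>. ennreal \<bar>avg 0 s \<omega>\<bar> \<partial>M) + (\<Sum>k. \<integral>\<^sup>+\<omega>. ennreal \<bar>avg (Suc k) s \<omega> - avg k s \<omega>\<bar> \<partial>M)"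
    unfolding envelope_def by (subst nn_integral_add) (auto simp: nn_integral_suminf)
  also have "\<dots> \<le> ennreal (sqrt (lin (x 0) (\<lambda>u. lin (x 0) (bifbm_cov K u))) / sqrt s) + (\<Sum>k. ennreal ((1/2) ^ k / sqrt s))"
    by (intro add_mono 0 suminf_le k) auto
  also have "(\<Sum>k. ennreal ((1/2) ^ k / sqrt s)) = ennreal (2 / sqrt s)"
    using s sm by (intro suminf_ennreal_eq) auto
  finally show ?thesis
    using s nonneg_cov[OF x_supp[of 0]] by (simp add: env_const_def add_divide_distrib)
qed

lemma nn_envelope_window:
  assumes "0 \<le> a" "a \<le> b"
  shows "(\<integral>\<^sup>+\<omega>. (\<integral>\<^sup>+s. envelope s \<omega> * indicator {a..b} s \<partial>lborel) \<partial>M) \<le> ennreal (2 * env_const * (sqrt b - sqrt a))"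
proof -
  have m: "case_prod (\<lambda>s \<omega>. envelope s \<omega> * indicator {a..b} s) \<in> borel_measurable (lborel \<Otimes>\<^sub>M M)"
    unfolding split_beta' by measurable
  have "(\<integral>\<^sup>+\<omega>. (\<integral>\<^sup>+s. envelope s \<omega> * indicator {a..b} s \<partial>lborel) \<partial>M) = (\<integral>\<^sup>+s. (\<integral>\<^sup>+\<omega>. envelope s \<omega> * indicator {a..b} s \<partial>M) \<partial>lborel)"
    by (rule P.Fubini'[OF m])
  also have "\<dots> \<le> (\<integral>\<^sup>+s. ennreal (env_const / sqrt s) * indicator {a..b} s \<partial>lborel)"
  proof (rule nn_integral_mono)
    fix s
    show "(\<integral>\<^sup>+\<omega>. envelope s \<omega> * indicator {a..b} s \<partial>M) \<le> ennreal (env_const / sqrt s) * indicator {a..b} s"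
      using nn_mean_envelope[of s] assms by (cases "s \<in> {a..b}") auto
  qed
  also have "\<dots> = ennreal (2 * env_const * (sqrt b - sqrt a))"
    using assms env_const_nonneg by (intro nn_integral_inverse_sqrt)
  finally show ?thesis .
qed

lemma nn_window_measurable [measurable]:
  "(\<lambda>\<omega>. \<integral>\<^sup>+s. envelope s \<omega> * indicator {a..b} s \<partial>lborel) \<in> borel_measurable M"
proof (rule lborel.borel_measurable_nn_integral)
  have "(\<lambda>z. envelope (snd z) (fst z)) \<in> borel_measurable (M \<Otimes>\<^sub>M lborel)"
    using measurable_compose[OF _ envelope_measurable_pair, of "\<lambda>z. (snd z, fst z)" "M \<Otimes>\<^sub>M lborel"] by simp
  then show "(\<lambda>(\<omega>, s). envelope s \<omega> * indicator {a..b} s) \<in> borel_measurable (M \<Otimes>\<^sub>M lborel)"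
    unfolding split_beta' by measurable
qed

lemma AE_drift_integrable: "AE \<omega> in M. \<forall>T\<ge>0. set_integrable lborel {0..T} (\<lambda>s. drift s \<omega>)"
proof -
  have "AE \<omega> in M. (\<integral>\<^sup>+s. envelope s \<omega> * indicator {0..real n} s \<partial>lborel) \<noteq> \<infinity>" for n :: nat
  proof (rule nn_integral_PInf_AE)
    have "(\<integral>\<^sup>+\<omega>. (\<integral>\<^sup>+s. envelope s \<omega> * indicator {0..real n} s \<partial>lborel) \<partial>M) < \<infinity>"
      by (rule le_less_trans[OF nn_envelope_window]) auto
    then show "(\<integral>\<^sup>+\<omega>. (\<integral>\<^sup>+s. envelope s \<omega> * indicator {0..real n} s \<partial>lborel) \<partial>M) \<noteq> \<infinity>" by simp
  qed measurable
  then have "AE \<omega> in M. \<forall>n::nat. (\<integral>\<^sup>+s. envelope s \<omega> * indicator {0..real n} s \<partial>lborel) \<noteq> \<infinity>"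
    by (simp add: AE_all_countable)
  then show ?thesis using AE_space
  proof eventually_elim
    case (elim \<omega>)
    show ?case
    proof (intro allI impI)
      fix T :: real assume "0 \<le> T"
      obtain n :: nat where n: "T \<le> real n" using real_arch_simple by blast
      have [measurable]: "(\<lambda>s. drift s \<omega>) \<in> borel_measurable borel" using elim by (intro drift_measurable_time)
      have "(\<integral>\<^sup>+s. ennreal (norm (indicator {0..T} s *\<^sub>R drift s \<omega>)) \<partial>lborel) \<le> (\<integral>\<^sup>+s. envelope s \<omega> * indicator {0..real n} s \<partial>lborel)"
        using n drift_bound[of _ \<omega>] by (intro nn_integral_mono) (auto simp: indicator_def)
      also have "\<dots> < \<infinity>" using elim by (simp add: less_top)
      finally show "set_integrable lborel {0..T} (\<lambda>s. drift s \<omega>)"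
        unfolding set_integrable_def by (intro integrableI_bounded) measurable
    qed
  qed
qed

lemma window_integrable:
  fixes W :: "'a \<Rightarrow> real"
  assumes ab: "0 \<le> a" "a \<le> b" and [measurable]: "W \<in> borel_measurable M" and W: "\<And>\<omega>. \<bar>W \<omega>\<bar> \<le> 1"
  shows "integrable (lborel \<Otimes>\<^sub>M M) (\<lambda>(s, \<omega>). indicator {a..b} s *\<^sub>R (drift s \<omega> * W \<omega>))"
proof (rule integrableI_bounded)
  show m: "(\<lambda>(s, \<omega>). indicator {a..b} s *\<^sub>R (drift s \<omega> * W \<omega>)) \<in> borel_measurable (lborel \<Otimes>\<^sub>M M)"
    unfolding split_beta' by measurable
  have "(\<integral>\<^sup>+z. ennreal (norm (case z of (s, \<omega>) \<Rightarrow> indicator {a..b} s *\<^sub>R (drift s \<omega> * W \<omega>))) \<partial>(lborel \<Otimes>\<^sub>M M))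
    \<le> (\<integral>\<^sup>+z. (case z of (s, \<omega>) \<Rightarrow> envelope s \<omega> * indicator {a..b} s) \<partial>(lborel \<Otimes>\<^sub>M M))"
  proof (rule nn_integral_mono, clarify)
    fix s \<omega>
    have "ennreal \<bar>drift s \<omega> * W \<omega>\<bar> \<le> ennreal \<bar>drift s \<omega>\<bar>"
      using W[of \<omega>] by (intro ennreal_leI) (simp add: abs_mult mult_left_le)
    also have "\<dots> \<le> envelope s \<omega>" by (rule drift_bound)
    finally show "ennreal (norm (indicator {a..b} s *\<^sub>R (drift s \<omega> * W \<omega>))) \<le> envelope s \<omega> * indicator {a..b} s"
      by (auto simp: indicator_def)
  qed
  also have "\<dots> = (\<integral>\<^sup>+\<omega>. (\<integral>\<^sup>+s. envelope s \<omega> * indicator {a..b} s \<partial>lborel) \<partial>M)"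
    by (subst P.nn_integral_snd[symmetric]) (auto simp: split_beta')
  also have "\<dots> < \<infinity>" by (rule le_less_trans[OF nn_envelope_window[OF ab]]) simp
  finally show "(\<integral>\<^sup>+z. ennreal (norm (case z of (s, \<omega>) \<Rightarrow> indicator {a..b} s *\<^sub>R (drift s \<omega> * W \<omega>))) \<partial>(lborel \<Otimes>\<^sub>M M)) < \<infinity>" .
qed

lemma compensator_integrable:
  assumes "0 \<le> a" "a \<le> b" shows "integrable M (compensator a b)"
  using P.integrable_snd[OF window_integrable[OF assms, of "\<lambda>_. 1"]]
  by (simp add: compensator_def[abs_def] set_lebesgue_integral_def)

lemma compensator_expectation:
  assumes ab: "0 \<le> a" "a \<le> b" and W[measurable]: "W \<in> borel_measurable M" "\<And>\<omega>. \<bar>W \<omega>\<bar> \<le> 1"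
  shows "expectation (\<lambda>\<omega>. compensator a b \<omega> * W \<omega>) = (LINT s:{a..b}|lborel. expectation (\<lambda>\<omega>. drift s \<omega> * W \<omega>))"
proof -
  have "expectation (\<lambda>\<omega>. compensator a b \<omega> * W \<omega>) = expectation (\<lambda>\<omega>. \<integral>s. indicator {a..b} s *\<^sub>R (drift s \<omega> * W \<omega>) \<partial>lborel)"
    unfolding compensator_def set_lebesgue_integral_def by (simp add: mult.assoc[symmetric])
  also have "\<dots> = (\<integral>s. expectation (\<lambda>\<omega>. indicator {a..b} s *\<^sub>R (drift s \<omega> * W \<omega>)) \<partial>lborel)"
    by (rule P.Fubini_integral[OF window_integrable[OF ab W]])
  finally show ?thesis unfolding set_lebesgue_integral_def by simp
qed

text \<open>
  Where the drift is not integrable in time the Lebesgue integral is zero by convention, so the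
  pointwise bound by the integrated envelope holds everywhere.
\<close>

lemma compensator_mean_abs:
  assumes ab: "0 \<le> a" "a \<le> b"
  shows "expectation (\<lambda>\<omega>. \<bar>compensator a b \<omega>\<bar>) \<le> 2 * env_const * (sqrt b - sqrt a)"
proof -
  have "ennreal (expectation (\<lambda>\<omega>. \<bar>compensator a b \<omega>\<bar>)) = (\<integral>\<^sup>+\<omega>. ennreal \<bar>compensator a b \<omega>\<bar> \<partial>M)"
    using compensator_integrable[OF ab] by (intro nn_integral_eq_integral[symmetric]) auto
  also have "\<dots> \<le> (\<integral>\<^sup>+\<omega>. (\<integral>\<^sup>+s. envelope s \<omega> * indicator {a..b} s \<partial>lborel) \<partial>M)"
  proof (rule nn_integral_mono)
    fix \<omega>
    have "ennreal \<bar>compensator a b \<omega>\<bar> \<le> (\<integral>\<^sup>+s. ennreal (norm (indicator {a..b} s *\<^sub>R drift s \<omega>)) \<partial>lborel)"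
    proof (cases "integrable lborel (\<lambda>s. indicator {a..b} s *\<^sub>R drift s \<omega>)")
      case True then show ?thesis
        using integral_norm_bound_ennreal[OF True] by (simp add: compensator_def set_lebesgue_integral_def)
    next
      case False then show ?thesis by (simp add: compensator_def set_lebesgue_integral_def not_integrable_integral_eq)
    qed
    also have "\<dots> \<le> (\<integral>\<^sup>+s. envelope s \<omega> * indicator {a..b} s \<partial>lborel)"
      using drift_bound[of _ \<omega>] by (intro nn_integral_mono) (auto simp: indicator_def)
    finally show "ennreal \<bar>compensator a b \<omega>\<bar> \<le> (\<integral>\<^sup>+s. envelope s \<omega> * indicator {a..b} s \<partial>lborel)" .
  qed
  also have "\<dots> \<le> ennreal (2 * env_const * (sqrt b - sqrt a))" by (rule nn_envelope_window[OF ab])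
  finally show ?thesis using ab env_const_nonneg by (subst (asm) ennreal_le_iff) auto
qed

lemma drift_expectation_limit:
  fixes W :: "'a \<Rightarrow> real"
  assumes s: "0 < s" and [measurable]: "W \<in> borel_measurable M" and W: "\<And>\<omega>. \<bar>W \<omega>\<bar> \<le> 1"
  shows "(\<lambda>k. expectation (\<lambda>\<omega>. avg k s \<omega> * W \<omega>)) \<longlonglongrightarrow> expectation (\<lambda>\<omega>. drift s \<omega> * W \<omega>)"
proof (rule integral_dominated_convergence[where w="\<lambda>\<omega>. enn2real (envelope s \<omega>)"])
  have fin: "(\<integral>\<^sup>+\<omega>. envelope s \<omega> \<partial>M) < \<infinity>" using nn_mean_envelope[of s] s by (auto intro: le_less_trans)
  then have ae: "AE \<omega> in M. envelope s \<omega> \<noteq> \<infinity>" by (intro nn_integral_PInf_AE) auto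
  show "integrable M (\<lambda>\<omega>. enn2real (envelope s \<omega>))"
  proof (rule integrableI_bounded)
    have "(\<integral>\<^sup>+\<omega>. ennreal (norm (enn2real (envelope s \<omega>))) \<partial>M) \<le> (\<integral>\<^sup>+\<omega>. envelope s \<omega> \<partial>M)"
      by (intro nn_integral_mono) (simp add: ennreal_enn2real_if)
    then show "(\<integral>\<^sup>+\<omega>. ennreal (norm (enn2real (envelope s \<omega>))) \<partial>M) < \<infinity>" using fin by (rule le_less_trans)
  qed measurable
  show "AE \<omega> in M. (\<lambda>k. avg k s \<omega> * W \<omega>) \<longlonglongrightarrow> drift s \<omega> * W \<omega>"
    using ae
  proof eventually_elim
    case (elim \<omega>)
    then have "(\<lambda>k. avg k s \<omega>) \<longlonglongrightarrow> lim (\<lambda>k. avg k s \<omega>)"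
      by (intro telescoping_envelope(2)) (simp add: envelope_def less_top)
    then show ?case unfolding drift_eq_lim by (intro tendsto_intros)
  qed
  show "AE \<omega> in M. norm (avg k s \<omega> * W \<omega>) \<le> enn2real (envelope s \<omega>)" for k
    using ae
  proof eventually_elim
    case (elim \<omega>)
    have "ennreal \<bar>avg k s \<omega>\<bar> \<le> envelope s \<omega>" unfolding envelope_def by (rule telescoping_envelope(1))
    also have "\<dots> = ennreal (enn2real (envelope s \<omega>))" using elim by (simp add: less_top)
    finally have "\<bar>avg k s \<omega>\<bar> \<le> enn2real (envelope s \<omega>)" by (subst (asm) ennreal_le_iff) auto
    then show ?case using W[of \<omega>] by (simp add: abs_mult) (meson abs_ge_zero mult_left_le order_trans)
  qed
qed measurable

end

section \<open>Innovations are orthogonal to the past\<close>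

context prob_space begin

lemma trig_orthogonal_cong_AE:
  assumes "trig_orthogonal V Y" "AE \<omega> in M. Y \<omega> = Y' \<omega>" and [measurable]: "Y' \<in> borel_measurable M"
    and V: "\<And>Z. Z \<in> V \<Longrightarrow> Z \<in> borel_measurable M"
  shows "trig_orthogonal V Y'"
  unfolding trig_orthogonal_def
proof (intro conjI ballI)
  have i: "integrable M Y" using assms(1) by (simp add: trig_orthogonal_def)
  then have [measurable]: "Y \<in> borel_measurable M" by simp
  show "integrable M Y'" by (rule integrable_cong_AE_imp[OF i]) (use assms(2) in auto)
  fix Z assume Z: "Z \<in> V"
  have [measurable]: "Z \<in> borel_measurable M" by (rule V[OF Z])
  have "expectation (\<lambda>x. Y' x * cos (Z x)) = expectation (\<lambda>x. Y x * cos (Z x))"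
    "expectation (\<lambda>x. Y' x * sin (Z x)) = expectation (\<lambda>x. Y x * sin (Z x))"
    by (intro integral_cong_AE; use assms(2) in auto)+
  then show "expectation (\<lambda>x. Y' x * cos (Z x)) = 0" "expectation (\<lambda>x. Y' x * sin (Z x)) = 0"
    using assms(1) Z by (auto simp: trig_orthogonal_def)
qed

text \<open>
  The product formulas write \<open>cos Z * cos (t * W)\<close> and its variants as combinations of
  characters of \<open>Z + t * W\<close> and \<open>Z - t * W\<close>, so \<open>Y * cos Z\<close> and \<open>Y * sin Z\<close> are orthogonal to all
  characters of \<open>W\<close>.
\<close>

lemma trig_orthogonal_indicator:
  assumes V: "\<And>Z. Z \<in> V \<Longrightarrow> Z \<in> borel_measurable M"
    and W[measurable]: "W \<in> borel_measurable M"
    and shift: "\<And>Z t. Z \<in> V \<Longrightarrow> (\<lambda>x. Z x + t * W x) \<in> V"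
    and A[measurable]: "A \<in> sets borel" and Y: "trig_orthogonal V Y"
  shows "trig_orthogonal V (\<lambda>x. Y x * indicator A (W x))"
  unfolding trig_orthogonal_def
proof (intro conjI ballI)
  have i: "integrable M Y" using Y by (simp add: trig_orthogonal_def)
  show "integrable M (\<lambda>x. Y x * indicator A (W x))"
    by (rule integrable_mult_bounded[OF i]) (auto simp: indicator_def)
  fix Z assume Z: "Z \<in> V"
  have [measurable]: "Z \<in> borel_measurable M" by (rule V[OF Z])
  have z: "expectation (\<lambda>x. Y x * cos (Z x + t * W x)) = 0" "expectation (\<lambda>x. Y x * sin (Z x + t * W x)) = 0" for t
    using Y shift[OF Z, of t] by (auto simp: trig_orthogonal_def)
  have ci: "integrable M (\<lambda>x. Y x * cos (Z x + t * W x))" "integrable M (\<lambda>x. Y x * sin (Z x + t * W x))" for t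
    by (rule integrable_mult_bounded[OF i]; simp)+
  have e: "Y x * cos (Z x) * cos (t * W x) = (Y x * cos (Z x + t * W x) + Y x * cos (Z x + (-t) * W x)) / 2"
    "Y x * cos (Z x) * sin (t * W x) = (Y x * sin (Z x + t * W x) - Y x * sin (Z x + (-t) * W x)) / 2"
    "Y x * sin (Z x) * cos (t * W x) = (Y x * sin (Z x + t * W x) + Y x * sin (Z x + (-t) * W x)) / 2"
    "Y x * sin (Z x) * sin (t * W x) = (Y x * cos (Z x + (-t) * W x) - Y x * cos (Z x + t * W x)) / 2" for x t
  proof -
    have "cos (Z x + (-t) * W x) = cos (Z x) * cos (t * W x) + sin (Z x) * sin (t * W x)"
      "sin (Z x + (-t) * W x) = sin (Z x) * cos (t * W x) - cos (Z x) * sin (t * W x)"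
      by (simp_all add: cos_diff sin_diff)
    then show "Y x * cos (Z x) * cos (t * W x) = (Y x * cos (Z x + t * W x) + Y x * cos (Z x + (-t) * W x)) / 2"
      "Y x * cos (Z x) * sin (t * W x) = (Y x * sin (Z x + t * W x) - Y x * sin (Z x + (-t) * W x)) / 2"
      "Y x * sin (Z x) * cos (t * W x) = (Y x * sin (Z x + t * W x) + Y x * sin (Z x + (-t) * W x)) / 2"
      "Y x * sin (Z x) * sin (t * W x) = (Y x * cos (Z x + (-t) * W x) - Y x * cos (Z x + t * W x)) / 2"
      by (simp_all only: cos_add[of "Z x" "t * W x"] sin_add[of "Z x" "t * W x"]) (simp_all add: algebra_simps)
  qed
  have "expectation (\<lambda>x. (Y x * cos (Z x)) * indicator A (W x)) = 0"
  proof (rule fourier_zero_imp_zero)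
    show "integrable M (\<lambda>x. Y x * cos (Z x))" by (rule integrable_mult_bounded[OF i]) simp_all
    show "expectation (\<lambda>x. Y x * cos (Z x) * cos (t * W x)) = 0"
      "expectation (\<lambda>x. Y x * cos (Z x) * sin (t * W x)) = 0" for t
      unfolding e using z[of t] z[of "-t"] ci[of t] ci[of "-t"] by simp_all
  qed simp_all
  then show "expectation (\<lambda>x. Y x * indicator A (W x) * cos (Z x)) = 0" by (simp add: mult_ac)
  have "expectation (\<lambda>x. (Y x * sin (Z x)) * indicator A (W x)) = 0"
  proof (rule fourier_zero_imp_zero)
    show "integrable M (\<lambda>x. Y x * sin (Z x))" by (rule integrable_mult_bounded[OF i]) simp_all
    show "expectation (\<lambda>x. Y x * sin (Z x) * cos (t * W x)) = 0"
      "expectation (\<lambda>x. Y x * sin (Z x) * sin (t * W x)) = 0" for t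
      unfolding e using z[of t] z[of "-t"] ci[of t] ci[of "-t"] by simp_all
  qed simp_all
  then show "expectation (\<lambda>x. Y x * indicator A (W x) * sin (Z x)) = 0" by (simp add: mult_ac)
qed

end

context regular_bifbm begin

lemma expectation_X_lin:
  assumes t: "0 \<le> t" and d: "d \<in> finsupp {0..}"
  shows "expectation (\<lambda>\<omega>. X t \<omega> * lin d (\<lambda>r. X r \<omega>)) = lin d (bifbm_cov K t)"
proof -
  have "expectation (\<lambda>\<omega>. X t \<omega> * lin d (\<lambda>r. X r \<omega>)) = expectation (\<lambda>\<omega>. lin d (\<lambda>r. X t \<omega> * X r \<omega>))"
    by (simp add: lin_scale_right)
  also have "\<dots> = lin d (\<lambda>r. expectation (\<lambda>\<omega>. X t \<omega> * X r \<omega>))"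
    by (intro lin_integral[OF d] X_mult t) auto
  also have "\<dots> = lin d (bifbm_cov K t)" by (intro lin_cong[OF d] X_cov t) auto
  finally show ?thesis .
qed

lemma expectation_avg_mult:
  assumes s: "0 < s" and W: "W \<in> borel_measurable M" "\<And>\<omega>. \<bar>W \<omega>\<bar> \<le> 1"
  shows "expectation (\<lambda>\<omega>. avg k s \<omega> * W \<omega>) = lin (x k) (\<lambda>u. expectation (\<lambda>\<omega>. X (s * u) \<omega> * W \<omega>)) / s"
proof -
  have "avg k s \<omega> * W \<omega> = lin (x k) (\<lambda>u. X (s * u) \<omega> * W \<omega>) / s" for \<omega>
    unfolding avg_def mult.commute[of _ "W \<omega>"] lin_scale_right by simp
  moreover have "expectation (\<lambda>\<omega>. lin (x k) (\<lambda>u. X (s * u) \<omega> * W \<omega>)) = lin (x k) (\<lambda>u. expectation (\<lambda>\<omega>. X (s * u) \<omega> * W \<omega>))"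
    using s by (intro lin_integral(2)[OF x_supp] integrable_mult_bounded X_int W) auto
  ultimately show ?thesis by simp
qed

text \<open>
  The characteristic function of a centred Gaussian combination. It is a common factor of all
  sine expectations below, and so drops out of orthogonality relations.
\<close>

abbreviation damping :: "(real \<Rightarrow> real) \<Rightarrow> real" where
  "damping d \<equiv> exp (- expectation (\<lambda>\<omega>. (lin d (\<lambda>r. X r \<omega>))\<^sup>2) / 2)"

lemma drift_cos:
  assumes s: "0 < s" and d: "d \<in> finsupp {0..}"
  shows "expectation (\<lambda>\<omega>. drift s \<omega> * cos (lin d (\<lambda>r. X r \<omega>))) = 0"
proof -
  have m[measurable]: "(\<lambda>\<omega>. lin d (\<lambda>r. X r \<omega>)) \<in> borel_measurable M" by (rule lin_X_meas[OF d])
  have "expectation (\<lambda>\<omega>. avg k s \<omega> * cos (lin d (\<lambda>r. X r \<omega>))) = 0" for k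
  proof -
    have "lin (x k) (\<lambda>u. expectation (\<lambda>\<omega>. X (s * u) \<omega> * cos (lin d (\<lambda>r. X r \<omega>)))) = lin (x k) (\<lambda>u. 0)"
      using s d by (intro lin_cong[OF x_supp]) (simp add: X_cos)
    also have "\<dots> = 0" by (simp add: lin_def)
    finally show ?thesis using s by (subst expectation_avg_mult) auto
  qed
  moreover have "(\<lambda>k. expectation (\<lambda>\<omega>. avg k s \<omega> * cos (lin d (\<lambda>r. X r \<omega>)))) \<longlonglongrightarrow> expectation (\<lambda>\<omega>. drift s \<omega> * cos (lin d (\<lambda>r. X r \<omega>)))"
    by (rule drift_expectation_limit[OF s]) auto
  ultimately show ?thesis by (simp add: LIMSEQ_const_iff)
qed

text \<open>
  Rescaling time by \<open>s\<close> turns the covariances with the past before \<open>s\<close> into covariances at times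
  \<open>v / s\<close> in \<open>{0..1}\<close>, where the defining limit of the coefficients applies.
\<close>

lemma drift_sin:
  assumes s: "0 < s" "u \<le> s" and d: "d \<in> finsupp {0..u}"
  shows "expectation (\<lambda>\<omega>. drift s \<omega> * sin (lin d (\<lambda>r. X r \<omega>))) = damping d * lin d (\<lambda>v. drift_kernel K (v / s))"
proof -
  have d0: "d \<in> finsupp {0..}" by (rule finsupp_mono[OF _ d]) auto
  have m[measurable]: "(\<lambda>\<omega>. lin d (\<lambda>r. X r \<omega>)) \<in> borel_measurable M" by (rule lin_X_meas[OF d])
  have "expectation (\<lambda>\<omega>. avg k s \<omega> * sin (lin d (\<lambda>r. X r \<omega>))) = damping d * lin d (\<lambda>v. lin (x k) (\<lambda>w. bifbm_cov K w (v / s)))" for k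
  proof -
    have "lin (x k) (\<lambda>w. expectation (\<lambda>\<omega>. X (s * w) \<omega> * sin (lin d (\<lambda>r. X r \<omega>))))
      = lin (x k) (\<lambda>w. damping d * lin d (\<lambda>v. s * bifbm_cov K w (v / s)))"
    proof (rule lin_cong[OF x_supp])
      fix w :: real assume w: "w \<in> {0..1}"
      have "lin d (bifbm_cov K (s * w)) = lin d (\<lambda>v. s * bifbm_cov K w (v / s))"
      proof (rule lin_cong[OF d])
        fix v assume "v \<in> {0..u}"
        then show "bifbm_cov K (s * w) v = s * bifbm_cov K w (v / s)"
          using bifbm_cov_scale[of K s w "v / s"] s w K by simp
      qed
      then show "expectation (\<lambda>\<omega>. X (s * w) \<omega> * sin (lin d (\<lambda>r. X r \<omega>))) = damping d * lin d (\<lambda>v. s * bifbm_cov K w (v / s))"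
        using X_sin[of "s * w" d] expectation_X_lin[of "s * w" d] d0 s w by simp
    qed
    also have "\<dots> = damping d * (s * lin d (\<lambda>v. lin (x k) (\<lambda>w. bifbm_cov K w (v / s))))"
      unfolding lin_scale_right by (subst lin_swap) simp
    finally show ?thesis using s by (subst expectation_avg_mult) auto
  qed
  moreover have "(\<lambda>k. damping d * lin d (\<lambda>v. lin (x k) (\<lambda>w. bifbm_cov K w (v / s)))) \<longlonglongrightarrow> damping d * lin d (\<lambda>v. drift_kernel K (v / s))"
    using s by (intro tendsto_mult_left lin_tendsto[OF d] x_lim) auto
  moreover have "(\<lambda>k. expectation (\<lambda>\<omega>. avg k s \<omega> * sin (lin d (\<lambda>r. X r \<omega>)))) \<longlonglongrightarrow> expectation (\<lambda>\<omega>. drift s \<omega> * sin (lin d (\<lambda>r. X r \<omega>)))"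
    using s by (intro drift_expectation_limit) auto
  ultimately show ?thesis by (simp add: LIMSEQ_unique)
qed

definition past_span :: "real \<Rightarrow> ('a \<Rightarrow> real) set" where
  "past_span u = {\<lambda>\<omega>. lin d (\<lambda>r. X r \<omega>) | d. d \<in> finsupp {0..u}}"

definition innovation :: "real \<Rightarrow> real \<Rightarrow> 'a \<Rightarrow> real" where
  "innovation u t \<omega> = X t \<omega> - X u \<omega> - compensator u t \<omega>"

lemma innovation_integrable: "0 \<le> u \<Longrightarrow> u \<le> t \<Longrightarrow> integrable M (innovation u t)"
  unfolding innovation_def[abs_def] using compensator_integrable X_int by simp

lemma past_span_measurable: "Z \<in> past_span u \<Longrightarrow> Z \<in> borel_measurable M"
  by (auto simp: past_span_def)

text \<open>
  The sine expectation of the compensator is the time integral of \<open>drift_kernel K (v / s)\<close>,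
  which by \<open>bifbm_cov_increment\<close> equals the covariance increment contributed by \<open>X t - X u\<close>.
\<close>

lemma innovation_trig_orthogonal:
  assumes u: "0 < u" "u \<le> t"
  shows "trig_orthogonal (past_span u) (innovation u t)"
  unfolding trig_orthogonal_def
proof (intro conjI ballI)
  show "integrable M (innovation u t)" using u by (intro innovation_integrable) auto
  fix Z assume "Z \<in> past_span u"
  then obtain d where d: "d \<in> finsupp {0..u}" and Z: "Z = (\<lambda>\<omega>. lin d (\<lambda>r. X r \<omega>))" by (auto simp: past_span_def)
  have d0: "d \<in> finsupp {0..}" by (rule finsupp_mono[OF _ d]) auto
  have [measurable]: "Z \<in> borel_measurable M" unfolding Z by (rule lin_X_meas[OF d])
  have i: "integrable M (\<lambda>\<omega>. Q \<omega> * cos (Z \<omega>))" "integrable M (\<lambda>\<omega>. Q \<omega> * sin (Z \<omega>))" if "integrable M Q" for Q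
    by (rule integrable_mult_bounded[OF that]; simp)+
  have Xi: "integrable M (X t)" "integrable M (X u)" and Ci: "integrable M (compensator u t)"
    using u by (auto intro: X_int compensator_integrable)
  have "expectation (\<lambda>\<omega>. compensator u t \<omega> * cos (Z \<omega>)) = (LINT s:{u..t}|lborel. expectation (\<lambda>\<omega>. drift s \<omega> * cos (Z \<omega>)))"
    using u by (intro compensator_expectation) auto
  also have "\<dots> = (LINT s:{u..t}|lborel. 0)"
    using u d0 unfolding Z by (intro set_lebesgue_integral_cong) (auto simp: drift_cos)
  finally have c: "expectation (\<lambda>\<omega>. compensator u t \<omega> * cos (Z \<omega>)) = 0" by (simp add: set_lebesgue_integral_def)
  show "expectation (\<lambda>\<omega>. innovation u t \<omega> * cos (Z \<omega>)) = 0"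
    unfolding innovation_def left_diff_distrib
    using i(1)[OF Xi(1)] i(1)[OF Xi(2)] i(1)[OF Ci] c X_cos[of t d] X_cos[of u d] u d0 by (simp add: Z)
  have "expectation (\<lambda>\<omega>. compensator u t \<omega> * sin (Z \<omega>)) = (LINT s:{u..t}|lborel. expectation (\<lambda>\<omega>. drift s \<omega> * sin (Z \<omega>)))"
    using u by (intro compensator_expectation) auto
  also have "\<dots> = (LINT s:{u..t}|lborel. damping d * lin d (\<lambda>v. drift_kernel K (v / s)))"
    using u d unfolding Z by (intro set_lebesgue_integral_cong) (auto simp: drift_sin)
  also have "\<dots> = damping d * (\<integral>s. lin d (\<lambda>v. drift_kernel K (v / s) * indicator {u..t} s) \<partial>lborel)"
    by (simp add: set_lebesgue_integral_def mult.commute[of _ "indicator _ _"] lin_scale_right mult.left_commute)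
  also have "(\<integral>s. lin d (\<lambda>v. drift_kernel K (v / s) * indicator {u..t} s) \<partial>lborel) = lin d (\<lambda>v. \<integral>s. drift_kernel K (v / s) * indicator {u..t} s \<partial>lborel)"
    using bifbm_cov_increment[OF K(1) _ _ u] by (intro lin_integral(2)[OF d]) (auto simp: has_bochner_integral_iff)
  also have "\<dots> = lin d (\<lambda>v. bifbm_cov K t v - bifbm_cov K u v)"
    using bifbm_cov_increment[OF K(1) _ _ u] by (intro lin_cong[OF d]) (auto simp: has_bochner_integral_iff)
  finally have c: "expectation (\<lambda>\<omega>. compensator u t \<omega> * sin (Z \<omega>)) = damping d * (lin d (bifbm_cov K t) - lin d (bifbm_cov K u))"
    by (simp add: lin_diff_right)
  show "expectation (\<lambda>\<omega>. innovation u t \<omega> * sin (Z \<omega>)) = 0"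
    unfolding innovation_def left_diff_distrib
    using i(2)[OF Xi(1)] i(2)[OF Xi(2)] i(2)[OF Ci] c X_sin[of t d] X_sin[of u d] u d0
      expectation_X_lin[of t d] expectation_X_lin[of u d]
    by (simp add: Z right_diff_distrib)
qed

text \<open>
  Generators are described only up to null sets, which covers both the negligible sets of the
  augmentation and events of a modification of \<open>X\<close>.
\<close>

lemma innovation_orthogonal_sigma:
  assumes u: "0 < u" "u \<le> t" and G: "G \<subseteq> sets M"
    and gen: "\<And>C. C \<in> G \<Longrightarrow> C \<in> null_sets M \<or> (\<exists>r\<in>{0..u}. \<exists>S\<in>sets borel. AE \<omega> in M. \<omega> \<in> C \<longleftrightarrow> X r \<omega> \<in> S)"
    and A: "A \<in> sigma_sets (space M) G"
  shows "expectation (\<lambda>\<omega>. innovation u t \<omega> * indicator A \<omega>) = 0"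
proof -
  have "trig_orthogonal (past_span u) (\<lambda>\<omega>. innovation u t \<omega> * indicator A \<omega>)"
  proof (rule trig_orthogonal_sigma[OF past_span_measurable _ G A innovation_trig_orthogonal[OF u]])
    fix C Y assume C: "C \<in> G" and Y: "trig_orthogonal (past_span u) Y"
    have [measurable]: "C \<in> sets M" using C G by blast
    have i: "integrable M Y" using Y by (simp add: trig_orthogonal_def)
    then have [measurable]: "Y \<in> borel_measurable M" by simp
    from gen[OF C] show "trig_orthogonal (past_span u) (\<lambda>x. Y x * indicator C x)"
    proof
      assume "C \<in> null_sets M"
      from AE_not_in[OF this] have "AE x in M. 0 = Y x * indicator C x"
        by eventually_elim simp
      moreover have z: "trig_orthogonal (past_span u) (\<lambda>_. 0)" by (simp add: trig_orthogonal_def)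
      moreover have m: "(\<lambda>x. Y x * indicator C x) \<in> borel_measurable M" by measurable
      ultimately show ?thesis by (intro trig_orthogonal_cong_AE[OF z _ m past_span_measurable])
    next
      assume "\<exists>r\<in>{0..u}. \<exists>S\<in>sets borel. AE \<omega> in M. \<omega> \<in> C \<longleftrightarrow> X r \<omega> \<in> S"
      then obtain r S where r: "r \<in> {0..u}" and S: "S \<in> sets borel" and ae: "AE \<omega> in M. \<omega> \<in> C \<longleftrightarrow> X r \<omega> \<in> S" by blast
      have "trig_orthogonal (past_span u) (\<lambda>x. Y x * indicator S (X r x))"
      proof (rule trig_orthogonal_indicator[OF past_span_measurable X_meas _ S Y])
        fix Z t assume "Z \<in> past_span u"
        then obtain d where d: "d \<in> finsupp {0..u}" and Z: "Z = (\<lambda>\<omega>. lin d (\<lambda>r. X r \<omega>))" by (auto simp: past_span_def)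
        have "(\<lambda>x. Z x + t * X r x) = (\<lambda>\<omega>. lin (\<lambda>v. d v + t * point r v) (\<lambda>r. X r \<omega>))"
          unfolding Z using lin_comb_left[OF d point_finsupp[OF r]] by simp
        then show "(\<lambda>x. Z x + t * X r x) \<in> past_span u"
          unfolding past_span_def using finsupp_comb[OF d point_finsupp[OF r]] by blast
      qed
      moreover have "AE x in M. Y x * indicator S (X r x) = Y x * indicator C x"
        using ae by eventually_elim (auto simp: indicator_def)
      ultimately show ?thesis
        by (rule trig_orthogonal_cong_AE[OF _ _ _ past_span_measurable]) measurable
    qed
  qed
  moreover have "(\<lambda>_. 0) \<in> past_span u" unfolding past_span_def using zero_finsupp by force
  ultimately show ?thesis unfolding trig_orthogonal_def by force
qed

text \<open>
  Events of the right-continuous filtration at \<open>s\<close> belong to the past of every \<open>u > s\<close>. The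
  innovations over \<open>{s..t}\<close> and \<open>{u..t}\<close> differ by terms that tend to zero in mean as \<open>u\<close>
  decreases to \<open>s\<close>; this also reaches \<open>s = 0\<close>, where the drift is singular.
\<close>

lemma innovation_orthogonal_right_limit:
  assumes s: "0 \<le> s" "s < t" and A[measurable]: "A \<in> sets M"
    and orth: "\<And>u. s < u \<Longrightarrow> u \<le> t \<Longrightarrow> expectation (\<lambda>\<omega>. innovation u t \<omega> * indicator A \<omega>) = 0"
  shows "expectation (\<lambda>\<omega>. innovation s t \<omega> * indicator A \<omega>) = 0"
proof -
  let ?b = "\<lambda>u. sqrt (u - 2 * bifbm_cov K u s + s) + 2 * env_const * (sqrt u - sqrt s)"
  have bound: "\<bar>expectation (\<lambda>\<omega>. innovation s t \<omega> * indicator A \<omega>)\<bar> \<le> ?b u" if u: "s < u" "u \<le> t" for u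
  proof -
    have i: "integrable M (\<lambda>\<omega>. Q \<omega> * indicator A \<omega>)" if "integrable M Q" for Q :: "'a \<Rightarrow> real"
      by (rule integrable_mult_bounded[OF that]) (auto simp: indicator_def)
    have abs: "\<bar>expectation (\<lambda>\<omega>. Q \<omega> * indicator A \<omega>)\<bar> \<le> expectation (\<lambda>\<omega>. \<bar>Q \<omega>\<bar>)" if "integrable M Q" for Q :: "'a \<Rightarrow> real"
    proof -
      have "\<bar>expectation (\<lambda>\<omega>. Q \<omega> * indicator A \<omega>)\<bar> \<le> expectation (\<lambda>\<omega>. \<bar>Q \<omega> * indicator A \<omega>\<bar>)"
        by (rule integral_abs_bound)
      also have "\<dots> \<le> expectation (\<lambda>\<omega>. \<bar>Q \<omega>\<bar>)"
        using that i[OF that] by (intro integral_mono integrable_abs) (auto simp: indicator_def)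
      finally show ?thesis .
    qed
    have XI: "integrable M (\<lambda>\<omega>. X u \<omega> - X s \<omega>)" using s u by (intro Bochner_Integration.integrable_diff X_int) auto
    have CI: "integrable M (compensator s u)" using s u by (intro compensator_integrable) auto
    have NI: "integrable M (innovation u t)" using s u by (intro innovation_integrable) auto
    have NS: "integrable M (innovation s t)" using s u by (intro innovation_integrable) auto
    have ae: "AE \<omega> in M. innovation s t \<omega> = innovation u t \<omega> + (X u \<omega> - X s \<omega>) - compensator s u \<omega>"
      using AE_drift_integrable
    proof eventually_elim
      case (elim \<omega>)
      have "compensator s t \<omega> = compensator s u \<omega> + compensator u t \<omega>"
        unfolding compensator_def
        using indefinite_integral_diff[of "\<lambda>s. drift s \<omega>" s t] indefinite_integral_diff[of "\<lambda>s. drift s \<omega>" s u]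
          indefinite_integral_diff[of "\<lambda>s. drift s \<omega>" u t] elim s u by simp
      then show ?case by (simp add: innovation_def)
    qed
    have "expectation (\<lambda>\<omega>. innovation s t \<omega> * indicator A \<omega>)
      = expectation (\<lambda>\<omega>. innovation u t \<omega> * indicator A \<omega> + (X u \<omega> - X s \<omega>) * indicator A \<omega> - compensator s u \<omega> * indicator A \<omega>)"
    proof (rule integral_cong_AE)
      show "AE \<omega> in M. innovation s t \<omega> * indicator A \<omega> = innovation u t \<omega> * indicator A \<omega> + (X u \<omega> - X s \<omega>) * indicator A \<omega> - compensator s u \<omega> * indicator A \<omega>"
        using ae by eventually_elim (simp add: indicator_def)
    qed (use i[OF NS] i[OF NI] i[OF XI] i[OF CI] in auto)
    also have "\<dots> = expectation (\<lambda>\<omega>. (X u \<omega> - X s \<omega>) * indicator A \<omega>) - expectation (\<lambda>\<omega>. compensator s u \<omega> * indicator A \<omega>)"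
      using i[OF NI] i[OF XI] i[OF CI] orth[OF u] by simp
    finally have "\<bar>expectation (\<lambda>\<omega>. innovation s t \<omega> * indicator A \<omega>)\<bar> \<le> expectation (\<lambda>\<omega>. \<bar>X u \<omega> - X s \<omega>\<bar>) + expectation (\<lambda>\<omega>. \<bar>compensator s u \<omega>\<bar>)"
      using abs[OF XI] abs[OF CI] by linarith
    moreover have "expectation (\<lambda>\<omega>. \<bar>compensator s u \<omega>\<bar>) \<le> 2 * env_const * (sqrt u - sqrt s)"
      using s u by (intro compensator_mean_abs) auto
    moreover have "expectation (\<lambda>\<omega>. \<bar>X u \<omega> - X s \<omega>\<bar>) \<le> sqrt (u - 2 * bifbm_cov K u s + s)"
    proof -
      have e: "(X u \<omega> - X s \<omega>)\<^sup>2 = X u \<omega> * X u \<omega> - 2 * (X u \<omega> * X s \<omega>) + X s \<omega> * X s \<omega>" for \<omega>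
        by (simp add: power2_eq_square algebra_simps)
      have m: "integrable M (\<lambda>\<omega>. X u \<omega> * X u \<omega>)" "integrable M (\<lambda>\<omega>. X u \<omega> * X s \<omega>)" "integrable M (\<lambda>\<omega>. X s \<omega> * X s \<omega>)"
        using s u by (auto intro!: X_mult)
      have "expectation (\<lambda>\<omega>. (X u \<omega> - X s \<omega>)\<^sup>2) = u - 2 * bifbm_cov K u s + s"
        unfolding e using m s u K by (simp add: X_cov bifbm_cov_diag)
      moreover have "expectation (\<lambda>\<omega>. \<bar>X u \<omega> - X s \<omega>\<bar>) \<le> sqrt (expectation (\<lambda>\<omega>. (X u \<omega> - X s \<omega>)\<^sup>2))"
        by (rule mean_abs_le(2)) (use m in \<open>simp_all add: e\<close>)
      ultimately show ?thesis by simp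
    qed
    ultimately show ?thesis by linarith
  qed
  have "(?b \<longlongrightarrow> sqrt (s - 2 * bifbm_cov K s s + s) + 2 * env_const * (sqrt s - sqrt s)) (at_right s)"
    using s K by (intro tendsto_intros bifbm_cov_continuous) auto
  then have "(?b \<longlongrightarrow> 0) (at_right s)" using s K by (simp add: bifbm_cov_diag)
  moreover have "eventually (\<lambda>u. \<bar>expectation (\<lambda>\<omega>. innovation s t \<omega> * indicator A \<omega>)\<bar> \<le> ?b u) (at_right s)"
    unfolding eventually_at_right[OF s(2)] using s bound by (intro exI[of _ t]) auto
  ultimately have "\<bar>expectation (\<lambda>\<omega>. innovation s t \<omega> * indicator A \<omega>)\<bar> \<le> 0"
    by (rule tendsto_lowerbound) simp
  then show ?thesis by simp
qed

text \<open>
  Up to time \<open>t\<close> the drift does not change when the path is stopped at \<open>t\<close>, and the stopped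
  process is jointly measurable for any \<open>\<sigma>\<close>-algebra containing the past of \<open>t\<close>.
\<close>

lemma compensator_adapted:
  assumes t: "0 \<le> t" and N: "\<And>r. r \<le> t \<Longrightarrow> X r \<in> borel_measurable N"
  shows "compensator 0 t \<in> borel_measurable N"
proof -
  let ?y = "\<lambda>\<omega> s. path_drift x (\<lambda>r. X (min r t) \<omega>) s"
  have e: "compensator 0 t \<omega> = (LINT s:{0..t}|lborel. ?y \<omega> s)" for \<omega>
    unfolding compensator_def drift_def
    by (intro set_lebesgue_integral_cong) (auto intro!: path_drift_cong[OF x_supp])
  have c: "continuous_on UNIV (\<lambda>r. X (min r t) \<omega>)" for \<omega>
    by (rule continuous_on_compose2[OF X_cont]) (auto intro!: continuous_intros)
  have p: "(\<lambda>z. ?y (snd z) (fst z)) \<in> borel_measurable (lborel \<Otimes>\<^sub>M N)"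
    by (rule path_drift_measurable[OF N c x_supp]) simp
  have [measurable]: "(\<lambda>z. ?y (fst z) (snd z)) \<in> borel_measurable (N \<Otimes>\<^sub>M lborel)"
    using measurable_compose[OF _ p, of "\<lambda>z. (snd z, fst z)" "N \<Otimes>\<^sub>M lborel"] by simp
  show ?thesis
    unfolding e[abs_def] set_lebesgue_integral_def
    by (rule lborel.borel_measurable_lebesgue_integral) (unfold split_beta', measurable)
qed

end

section \<open>The augmented filtration and the decomposition\<close>

text \<open>
  The past together with all negligible sets, before taking right limits.
\<close>

definition enlarged_sets :: "'a measure \<Rightarrow> (real \<Rightarrow> 'a measure) \<Rightarrow> real \<Rightarrow> 'a set set" where
  "enlarged_sets M F u = sigma_sets (space M) (sets (F u) \<union> null_sets (completion M))"

context
  fixes M :: "'a measure" and F :: "real \<Rightarrow> 'a measure"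
  assumes sub: "\<And>t. subalgebra M (F t)" and mono: "\<forall>s t. s \<le> t \<longrightarrow> sets (F s) \<subseteq> sets (F t)"
begin

lemma enlarged_sets_completion: "enlarged_sets M F u \<subseteq> sets (completion M)"
proof -
  have "sets (F u) \<union> null_sets (completion M) \<subseteq> sets (completion M)"
    using sub[of u] by (auto simp: subalgebra_def)
  then show ?thesis unfolding enlarged_sets_def using sets.sigma_sets_subset[of _ "completion M"] by simp
qed

lemma enlarged_sets_mono: "s \<le> t \<Longrightarrow> enlarged_sets M F s \<subseteq> enlarged_sets M F t"
  unfolding enlarged_sets_def using mono by (intro sigma_sets_mono') blast

lemma enlarged_sets_Pow: "enlarged_sets M F u \<subseteq> Pow (space M)"
  using enlarged_sets_completion[of u] sets.sets_into_space[of _ "completion M"] by auto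

lemma Inter_enlarged_sets: "(\<Inter>u\<in>{t<..}. enlarged_sets M F u) \<subseteq> enlarged_sets M F (t + 1)"
  by (rule INF_lower) simp

lemma enlarged_sets_sigma: "sigma_sets (space M) (enlarged_sets M F u) = enlarged_sets M F u"
proof -
  have "sets (F u) \<union> null_sets (completion M) \<subseteq> Pow (space M)"
    using enlarged_sets_Pow[of u] unfolding enlarged_sets_def by (auto intro: sigma_sets.Basic)
  then show ?thesis unfolding enlarged_sets_def by (rule sigma_sets_sigma_sets_eq)
qed

lemma space_usual_augmentation: "space (usual_augmentation M F t) = space M"
  unfolding usual_augmentation_def enlarged_sets_def[symmetric]
  by (rule space_measure_of) (rule order_trans[OF Inter_enlarged_sets enlarged_sets_Pow])

text \<open>
  An intersection of \<open>\<sigma>\<close>-algebras is one already, so generating adds nothing.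
\<close>

lemma sets_usual_augmentation: "sets (usual_augmentation M F t) = (\<Inter>u\<in>{t<..}. enlarged_sets M F u)"
proof -
  have P: "(\<Inter>u\<in>{t<..}. enlarged_sets M F u) \<subseteq> Pow (space M)"
    by (rule order_trans[OF Inter_enlarged_sets enlarged_sets_Pow])
  have "sigma_sets (space M) (\<Inter>u\<in>{t<..}. enlarged_sets M F u) \<subseteq> enlarged_sets M F u" if "t < u" for u
  proof -
    have "sigma_sets (space M) (\<Inter>u\<in>{t<..}. enlarged_sets M F u) \<subseteq> sigma_sets (space M) (enlarged_sets M F u)"
      using that by (intro sigma_sets_mono') auto
    also have "\<dots> = enlarged_sets M F u" by (rule enlarged_sets_sigma)
    finally show ?thesis .
  qed
  then have "sigma_sets (space M) (\<Inter>u\<in>{t<..}. enlarged_sets M F u) = (\<Inter>u\<in>{t<..}. enlarged_sets M F u)"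
    by (intro equalityI sigma_sets_superset_generator) auto
  then show ?thesis
    unfolding usual_augmentation_def enlarged_sets_def[symmetric] sets_measure_of[OF P] .
qed

lemma usual_augmentation_filtered:
  assumes "prob_space M"
  shows "filtered_prob_space (completion M) (usual_augmentation M F)"
  unfolding filtered_prob_space_def filtration_def subalgebra_def sets_usual_augmentation
    space_usual_augmentation space_completion
proof (intro conjI allI impI refl)
  show "prob_space (completion M)" by (rule prob_space.prob_space_completion[OF assms])
  show "(\<Inter>u\<in>{t<..}. enlarged_sets M F u) \<subseteq> sets (completion M)" for t
    by (rule order_trans[OF Inter_enlarged_sets enlarged_sets_completion])
qed (rule INF_superset_mono, auto)

lemma measurable_usual_augmentation:
  assumes "f \<in> borel_measurable (sigma (space M) (enlarged_sets M F t))"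
  shows "f \<in> borel_measurable (usual_augmentation M F t)"
proof (rule measurable_from_subalg[OF _ assms])
  have "sets (sigma (space M) (enlarged_sets M F t)) = enlarged_sets M F t"
    unfolding sets_measure_of[OF enlarged_sets_Pow] by (rule enlarged_sets_sigma)
  then show "subalgebra (usual_augmentation M F t) (sigma (space M) (enlarged_sets M F t))"
    unfolding subalgebra_def space_usual_augmentation sets_usual_augmentation space_measure_of[OF enlarged_sets_Pow]
    by (auto intro!: INF_greatest enlarged_sets_mono)
qed

end

lemma (in prob_space) gaussian_process_moments:
  fixes B :: "real \<Rightarrow> 'a \<Rightarrow> real"
  assumes g: "gaussian_process M B" and mean0: "\<forall>t\<ge>0. expectation (B t) = 0"
  shows "\<And>t. 0 \<le> t \<Longrightarrow> B t \<in> borel_measurable M"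
    and "\<And>t. 0 \<le> t \<Longrightarrow> integrable M (\<lambda>\<omega>. (B t \<omega>)\<^sup>2)"
    and "\<And>t c. 0 \<le> t \<Longrightarrow> c \<in> finsupp {0..} \<Longrightarrow> expectation (\<lambda>\<omega>. B t \<omega> * cos (lin c (\<lambda>r. B r \<omega>))) = 0"
    and "\<And>t c. 0 \<le> t \<Longrightarrow> c \<in> finsupp {0..} \<Longrightarrow> expectation (\<lambda>\<omega>. B t \<omega> * sin (lin c (\<lambda>r. B r \<omega>))) =
        exp (- expectation (\<lambda>\<omega>. (lin c (\<lambda>r. B r \<omega>))\<^sup>2) / 2) * expectation (\<lambda>\<omega>. B t \<omega> * lin c (\<lambda>r. B r \<omega>))"
proof -
  have glin: "gaussian_rv M (\<lambda>\<omega>. lin c (\<lambda>r. B r \<omega>))" if "c \<in> finsupp {0..}" for c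
    using g that unfolding gaussian_process_def lin_def finsupp_def by auto
  have gB: "gaussian_rv M (B t)" if "0 \<le> t" for t
    using glin[OF point_finsupp[of t]] that by simp
  have mean: "expectation (B t) = 0" if "0 \<le> t" for t using mean0 that by simp
  show meas: "B t \<in> borel_measurable M" if "0 \<le> t" for t using gB[OF that] by (simp add: gaussian_rv_def)
  show sq: "integrable M (\<lambda>\<omega>. (B t \<omega>)\<^sup>2)" if "0 \<le> t" for t
    using gaussian_centered(1)[OF gB[OF that] mean[OF that]] .
  have int: "integrable M (B t)" if "0 \<le> t" for t
    by (rule integrable_of_square[OF meas[OF that] sq[OF that]])
  have mlin: "expectation (\<lambda>\<omega>. lin c (\<lambda>r. B r \<omega>)) = 0" if c: "c \<in> finsupp {0..}" for c
  proof -
    have "expectation (\<lambda>\<omega>. lin c (\<lambda>r. B r \<omega>)) = lin c (\<lambda>r. expectation (B r))"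
      by (intro lin_integral(2)[OF c] int) auto
    also have "\<dots> = lin c (\<lambda>_. 0)" by (intro lin_cong[OF c] mean) auto
    finally show ?thesis by (simp add: lin_def)
  qed
  fix t :: real and c assume t: "0 \<le> t" and c: "c \<in> finsupp {0::real..}"
  have e: "h * B t \<omega> + lin c (\<lambda>r. B r \<omega>) = lin (\<lambda>v. c v + h * point t v) (\<lambda>r. B r \<omega>)" for h \<omega>
    using lin_comb_left[OF c point_finsupp[of t]] t by simp
  have f: "(\<lambda>v. c v + h * point t v) \<in> finsupp {0..}" for h
    using finsupp_comb[OF c point_finsupp[of t]] t by simp
  have m: "(\<lambda>\<omega>. lin c (\<lambda>r. B r \<omega>)) \<in> borel_measurable M" using glin[OF c] by (simp add: gaussian_rv_def)
  show "expectation (\<lambda>\<omega>. B t \<omega> * cos (lin c (\<lambda>r. B r \<omega>))) = 0"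
    by (rule gaussian_integration_by_parts(1)[OF _ _ meas[OF t] m sq[OF t]]) (unfold e, intro glin f, intro mlin f)
  show "expectation (\<lambda>\<omega>. B t \<omega> * sin (lin c (\<lambda>r. B r \<omega>))) =
        exp (- expectation (\<lambda>\<omega>. (lin c (\<lambda>r. B r \<omega>))\<^sup>2) / 2) * expectation (\<lambda>\<omega>. B t \<omega> * lin c (\<lambda>r. B r \<omega>))"
    by (rule gaussian_integration_by_parts(2)[OF _ _ meas[OF t] m sq[OF t]]) (unfold e, intro glin f, intro mlin f)
qed

lemma natural_filtration_generators:
  assumes "\<forall>t\<ge>0. B t \<in> borel_measurable M"
  shows "sets (natural_filtration M B t) = sigma_sets (space M) {B s -` A \<inter> space M | s A. 0 \<le> s \<and> s \<le> t \<and> A \<in> sets borel}"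
    and "space (natural_filtration M B t) = space M"
    and "subalgebra M (natural_filtration M B t)"
    and "\<forall>s t. s \<le> t \<longrightarrow> sets (natural_filtration M B s) \<subseteq> sets (natural_filtration M B t)"
proof -
  have P: "{B s -` A \<inter> space M | s A. 0 \<le> s \<and> s \<le> t \<and> A \<in> sets borel} \<subseteq> Pow (space M)" for t by auto
  show sets: "sets (natural_filtration M B t) = sigma_sets (space M) {B s -` A \<inter> space M | s A. 0 \<le> s \<and> s \<le> t \<and> A \<in> sets borel}" for t
    unfolding natural_filtration_def by (rule sets_measure_of[OF P])
  show space: "space (natural_filtration M B t) = space M"
    unfolding natural_filtration_def by (rule space_measure_of[OF P])
  have "{B s -` A \<inter> space M | s A. 0 \<le> s \<and> s \<le> t \<and> A \<in> sets borel} \<subseteq> sets M"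
    using assms by (auto intro: measurable_sets)
  then show "subalgebra M (natural_filtration M B t)"
    unfolding subalgebra_def space sets by (auto dest: sets.sigma_sets_subset)
  show "\<forall>s t. s \<le> t \<longrightarrow> sets (natural_filtration M B s) \<subseteq> sets (natural_filtration M B t)"
    unfolding sets by (intro allI impI sigma_sets_mono') force
qed

theorem mainTheorem2:
  fixes H K :: real and M :: "'a measure" and B :: "real \<Rightarrow> 'a \<Rightarrow> real"
  assumes "0 < H" and "H < 1"
    and "1 < K" and "K < 2"
    and "2 * H * K = 1"
    and "prob_space M"
    and "bifractional_brownian_motion H K M B"
  shows "semimartingale (completion M) (usual_augmentation M (natural_filtration M B)) B"
proof -
  interpret prob_space M by fact
  interpret C: prob_space "completion M" by (rule prob_space_completion)
  have K: "1 < K" "K < 2" by fact+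
  have gauss: "gaussian_process M B" and mean: "\<forall>t\<ge>0. expectation (B t) = 0"
    and paths: "AE \<omega> in M. continuous_on {0..} (\<lambda>t. B t \<omega>)"
    using assms(7) by (auto simp: bifractional_brownian_motion_def)
  note B = gaussian_process_moments[OF gauss mean]
  have "2 * H = 1 / K" using assms(5) K by (simp add: field_simps)
  then have cov: "expectation (\<lambda>\<omega>. B t \<omega> * B s \<omega>) = bifbm_cov K t s" if "0 \<le> t" "0 \<le> s" for t s
    using assms(5,7) that by (simp add: bifractional_brownian_motion_def bifbm_cov_def)
  obtain N where N: "{\<omega>\<in>space M. \<not> continuous_on {0..} (\<lambda>t. B t \<omega>)} \<subseteq> N" "N \<in> null_sets M"
    using paths by (auto elim!: AE_E simp: null_sets_def)
  have [measurable]: "N \<in> sets M" using N by auto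
  \<comment> \<open>A modification all of whose paths are continuous, extended constantly to negative times.\<close>
  define X where "X t \<omega> = indicator (space M - N) \<omega> * B (max 0 t) \<omega>" for t \<omega>
  have XB: "AE \<omega> in M. \<forall>t\<ge>0. X t \<omega> = B t \<omega>"
    using AE_not_in[OF N(2)] AE_space by eventually_elim (auto simp: X_def)
  have XBl: "AE \<omega> in M. \<forall>c\<in>finsupp {0..}. lin c (\<lambda>r. X r \<omega>) = lin c (\<lambda>r. B r \<omega>)"
    using XB by eventually_elim (auto intro: lin_cong)
  have XM[measurable]: "X t \<in> borel_measurable M" for t
  proof -
    have [measurable]: "B (max 0 t) \<in> borel_measurable M" by (rule B(1)) (rule max.cobounded1)
    show ?thesis unfolding X_def[abs_def] by measurable
  qed
  have BlM: "(\<lambda>\<omega>. lin c (\<lambda>r. B r \<omega>)) \<in> borel_measurable M" if "c \<in> finsupp {0..}" for c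
    using that B(1) by (auto intro: lin_measurable)
  have XlM: "(\<lambda>\<omega>. lin c (\<lambda>r. X r \<omega>)) \<in> borel_measurable M" if "c \<in> finsupp {0..}" for c
    using that by (auto intro: lin_measurable)
  have Xc: "continuous_on UNIV (\<lambda>t. X t \<omega>)" for \<omega>
  proof (cases "\<omega> \<in> space M - N")
    case True
    then have c: "continuous_on {0..} (\<lambda>t. B t \<omega>)" using N by auto
    have "continuous_on UNIV (\<lambda>t. B (max 0 t) \<omega>)"
      by (rule continuous_on_compose2[OF c]) (auto intro!: continuous_intros)
    then show ?thesis using True by (simp add: X_def)
  qed (simp add: X_def)
  have transfer: "integral\<^sup>L (completion M) f = expectation g"
    if "f \<in> borel_measurable M" "g \<in> borel_measurable M" "AE \<omega> in M. f \<omega> = g \<omega>" for f g :: "'a \<Rightarrow> real"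
    using integral_cong_AE[OF that] that(1) by (simp add: integral_completion)
  obtain x where x: "\<And>k. x k \<in> finsupp {0..1}"
    "\<And>k. lin (\<lambda>u. x (Suc k) u - x k u) (\<lambda>u. lin (\<lambda>u. x (Suc k) u - x k u) (bifbm_cov K u)) \<le> (1/4) ^ k"
    "\<And>v. v \<in> {0..1} \<Longrightarrow> (\<lambda>k. lin (x k) (\<lambda>u. bifbm_cov K u v)) \<longlonglongrightarrow> drift_kernel K v"
    using drift_coefficients[OF K] by blast
  interpret regular_bifbm "completion M" X K x
  proof
    show "1 < K" "K < 2" by fact+
    show "X t \<in> borel_measurable (completion M)" for t by (intro measurable_completion XM)
    show "continuous_on UNIV (\<lambda>t. X t \<omega>)" for \<omega> by (rule Xc)
    show "x k \<in> finsupp {0..1}" for k by (rule x)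
    show "lin (\<lambda>u. x (Suc k) u - x k u) (\<lambda>u. lin (\<lambda>u. x (Suc k) u - x k u) (bifbm_cov K u)) \<le> (1/4) ^ k" for k by (rule x)
    show "(\<lambda>k. lin (x k) (\<lambda>u. bifbm_cov K u v)) \<longlonglongrightarrow> drift_kernel K v" if "v \<in> {0..1}" for v using that by (rule x)
    fix t :: real assume t: "0 \<le> t"
    note [measurable] = B(1)[OF t]
    have "integrable M (\<lambda>\<omega>. (X t \<omega>)\<^sup>2)"
      by (rule integrable_cong_AE_imp[OF B(2)[OF t]]) (measurable, use XB t in auto)
    then show "integrable (completion M) (\<lambda>\<omega>. (X t \<omega>)\<^sup>2)" by (subst integrable_completion) auto
    show "integral\<^sup>L (completion M) (\<lambda>\<omega>. X t \<omega> * X s \<omega>) = bifbm_cov K t s" if s: "0 \<le> s" for s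
    proof -
      note [measurable] = B(1)[OF s]
      have "integral\<^sup>L (completion M) (\<lambda>\<omega>. X t \<omega> * X s \<omega>) = expectation (\<lambda>\<omega>. B t \<omega> * B s \<omega>)"
        by (rule transfer) (measurable, use XB t s in auto)
      then show ?thesis using cov t s by simp
    qed
    fix c :: "real \<Rightarrow> real" assume c: "c \<in> finsupp {0..}"
    note [measurable] = BlM[OF c] XlM[OF c]
    have ae: "AE \<omega> in M. X t \<omega> = B t \<omega> \<and> lin c (\<lambda>r. X r \<omega>) = lin c (\<lambda>r. B r \<omega>)"
      using XB XBl by eventually_elim (use t c in auto)
    have "integral\<^sup>L (completion M) (\<lambda>\<omega>. X t \<omega> * cos (lin c (\<lambda>r. X r \<omega>))) = expectation (\<lambda>\<omega>. B t \<omega> * cos (lin c (\<lambda>r. B r \<omega>)))"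
      by (rule transfer) (measurable, use ae in auto)
    then show "integral\<^sup>L (completion M) (\<lambda>\<omega>. X t \<omega> * cos (lin c (\<lambda>r. X r \<omega>))) = 0" using B(3)[OF t c] by simp
    have "integral\<^sup>L (completion M) (\<lambda>\<omega>. X t \<omega> * sin (lin c (\<lambda>r. X r \<omega>))) = expectation (\<lambda>\<omega>. B t \<omega> * sin (lin c (\<lambda>r. B r \<omega>)))"
      "integral\<^sup>L (completion M) (\<lambda>\<omega>. X t \<omega> * lin c (\<lambda>r. X r \<omega>)) = expectation (\<lambda>\<omega>. B t \<omega> * lin c (\<lambda>r. B r \<omega>))"
      "integral\<^sup>L (completion M) (\<lambda>\<omega>. (lin c (\<lambda>r. X r \<omega>))\<^sup>2) = expectation (\<lambda>\<omega>. (lin c (\<lambda>r. B r \<omega>))\<^sup>2)"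
      by (rule transfer; (measurable; fail)?; use ae in auto)+
    then show "integral\<^sup>L (completion M) (\<lambda>\<omega>. X t \<omega> * sin (lin c (\<lambda>r. X r \<omega>))) =
        exp (- integral\<^sup>L (completion M) (\<lambda>\<omega>. (lin c (\<lambda>r. X r \<omega>))\<^sup>2) / 2) * integral\<^sup>L (completion M) (\<lambda>\<omega>. X t \<omega> * lin c (\<lambda>r. X r \<omega>))"
      using B(4)[OF t c] by simp
  qed
  let ?nat = "natural_filtration M B" let ?F = "usual_augmentation M ?nat"
  have BM: "\<forall>t\<ge>0. B t \<in> borel_measurable M" using B(1) by blast
  note nat = natural_filtration_generators[OF BM]
  note aug = enlarged_sets_completion[of M ?nat, OF nat(3,4)] enlarged_sets_Pow[of M ?nat, OF nat(3,4)]
    space_usual_augmentation[of M ?nat, OF nat(3,4)] sets_usual_augmentation[of M ?nat, OF nat(3,4)]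
  note aug_meas = measurable_usual_augmentation[of M ?nat, OF nat(3,4)]
  let ?E = "\<lambda>t. sigma (space M) (enlarged_sets M ?nat t)"
  have BE: "B r \<in> borel_measurable (?E t)" if "0 \<le> r" "r \<le> t" for r t
  proof (rule measurableI)
    fix A :: "real set" assume A: "A \<in> sets borel"
    have sp: "space (?E t) = space M" using aug(2) by (intro space_measure_of)
    have "B r -` A \<inter> space M \<in> sets (?nat t)" unfolding nat(1) using that A by (intro sigma_sets.Basic) blast
    then have "B r -` A \<inter> space M \<in> enlarged_sets M ?nat t" unfolding enlarged_sets_def by (intro sigma_sets.Basic) blast
    then show "B r -` A \<inter> space (?E t) \<in> sets (?E t)"
      unfolding sp by (subst sets_measure_of[OF aug(2)]) (rule sigma_sets.Basic)
  qed simp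
  have XE: "X r \<in> borel_measurable (?E t)" if "r \<le> t" "0 \<le> t" for r t
  proof -
    have "N \<in> null_sets (completion M)" using N(2) by (rule null_sets_completionI)
    then have "N \<in> enlarged_sets M ?nat t" unfolding enlarged_sets_def by (intro sigma_sets.Basic) blast
    then have [measurable]: "N \<in> sets (?E t)" by (subst sets_measure_of[OF aug(2)]) (rule sigma_sets.Basic)
    have [measurable]: "B (max 0 r) \<in> borel_measurable (?E t)" using that by (intro BE) auto
    have sp: "space (?E t) = space M" using aug(2) by (intro space_measure_of)
    have [measurable]: "space M - N \<in> sets (?E t)" using sets.compl_sets[OF \<open>N \<in> sets (?E t)\<close>] unfolding sp .
    show ?thesis unfolding X_def[abs_def] by measurable
  qed
  have BF: "B t \<in> borel_measurable (?F t)" if "0 \<le> t" for t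
    using that by (intro aug_meas BE) auto
  have B0F: "B 0 \<in> borel_measurable (?F t)" if "0 \<le> t" for t
    using that by (intro aug_meas BE) auto
  have AF: "compensator 0 t \<in> borel_measurable (?F t)" if "0 \<le> t" for t
    using that by (intro aug_meas compensator_adapted XE) auto
  \<comment> \<open>The martingale part is formed from \<open>B\<close> itself, so that the decomposition is exact on every path.\<close>
  let ?N = "\<lambda>t \<omega>. B t \<omega> - B 0 \<omega> - compensator 0 t \<omega>"
  have filt: "filtered_prob_space (completion M) ?F"
    using usual_augmentation_filtered[of M ?nat, OF nat(3,4)] assms(6) by blast
  have NF: "?N t \<in> borel_measurable (?F t)" if "0 \<le> t" for t
    using BF[OF that] B0F[OF that] AF[OF that] by (intro borel_measurable_diff)
  have N0F: "?N 0 \<in> borel_measurable (?F t)" if "0 \<le> t" for t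
  proof -
    have "compensator 0 0 \<in> borel_measurable (?F t)"
      using that XE by (intro aug_meas compensator_adapted) auto
    then show ?thesis using B0F[OF that] by (intro borel_measurable_diff)
  qed
  have pathsC: "AE \<omega> in completion M. continuous_on {0..} (\<lambda>t. B t \<omega>)" using paths by (rule AE_completion)
  have XBC: "AE \<omega> in completion M. \<forall>t\<ge>0. X t \<omega> = B t \<omega>" using XB by (rule AE_completion)
  have comp0: "AE \<omega> in completion M. compensator 0 0 \<omega> = 0"
    using AE_drift_integrable
  proof eventually_elim
    case (elim \<omega>)
    then show ?case
      using set_borel_integral_eq_integral(2)[of "{0..0}" "\<lambda>s. drift s \<omega>"] by (simp add: compensator_def)
  qed
  have A_cont: "AE \<omega> in completion M. continuous_on {0..} (\<lambda>t. compensator 0 t \<omega>)"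
    using AE_drift_integrable
    by eventually_elim (unfold compensator_def, rule indefinite_integral_continuous_on, blast)
  have A_fv: "AE \<omega> in completion M. locally_finite_variation (\<lambda>t. compensator 0 t \<omega>)"
    using AE_drift_integrable
    by eventually_elim (unfold compensator_def, rule indefinite_integral_finite_variation, blast)
  have N_cont: "AE \<omega> in completion M. continuous_on {0..} (\<lambda>t. ?N t \<omega>)"
    using pathsC A_cont by eventually_elim (intro continuous_intros)
  have N_incr: "AE \<omega> in completion M. ?N t \<omega> - ?N s \<omega> = innovation s t \<omega>" if "0 \<le> s" "s \<le> t" for s t
    using XBC AE_drift_integrable
  proof eventually_elim
    case (elim \<omega>)
    have "compensator 0 t \<omega> - compensator 0 s \<omega> = compensator s t \<omega>"
      unfolding compensator_def by (rule indefinite_integral_diff) (use elim that in auto)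
    then show ?case using elim that by (simp add: innovation_def)
  qed
  have orth: "C.expectation (\<lambda>\<omega>. innovation s t \<omega> * indicator A \<omega>) = 0"
    if s: "0 \<le> s" "s < t" and A: "A \<in> sets (?F s)" for s t A
  proof (rule innovation_orthogonal_right_limit[OF s])
    show "A \<in> sets (completion M)" using A aug(1)[of "s + 1"] unfolding aug(4) by auto
    fix u assume u: "s < u" "u \<le> t"
    let ?G = "{B r -` S \<inter> space M | r S. 0 \<le> r \<and> r \<le> u \<and> S \<in> sets borel}"
    have "A \<in> sigma_sets (space M) (sigma_sets (space M) ?G \<union> null_sets (completion M))"
      using A u unfolding aug(4) enlarged_sets_def nat(1) by auto
    also have "\<dots> \<subseteq> sigma_sets (space M) (?G \<union> null_sets (completion M))"
    proof (rule sigma_sets_mono)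
      have "sigma_sets (space M) ?G \<subseteq> sigma_sets (space M) (?G \<union> null_sets (completion M))"
        by (rule sigma_sets_mono') blast
      then show "sigma_sets (space M) ?G \<union> null_sets (completion M) \<subseteq> sigma_sets (space M) (?G \<union> null_sets (completion M))"
        by (auto intro: sigma_sets.Basic)
    qed
    finally have AG: "A \<in> sigma_sets (space (completion M)) (?G \<union> null_sets (completion M))" by simp
    show "C.expectation (\<lambda>\<omega>. innovation u t \<omega> * indicator A \<omega>) = 0"
    proof (rule innovation_orthogonal_sigma[OF _ u(2) _ _ AG])
      show "0 < u" using s u by simp
      show "?G \<union> null_sets (completion M) \<subseteq> sets (completion M)"
        using B(1) by (auto intro: measurable_sets)
      fix C assume "C \<in> ?G \<union> null_sets (completion M)"
      then show "C \<in> null_sets (completion M) \<or> (\<exists>r\<in>{0..u}. \<exists>S\<in>sets borel. AE \<omega> in completion M. (\<omega> \<in> C) = (X r \<omega> \<in> S))"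
      proof
        assume "C \<in> ?G"
        then obtain r S where r: "0 \<le> r" "r \<le> u" and S: "S \<in> sets borel" and C: "C = B r -` S \<inter> space M" by blast
        have "AE \<omega> in completion M. (\<omega> \<in> C) = (X r \<omega> \<in> S)"
          using XBC AE_space by eventually_elim (use r C in auto)
        then show ?thesis using r S by auto
      qed simp
    qed
  qed
  have subalg: "subalgebra (completion M) (?F s)" for s using filt by (simp add: filtered_prob_space_def)
  have N_meas: "?N t \<in> borel_measurable (completion M)" if "0 \<le> t" for t
    using NF[OF that] by (rule measurable_from_subalg[OF subalg])
  have N0: "AE \<omega> in completion M. ?N 0 \<omega> = 0" using comp0 by eventually_elim simp
  have N_int: "integrable (completion M) (?N t)" if t: "0 \<le> t" for t
  proof (rule integrable_cong_AE_imp[OF innovation_integrable[OF order_refl t]])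
    show "AE \<omega> in completion M. innovation 0 t \<omega> = ?N t \<omega>"
      using N_incr[OF order_refl t] N0 by eventually_elim simp
  qed (rule N_meas[OF t])
  have mart: "martingale (completion M) ?F (\<lambda>t \<omega>. ?N t \<omega> - ?N 0 \<omega>)"
    unfolding martingale_def adapted_def
  proof (intro conjI allI impI)
    fix t :: real assume t: "0 \<le> t"
    show "(\<lambda>\<omega>. ?N t \<omega> - ?N 0 \<omega>) \<in> borel_measurable (?F t)"
      by (rule borel_measurable_diff[OF NF[OF t] N0F[OF t]])
    show "integrable (completion M) (\<lambda>\<omega>. ?N t \<omega> - ?N 0 \<omega>)"
      by (intro Bochner_Integration.integrable_diff N_int t order_refl)
  next
    fix s t :: real assume st: "0 \<le> s \<and> s \<le> t"
    then have s: "0 \<le> s" and t: "0 \<le> t" by auto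
    interpret S: finite_measure_subalgebra "completion M" "?F s"
      using subalg[of s] by unfold_locales
    let ?D = "\<lambda>t \<omega>. ?N t \<omega> - ?N 0 \<omega>"
    have Di: "integrable (completion M) (?D r)" if "0 \<le> r" for r
      by (intro Bochner_Integration.integrable_diff N_int that order_refl)
    show "AE \<omega> in completion M. real_cond_exp (completion M) (?F s) (?D t) \<omega> = ?D s \<omega>"
    proof (rule S.real_cond_exp_charact)
      show "?D s \<in> borel_measurable (?F s)"
        by (rule borel_measurable_diff[OF NF[OF s] N0F[OF s]])
      fix A assume A: "A \<in> sets (?F s)"
      have AC: "A \<in> sets (completion M)" using A subalg[of s] by (auto simp: subalgebra_def)
      have si: "integrable (completion M) (\<lambda>\<omega>. indicator A \<omega> *\<^sub>R ?D r \<omega>)" if "0 \<le> r" for r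
        by (rule integrable_mult_indicator[OF AC Di[OF that]])
      have "(\<integral>\<omega>. indicator A \<omega> *\<^sub>R ?D t \<omega> \<partial>completion M) - (\<integral>\<omega>. indicator A \<omega> *\<^sub>R ?D s \<omega> \<partial>completion M)
        = (\<integral>\<omega>. indicator A \<omega> *\<^sub>R ?D t \<omega> - indicator A \<omega> *\<^sub>R ?D s \<omega> \<partial>completion M)"
        by (rule Bochner_Integration.integral_diff[symmetric, OF si[OF t] si[OF s]])
      also have "\<dots> = C.expectation (\<lambda>\<omega>. innovation s t \<omega> * indicator A \<omega>)"
      proof (rule integral_cong_AE)
        show "AE \<omega> in completion M. indicator A \<omega> *\<^sub>R ?D t \<omega> - indicator A \<omega> *\<^sub>R ?D s \<omega> = innovation s t \<omega> * indicator A \<omega>"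
          using N_incr[of s t] st by (auto simp: indicator_def elim!: eventually_mono)
        show "(\<lambda>\<omega>. indicator A \<omega> *\<^sub>R ?D t \<omega> - indicator A \<omega> *\<^sub>R ?D s \<omega>) \<in> borel_measurable (completion M)"
          by (intro borel_measurable_diff borel_measurable_integrable si s t)
        show "(\<lambda>\<omega>. innovation s t \<omega> * indicator A \<omega>) \<in> borel_measurable (completion M)"
          using innovation_integrable[of s t] st AC by (intro borel_measurable_times) auto
      qed
      also have "\<dots> = 0"
      proof (cases "s < t")
        case True then show ?thesis using s A by (intro orth)
      next
        case False
        with st have "t = s" by simp
        have "AE \<omega> in completion M. innovation s s \<omega> = 0" using N_incr[of s s] s by (auto elim!: eventually_mono)
        then show ?thesis unfolding \<open>t = s\<close> by (intro integral_eq_zero_AE) (auto elim!: eventually_mono)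
      qed
      finally show "(LINT \<omega>:A|completion M. ?D t \<omega>) = (LINT \<omega>:A|completion M. ?D s \<omega>)"
        by (simp add: set_lebesgue_integral_def)
    qed (intro Di s t)+
  qed
  have stop: "stopped (\<lambda>_. \<infinity>) ?N t \<omega> = ?N t \<omega>" if "0 \<le> t" for t \<omega>
    using that by (simp add: stopped_def)
  have "local_martingale (completion M) ?F ?N"
    unfolding local_martingale_def
  \<comment> \<open>The martingale part is a true martingale, so stopping at infinity localises it.\<close>
  proof (intro conjI exI[of _ "\<lambda>_ _. \<infinity>"] allI)
    show "adapted ?F ?N" using NF by (simp add: adapted_def)
    show "AE \<omega> in completion M. cadlag (\<lambda>t. ?N t \<omega>)" using N_cont by eventually_elim (rule continuous_imp_cadlag)
    show "ext_stopping_time ?F (\<lambda>_. \<infinity>)" by (simp add: ext_stopping_time_def)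
    show "AE \<omega> in completion M. incseq (\<lambda>n::nat. \<infinity>::ennreal) \<and> (\<lambda>n::nat. \<infinity>::ennreal) \<longlonglongrightarrow> \<infinity>"
      by (simp add: incseq_def)
    show "martingale (completion M) ?F (\<lambda>t \<omega>. stopped (\<lambda>_. \<infinity>) ?N t \<omega> - ?N 0 \<omega>)"
      using mart stop by (simp add: martingale_def adapted_def)
  qed
  moreover have "finite_variation_process (completion M) ?F (compensator 0)"
    unfolding finite_variation_process_def adapted_def
  proof (intro conjI allI impI AF)
    show "AE \<omega> in completion M. cadlag (\<lambda>t. compensator 0 t \<omega>) \<and> locally_finite_variation (\<lambda>t. compensator 0 t \<omega>)"
      using A_cont A_fv by eventually_elim (auto intro: continuous_imp_cadlag)
  qed
  moreover have "AE \<omega> in completion M. ?N 0 \<omega> = 0 \<and> compensator 0 0 \<omega> = 0 \<and>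
      (\<forall>t\<ge>0. B t \<omega> = B 0 \<omega> + ?N t \<omega> + compensator 0 t \<omega>)"
    using comp0 by eventually_elim auto
  moreover have "adapted ?F B" using BF by (simp add: adapted_def)
  ultimately show ?thesis
    unfolding semimartingale_def using filt by blast
qed

end
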